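(* Let $\Theta$ be an open subset of $\mathbb R^p$. Suppose each agent's model is a canonical exponential family, $p_\theta^j(x)=h(x)\exp(\langle\theta,T^j(x)\rangle-\psi^j(\theta))$ for $\theta\in\Theta$, $j\in[m]$, and the prior $\Pi$ has density $\pi(\theta)=g(u)\exp(\langle\theta,u\rangle-\psi^0(\theta))$ on $\Theta$. Assume there is $\theta_0\in\Theta$ with $\mathbb P_0=\mathbb P_{\theta_0}^j$ for every $j\in[m]$. Assume the communication graph is static and undirected, $G_t=G=([m],E)$, with weighted adjacency matrix $A$ symmetric and row stochastic with positive diagonal entries, and $G$ connected; and assume $\mathbb P_0|\log p_\theta^j|<\infty$ for every $j\in[m]$, $\theta\in\Theta$. Let $$\chi_t^j=\sum_{k=1}^t\sum_{i=1}^m[A^{t-k}]_{ji}T^i(X_k^i),\qquad B_t^j(\theta)=\sum_{k=1}^t\sum_{i=1}^m[A^{t-k}]_{ji}\psi^i(\theta),$$ and let the sequence of estimators $\hat\theta_t^j$ be defined by $$\hat\theta_t^j=(\nabla_\theta B_t^j)^{-1}(\chi_t^j).$$ Let $q_t^j$ be the density of $\sqrt t(\theta-\hat\theta_t^j)$ when $\theta\sim P_t^j$, and let $\varphi$ be the density of $N(0,V_{\theta_0}^{-1})$, where $V_{\theta_0}=\frac1m\sum_{i=1}^m\mathrm{Cov}(T^i)$ with $\mathrm{Cov}(T^i)$ the covariance matrix of $T^i$ evaluated at $\theta_0$. Then $$\int_{\mathbb R^p}|q_t^j(x)-\varphi(x)|\,dx\to0\quad\text{in }\mathbb P_0\tex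t{-probability}.$$
   Context: There are $m$ agents, $[m]=\{1,\dots,m\}$. The observations $X_k^j$ ($k\ge1$ time, $j\in[m]$ agent) are i.i.d. with law $\mathbb P_0$ on a measurable space $\mathcal X$; $\mathbb P_0$ also denotes the joint law of all observations and $\mathbb P_0 g$ the expectation of $g$. $T^j:\mathcal X\to\mathbb R^p$ are sufficient statistics; $h$, $\psi^j$, $g$, $\psi^0$ are normalizing functions and $u\in\mathbb R^p$ is a prior hyperparameter. It is assumed that $\theta_0$ is the unique minimizer over $\Theta$ of $\sum_{j=1}^mD_{KL}(\mathbb P_0\parallel\mathbb P_\theta^j)$ ($D_{KL}$ the Kullback–Leibler divergence). The estimator $\hat\theta_t^j$ is the closed form of the M-estimator maximizing $\langle\theta,\chi_t^j\rangle-B_t^j(\theta)$ over $\theta$; its existence for all $t,j$ is taken for granted. The distributed Bayes posterior of agent $j$ at time $t$ is the probability measure $$P_t^j(B)=\frac1{z_t^j}\int_B\prod_{k=1}^t\prod_{i=1}^mp_\theta^i(X_k^i)^{[A^{t-k}]_{ij}}\,\pi(\theta)\,d\theta,$$ with $A^0$ the identity and $z_t^j$ the same integral over $\Theta$, assumed finite.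
   Formalization: The normalizing function ψ^0 of the prior is additionally assumed continuous at θ_0; without it a prior density that jumps across a hyperplane through θ_0 makes the convergence to the normal density fail. *)

theory Defs
  imports "HOL-Probability.Probability"
begin

(* On real^'n^'n the class operation * is not the matrix product, so the library's ^ cannot be used. *)
primrec matrix_power :: "real^'m^'m \<Rightarrow> nat \<Rightarrow> real^'m^'m" where
  "matrix_power A 0 = mat 1"
| "matrix_power A (Suc n) = A ** matrix_power A n"

(* A is a weighted adjacency matrix of (UNIV, E). Only off-diagonal entries are tied to E, so it
   does not matter whether E records self-loops. *)
definition weighted_adjacency :: "('m::finite \<times> 'm) set \<Rightarrow> real^'m^'m \<Rightarrow> bool" where
  "weighted_adjacency E A \<longleftrightarrow>
     (\<forall>i j. 0 \<le> A $ i $ j) \<and> (\<forall>i j. i \<noteq> j \<longrightarrow> (0 < A $ i $ j \<longleftrightarrow> (i, j) \<in> E))"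

definition row_stochastic :: "real^'m^'m \<Rightarrow> bool" where
  "row_stochastic A \<longleftrightarrow> (\<forall>i j. 0 \<le> A $ i $ j) \<and> (\<forall>i. (\<Sum>j\<in>UNIV. A $ i $ j) = 1)"

definition expfam_density ::
  "('x \<Rightarrow> real) \<Rightarrow> ('x \<Rightarrow> real^'p) \<Rightarrow> (real^'p \<Rightarrow> real) \<Rightarrow> real^'p \<Rightarrow> 'x \<Rightarrow> real" where
  "expfam_density h T \<psi> \<theta> x = h x * exp (\<theta> \<bullet> T x - \<psi> \<theta>)"

definition prior_density ::
  "(real^'p \<Rightarrow> real) \<Rightarrow> (real^'p \<Rightarrow> real) \<Rightarrow> real^'p \<Rightarrow> real^'p \<Rightarrow> real" where
  "prior_density g \<psi>0 u \<theta> = g u * exp (\<theta> \<bullet> u - \<psi>0 \<theta>)"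

(* The data x k i are the observation of agent i at time k = 1, 2, ...
   0 powr 0 = 0 here, whereas the usual convention for a zero weight is p^0 = 1; the two differ only
   where some density vanishes, and for exponential families that is a null event. *)
definition posterior_weight ::
  "real^'m^'m \<Rightarrow> ('m \<Rightarrow> real^'p \<Rightarrow> 'x \<Rightarrow> real) \<Rightarrow> (real^'p \<Rightarrow> real) \<Rightarrow>
   (nat \<Rightarrow> 'm \<Rightarrow> 'x) \<Rightarrow> nat \<Rightarrow> 'm \<Rightarrow> real^'p \<Rightarrow> real" where
  "posterior_weight A p \<pi> x t j \<theta> =
     (\<Prod>k=1..t. \<Prod>i\<in>UNIV. p i \<theta> (x k i) powr (matrix_power A (t - k) $ i $ j)) * \<pi> \<theta>"

definition posterior_normalizer ::
  "(real^'p) set \<Rightarrow> real^'m^'m \<Rightarrow> ('m \<Rightarrow> real^'p \<Rightarrow> 'x \<Rightarrow> real) \<Rightarrow> (real^'p \<Rightarrow> real) \<Rightarrow>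
   (nat \<Rightarrow> 'm \<Rightarrow> 'x) \<Rightarrow> nat \<Rightarrow> 'm \<Rightarrow> ennreal" where
  "posterior_normalizer \<Theta> A p \<pi> x t j =
     (\<integral>\<^sup>+\<theta>. ennreal (posterior_weight A p \<pi> x t j \<theta>) * indicator \<Theta> \<theta> \<partial>lborel)"

definition posterior ::
  "(real^'p) set \<Rightarrow> real^'m^'m \<Rightarrow> ('m \<Rightarrow> real^'p \<Rightarrow> 'x \<Rightarrow> real) \<Rightarrow> (real^'p \<Rightarrow> real) \<Rightarrow>
   (nat \<Rightarrow> 'm \<Rightarrow> 'x) \<Rightarrow> nat \<Rightarrow> 'm \<Rightarrow> (real^'p) measure" where
  "posterior \<Theta> A p \<pi> x t j = density lborel
     (\<lambda>\<theta>. ennreal (posterior_weight A p \<pi> x t j \<theta>) * indicator \<Theta> \<theta> / posterior_normalizer \<Theta> A p \<pi> x t j)"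

definition chi_stat ::
  "real^'m^'m \<Rightarrow> ('m \<Rightarrow> 'x \<Rightarrow> real^'p) \<Rightarrow> (nat \<Rightarrow> 'm \<Rightarrow> 'x) \<Rightarrow> nat \<Rightarrow> 'm \<Rightarrow> real^'p" where
  "chi_stat A T x t j = (\<Sum>k=1..t. \<Sum>i\<in>UNIV. (matrix_power A (t - k) $ j $ i) *\<^sub>R T i (x k i))"

definition B_fun ::
  "real^'m^'m \<Rightarrow> ('m \<Rightarrow> real^'p \<Rightarrow> real) \<Rightarrow> nat \<Rightarrow> 'm \<Rightarrow> real^'p \<Rightarrow> real" where
  "B_fun A \<psi> t j \<theta> = (\<Sum>k=1..t. \<Sum>i\<in>UNIV. (matrix_power A (t - k) $ j $ i) * \<psi> i \<theta>)"

definition gradient :: "('a::real_inner \<Rightarrow> real) \<Rightarrow> 'a \<Rightarrow> 'a" where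
  "gradient f x = (THE D. GDERIV f x :> D)"

(* The inverse of the gradient map on \<Theta>; meaningful when chi_stat lies in the image of \<Theta>. *)
definition theta_hat ::
  "(real^'p) set \<Rightarrow> real^'m^'m \<Rightarrow> ('m \<Rightarrow> 'x \<Rightarrow> real^'p) \<Rightarrow> ('m \<Rightarrow> real^'p \<Rightarrow> real) \<Rightarrow>
   (nat \<Rightarrow> 'm \<Rightarrow> 'x) \<Rightarrow> nat \<Rightarrow> 'm \<Rightarrow> real^'p" where
  "theta_hat \<Theta> A T \<psi> x t j = inv_into \<Theta> (gradient (B_fun A \<psi> t j)) (chi_stat A T x t j)"

(* Lebesgue density of sqrt t * (\<theta> - c) when \<theta> is distributed according to P. *)
definition rescaled_density :: "(real^'p) measure \<Rightarrow> real^'p \<Rightarrow> nat \<Rightarrow> real^'p \<Rightarrow> real" where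
  "rescaled_density P c t y =
     enn2real (RN_deriv lborel (distr P lborel (\<lambda>\<theta>. sqrt (real t) *\<^sub>R (\<theta> - c))) y)"

definition cov_matrix :: "'x measure \<Rightarrow> ('x \<Rightarrow> real^'p) \<Rightarrow> real^'p^'p" where
  "cov_matrix N T = (\<chi> a b. \<integral>x. (T x $ a - (\<integral>y. T y $ a \<partial>N)) * (T x $ b - (\<integral>y. T y $ b \<partial>N)) \<partial>N)"

definition mvnormal_density :: "real^'p \<Rightarrow> real^'p^'p \<Rightarrow> real^'p \<Rightarrow> real" where
  "mvnormal_density \<mu> \<Sigma> x =
     exp (- ((x - \<mu>) \<bullet> (matrix_inv \<Sigma> *v (x - \<mu>))) / 2) / sqrt ((2 * pi) ^ CARD('p) * det \<Sigma>)"

(* Outer probability agrees with probability on measurable events, and never makes the claim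
   easier when measurability of Y t is not known. *)
definition tendsto_in_probability :: "'w measure \<Rightarrow> (nat \<Rightarrow> 'w \<Rightarrow> real) \<Rightarrow> real \<Rightarrow> bool" where
  "tendsto_in_probability M Y c \<longleftrightarrow>
     (\<forall>\<epsilon>>0. (\<lambda>t. outer_measure_of M {\<omega> \<in> space M. \<epsilon> \<le> \<bar>Y t \<omega> - c\<bar>}) \<longlonglongrightarrow> 0)"

end

(* Write theta_hat for the estimator and D_i(a, d) = psi_i(a + d) - psi_i(a) - d . grad psi_i(a) for the
   Bregman divergence of the log-partition function. Since grad B_t(theta_hat) = chi_t, the posterior
   density at theta_hat + d is proportional to exp(- sum_i C_i D_i(theta_hat, d)) pi(theta_hat + d), where
   C_i is the total weight of agent i up to time t. The Cesaro means of the powers of A tend to 1/m, so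
   C_i / t -> 1/m; hence once theta_hat is near theta0 the rescaled density converges pointwise to
   exp(- y.Vy/2) pi(theta0). Near theta_hat it is dominated by a Gaussian, and by convexity the
   D_i grow at least linearly away from theta_hat, which makes the tail exponentially small in t; this
   gives L1 convergence without using that Theta is convex or connected. The same growth shows that
   theta_hat is far from theta0 only if chi_t / t deviates from its mean, which has small
   probability by Chebyshev's inequality. V is positive definite because a direction d with
   d.Vd = 0 would not change the model, against the uniqueness of the Kullback-Leibler minimizer. *)

theory Submission
  imports Defs
begin

section \<open>Averages of the powers of the weight matrix\<close>

text \<open>Observations at different times carry different weights, but the exponent of the
  posterior and the gradient equation see each agent only through its total weight; hence averages
  of powers of \<open>A\<close> matter, not single powers. Nothing is known about measurability of
  \<open>theta_hat\<close>, a value of \<open>inv_into\<close>, so randomness is kept out of the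
  analysis: L1 closeness is shown for all base points, times and weight vectors within one common
  \<open>\<delta>\<close> of their limits, and evaluated pathwise. Dominated convergence speaks
  about sequences, so this uniform form is reached by contradiction. The only random quantity left
  is the deviation of \<open>chi_stat\<close> from its mean, whose exceptional event is measurable.
  In the tail the likelihood is compared with its value at the estimator: the ratio is at most
  \<open>exp (- c * t)\<close> and the prior has mass one, so the rescaling costs only the Jacobian
  \<open>sqrt t ^ p\<close>, which the exponential absorbs.\<close>

lemma matrix_power_nonneg: "row_stochastic A \<Longrightarrow> 0 \<le> matrix_power A n $ i $ j"
  by (induction n arbitrary: i j)
    (auto simp: row_stochastic_def matrix_matrix_mult_def mat_def intro!: sum_nonneg)

text \<open>Symmetry turns the row sums of \<open>A\<close> into column sums, so each column of a
  power is a probability vector on which \<open>A\<close> acts from the left.\<close>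

lemma column_sum_matrix_power:
  assumes "transpose A = A" "row_stochastic A"
  shows "(\<Sum>j\<in>UNIV. matrix_power A n $ j $ i) = 1"
proof (induction n)
  case 0
  show ?case by (simp add: mat_def)
next
  case (Suc n)
  have col: "(\<Sum>j\<in>UNIV. A $ j $ l) = 1" for l
  proof -
    have "A $ j $ l = A $ l $ j" for j
      using assms(1) by (metis transpose_def vec_lambda_beta)
    then show ?thesis using assms(2) by (simp add: row_stochastic_def)
  qed
  have "(\<Sum>j\<in>UNIV. matrix_power A (Suc n) $ j $ i)
    = (\<Sum>j\<in>UNIV. \<Sum>l\<in>UNIV. A $ j $ l * matrix_power A n $ l $ i)"
    by (simp add: matrix_matrix_mult_def)
  also have "\<dots> = (\<Sum>l\<in>UNIV. (\<Sum>j\<in>UNIV. A $ j $ l) * matrix_power A n $ l $ i)"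
    by (subst sum.swap) (simp add: sum_distrib_right)
  finally show ?case using Suc by (simp add: col)
qed

lemma matrix_power_le_1:
  assumes "transpose A = A" "row_stochastic A"
  shows "matrix_power A n $ j $ i \<le> 1"
  using member_le_sum[of j UNIV "\<lambda>j. matrix_power A n $ j $ i"] column_sum_matrix_power[OF assms, of n i]
    matrix_power_nonneg[OF assms(2)] by auto

lemma matrix_power_symmetric:
  assumes "transpose A = A"
  shows "transpose (matrix_power A n) = matrix_power A n"
proof -
  have comm: "matrix_power A n ** A = A ** matrix_power A n" for n
    by (induction n) (simp_all add: matrix_mul_assoc[symmetric])
  show ?thesis
    by (induction n) (simp_all add: transpose_mat matrix_transpose_mul assms comm)
qed

text \<open>Maximum principle: each entry of \<open>A *v x\<close> is an average of entries of
  \<open>x\<close>. Where the maximum is attained, the average can equal it only if every neighbour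
  attains it as well, and connectedness spreads this to all vertices.\<close>

lemma harmonic_vector_constant:
  assumes conn: "\<And>i j. (i, j) \<in> E\<^sup>*" and "weighted_adjacency E A" "row_stochastic A" and eig: "A *v x = x"
  shows "x $ i = x $ j"
proof -
  define m where "m = Max (range (($) x))"
  have le: "x $ l \<le> m" for l unfolding m_def by (intro Max_ge) auto
  have "m \<in> range (($) x)" unfolding m_def by (intro Max_in) auto
  then obtain a where a: "x $ a = m" by auto
  have step: "x $ l = m" if "x $ k = m" "(k, l) \<in> E" for k l
  proof (cases "k = l")
    case False
    have pos: "A $ k $ l > 0" using assms(2) False that by (auto simp: weighted_adjacency_def)
    have "(\<Sum>j\<in>UNIV. A $ k $ j * (m - x $ j)) = m * (\<Sum>j\<in>UNIV. A $ k $ j) - (A *v x) $ k"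
      by (simp add: matrix_vector_mult_def right_diff_distrib sum_subtractf sum_distrib_left mult.commute)
    also have "\<dots> = 0" using assms(3) that by (simp add: eig row_stochastic_def)
    finally have "\<forall>j\<in>UNIV. A $ k $ j * (m - x $ j) = 0"
      using assms(3) le by (subst (asm) sum_nonneg_eq_0_iff) (auto simp: row_stochastic_def)
    then show ?thesis using pos by (metis UNIV_I eq_iff_diff_eq_0 less_irrefl mult_eq_0_iff)
  qed (use that in simp)
  have "x $ l = m" for l
    using conn[of a l] by (induction rule: rtrancl_induct) (use a step in blast)+
  then show ?thesis by simp
qed

text \<open>The average \<open>s t\<close> of the first \<open>t\<close> columns is almost fixed by
  \<open>A\<close>, because \<open>A *v s t - s t\<close> telescopes to
  \<open>(col t - col 0) / t\<close>. The only fixed probability vector is the uniform one, and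
  compactness turns "almost fixed" into convergence, without eigenvalues.\<close>

lemma matrix_power_Cesaro:
  fixes A :: "real^'m::finite^'m"
  assumes conn: "\<And>i j. (i, j) \<in> E\<^sup>*" and adj: "weighted_adjacency E A"
    and sym: "transpose A = A" and st: "row_stochastic A"
  shows "(\<lambda>t. (\<Sum>k=1..t. matrix_power A (t - k) $ j $ i) / real t) \<longlonglongrightarrow> 1 / real CARD('m)"
proof -
  define col :: "nat \<Rightarrow> real^'m" where "col n = (\<chi> j. matrix_power A n $ j $ i)" for n
  define s :: "nat \<Rightarrow> real^'m" where "s t = (1 / real t) *\<^sub>R (\<Sum>n<t. col n)" for t
  define L :: "real^'m" where "L = (\<chi> j. 1 / real CARD('m))"
  \<comment> \<open>The defect \<open>g\<close> measures how far a vector is from being fixed by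
    \<open>A\<close> with entries summing to one; its only zero is \<open>L\<close>.\<close>
  define g :: "real^'m \<Rightarrow> real" where "g x = norm (A *v x - x) + \<bar>(\<Sum>j\<in>UNIV. x $ j) - 1\<bar>" for x
  have col01: "0 \<le> col n $ j" "col n $ j \<le> 1" for n j
    using matrix_power_nonneg[OF st] matrix_power_le_1[OF sym st] by (auto simp: col_def)
  have Acol: "A *v col n = col (Suc n)" for n
    by (simp add: vec_eq_iff col_def matrix_vector_mult_def matrix_matrix_mult_def)
  have colsum: "(\<Sum>j\<in>UNIV. col n $ j) = 1" for n
    using column_sum_matrix_power[OF sym st] by (simp add: col_def)
  have s01: "0 \<le> s t $ j" "s t $ j \<le> 1" for t j
  proof -
    show "0 \<le> s t $ j" by (auto simp: s_def intro!: sum_nonneg divide_nonneg_nonneg col01)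
    have "(\<Sum>n<t. col n $ j) \<le> (\<Sum>n<t. 1)" by (intro sum_mono col01)
    then show "s t $ j \<le> 1" by (cases "t = 0") (auto simp: s_def field_simps)
  qed
  have ssum: "(\<Sum>j\<in>UNIV. s t $ j) = 1" if "t > 0" for t
  proof -
    have "(\<Sum>j\<in>UNIV. s t $ j) = (\<Sum>j\<in>UNIV. \<Sum>n<t. col n $ j) / t"
      by (simp add: s_def sum_divide_distrib)
    also have "(\<Sum>j\<in>UNIV. \<Sum>n<t. col n $ j) = t" by (subst sum.swap) (simp add: colsum)
    finally show ?thesis using that by simp
  qed
  have gs: "g (s t) \<le> 2 * real CARD('m) / t" if t: "t > 0" for t
  proof -
    have "A *v s t - s t = (1 / real t) *\<^sub>R (\<Sum>n<t. col (Suc n) - col n)"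
      by (simp add: s_def matrix_vector_mult_scaleR linear_sum[OF matrix_vector_mul_linear]
            Acol sum_subtractf scaleR_diff_right)
    also have "(\<Sum>n<t. col (Suc n) - col n) = col t - col 0" by (rule sum_lessThan_telescope)
    finally have "norm (A *v s t - s t) = norm (col t - col 0) / t" using t by simp
    also have "norm (col t - col 0) \<le> 2 * real CARD('m)"
    proof -
      have "norm (col n) \<le> real CARD('m)" for n
        using norm_le_l1_cart[of "col n"] colsum[of n] col01
        by (metis (no_types, lifting) abs_of_nonneg le_trans of_nat_1 of_nat_mono order_trans sum.cong zero_less_card_finite One_nat_def Suc_leI)
      then show ?thesis using norm_triangle_ineq4[of "col t" "col 0"] by (smt (verit))
    qed
    finally show ?thesis using t ssum[OF t] by (simp add: g_def divide_right_mono)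
  qed
  have g0: "(\<lambda>t. 2 * real CARD('m) / t) \<longlonglongrightarrow> 0" by real_asymp
  have gL: "x = L" if "g x = 0" for x
  proof -
    have x: "A *v x = x" "(\<Sum>j\<in>UNIV. x $ j) = 1" using that by (auto simp: g_def add_nonneg_eq_0_iff)
    have "x $ j = 1 / real CARD('m)" for j
    proof -
      have "(\<Sum>l\<in>UNIV. x $ l) = (\<Sum>l\<in>(UNIV :: 'm set). x $ j)"
        by (intro sum.cong refl harmonic_vector_constant[OF conn adj st x(1)])
      then show ?thesis using x(2) by (simp add: field_simps)
    qed
    then show ?thesis by (simp add: vec_eq_iff L_def)
  qed
  have "s \<longlonglongrightarrow> L"
  proof (rule tendstoI)
    fix e :: real assume e: "e > 0"
    \<comment> \<open>On this compact set \<open>g\<close> has a positive minimum, while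
      \<open>g (s t)\<close> is of order \<open>1 / t\<close>; so \<open>s t\<close> must eventually
      leave the set, that is, enter the ball.\<close>
    define K where "K = cbox 0 1 - ball L e"
    have K: "compact K" unfolding K_def by (intro compact_diff compact_cbox open_ball)
    have sK: "s t \<in> cbox 0 1" for t using s01 by (auto simp: mem_box_cart)
    have cont: "continuous_on K g" unfolding g_def by (intro continuous_intros)
    show "\<forall>\<^sub>F t in sequentially. dist (s t) L < e"
    proof (cases "K = {}")
      case True
      then have "s t \<in> ball L e" for t using sK unfolding K_def by blast
      then show ?thesis by (simp add: dist_commute)
    next
      case False
      then obtain x where x: "x \<in> K" "\<And>y. y \<in> K \<Longrightarrow> g x \<le> g y"
        using continuous_attains_inf[OF K False cont] by blast
      have "g x \<noteq> 0" using gL[of x] x(1) e by (auto simp: K_def)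
      then have "g x > 0" by (auto simp: g_def less_le)
      then have "\<forall>\<^sub>F t in sequentially. 2 * real CARD('m) / t < g x" by (rule order_tendstoD(2)[OF g0])
      then show ?thesis using eventually_gt_at_top[of 0]
      proof eventually_elim
        case (elim t)
        then have "s t \<notin> K" using gs[of t] x(2)[of "s t"] by linarith
        then show ?case using sK by (auto simp: K_def dist_commute)
      qed
    qed
  qed
  then have "(\<lambda>t. s t $ j) \<longlonglongrightarrow> L $ j" by (intro tendsto_intros)
  moreover have "s t $ j = (\<Sum>k=1..t. matrix_power A (t - k) $ j $ i) / real t" for t
  proof -
    have "(\<Sum>k=1..t. matrix_power A (t - k) $ j $ i) = (\<Sum>n<t. matrix_power A n $ j $ i)"
      by (rule sum.reindex_bij_witness[of _ "\<lambda>n. t - n" "\<lambda>k. t - k"]) auto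
    then show ?thesis by (simp add: s_def col_def)
  qed
  ultimately show ?thesis by (simp add: L_def)
qed

section \<open>Log-partition functions of exponential families\<close>

text \<open>Second-order remainder of \<open>exp\<close>, with the growth factor that an exponential
  moment can absorb. Everything comes from \<open>1 + x \<le> exp x\<close>, at \<open>z\<close> and
  at \<open>- z\<close>.\<close>

lemma abs_exp_minus_one_minus_le: "\<bar>exp z - 1 - z\<bar> \<le> z\<^sup>2 * exp \<bar>z\<bar>" for z :: real
proof -
  have 1: "exp z - 1 \<le> z * exp z"
  proof -
    have "(1 - z) * exp z \<le> exp (- z) * exp z"
      using exp_ge_add_one_self[of "- z"] by (intro mult_right_mono) auto
    also have "\<dots> = 1" by (simp add: exp_minus)
    finally show ?thesis by (simp add: algebra_simps)
  qed
  have 2: "0 \<le> exp z - 1 - z" using exp_ge_add_one_self[of z] by linarith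
  have "z * (exp z - 1) \<le> z\<^sup>2 * exp \<bar>z\<bar>"
  proof (cases "z \<ge> 0")
    case True
    then have "z * (exp z - 1) \<le> z * (z * exp z)" using 1 by (rule mult_left_mono[rotated])
    then show ?thesis using True by (simp add: power2_eq_square)
  next
    case False
    have "z * (exp z - 1) = (- z) * (1 - exp z)" by (simp add: algebra_simps)
    also have "\<dots> \<le> (- z) * (- z)"
      using False exp_ge_add_one_self[of z] by (intro mult_left_mono) linarith+
    also have "\<dots> \<le> z\<^sup>2 * exp \<bar>z\<bar>"
      by (simp add: power2_eq_square mult_le_cancel_left1)
    finally show ?thesis .
  qed
  moreover have "exp z - 1 - z \<le> z * (exp z - 1)" using 1 by (simp add: algebra_simps)
  ultimately show ?thesis using 2 by linarith
qed

text \<open>A single term of the exponential series; it trades powers of \<open>norm (T x)\<close>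
  for a small exponential factor.\<close>

lemma power_le_fact_exp: "0 \<le> z \<Longrightarrow> z ^ k \<le> fact k * exp z" for z :: real
proof -
  assume z: "0 \<le> z"
  have "z ^ k /\<^sub>R fact k \<le> (\<Sum>n. z ^ n /\<^sub>R fact n)"
    using sum_le_suminf[OF summable_exp_generic[of z], of "{k}"] z by simp
  then show ?thesis by (simp add: exp_def divide_simps mult.commute)
qed

text \<open>The norm is at most the dimension times the largest coordinate in absolute value, so one
  summand already dominates. This reduces an exponential moment of the norm to exponential moments
  in finitely many directions.\<close>

lemma exp_norm_le_sum_exp_Basis:
  fixes v :: "'a::euclidean_space"
  assumes "0 \<le> r"
  shows "exp (r * norm v) \<le> (\<Sum>b\<in>Basis. exp (r * DIM('a) * (b \<bullet> v)) + exp (- (r * DIM('a) * (b \<bullet> v))))"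
proof -
  have ne: "(Basis :: 'a set) \<noteq> {}" by simp
  define m where "m = Max ((\<lambda>b. \<bar>b \<bullet> v\<bar>) ` (Basis :: 'a set))"
  have "m \<in> (\<lambda>b. \<bar>b \<bullet> v\<bar>) ` (Basis :: 'a set)" unfolding m_def by (intro Max_in) (auto simp: ne)
  then obtain b :: 'a where b: "b \<in> Basis" "m = \<bar>b \<bullet> v\<bar>" by auto
  have "norm v \<le> (\<Sum>c\<in>Basis. \<bar>v \<bullet> c\<bar>)" by (rule norm_le_l1)
  also have "\<dots> \<le> (\<Sum>c\<in>(Basis::'a set). m)"
    unfolding m_def by (intro sum_mono Max_ge) (auto simp: inner_commute)
  also have "\<dots> = DIM('a) * \<bar>b \<bullet> v\<bar>" using b by simp
  finally have "r * norm v \<le> r * (DIM('a) * \<bar>b \<bullet> v\<bar>)" using assms by (intro mult_left_mono)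
  also have "\<dots> = \<bar>r * DIM('a) * (b \<bullet> v)\<bar>" using assms by (simp add: abs_mult)
  finally have "exp (r * norm v) \<le> exp \<bar>r * DIM('a) * (b \<bullet> v)\<bar>" by simp
  also have "\<dots> \<le> exp (r * DIM('a) * (b \<bullet> v)) + exp (- (r * DIM('a) * (b \<bullet> v)))"
    by (cases "r * DIM('a) * (b \<bullet> v) \<ge> 0") (simp_all add: abs_if)
  also have "\<dots> \<le> (\<Sum>b\<in>Basis. exp (r * DIM('a) * (b \<bullet> v)) + exp (- (r * DIM('a) * (b \<bullet> v))))"
    using b(1) by (intro member_le_sum[of b]) (auto intro: add_nonneg_nonneg)
  finally show ?thesis .
qed

text \<open>\<open>N\<close> stands for the measure with density \<open>h\<close>, so that
  normalization of the model reads as an identity for the Laplace transform of \<open>T\<close>.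
  \<open>N\<close> may have infinite mass.\<close>

locale exponential_family =
  fixes N :: "'x measure" and T :: "'x \<Rightarrow> 'a::euclidean_space" and \<Theta> :: "'a set" and \<psi> :: "'a \<Rightarrow> real"
  assumes open_Theta: "open \<Theta>"
    and T_measurable [measurable]: "T \<in> borel_measurable N"
    and integrable_exp: "\<And>\<theta>. \<theta> \<in> \<Theta> \<Longrightarrow> integrable N (\<lambda>x. exp (\<theta> \<bullet> T x))"
    and integral_exp: "\<And>\<theta>. \<theta> \<in> \<Theta> \<Longrightarrow> (\<integral>x. exp (\<theta> \<bullet> T x) \<partial>N) = exp (\<psi> \<theta>)"
begin

text \<open>Openness leaves room to move from \<open>\<theta>\<close> in each coordinate direction;
  the transforms at these finitely many nearby parameters dominate.\<close>

lemma integrable_exp_norm: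
  assumes "\<theta> \<in> \<Theta>"
  obtains r where "r > 0" "integrable N (\<lambda>x. exp (\<theta> \<bullet> T x + r * norm (T x)))"
proof -
  obtain e where e: "e > 0" "ball \<theta> e \<subseteq> \<Theta>"
    using open_Theta assms by (meson openE)
  \<comment> \<open>Chosen so that \<open>r * DIM('a)\<close> is \<open>e / 2\<close>, a
    displacement that keeps the parameter inside the ball.\<close>
  define r where "r = e / 2 / DIM('a)"
  have r: "r > 0" using e by (simp add: r_def)
  have rD: "r * DIM('a) = e / 2" by (simp add: r_def)
  have in\<Theta>: "\<theta> + (e/2) *\<^sub>R b \<in> \<Theta>" "\<theta> - (e/2) *\<^sub>R b \<in> \<Theta>" if "b \<in> Basis" for b
    using that e by (auto intro!: subsetD[OF e(2)] simp: dist_norm)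
  have "integrable N (\<lambda>x. \<Sum>b\<in>Basis. exp ((\<theta> + (e/2) *\<^sub>R b) \<bullet> T x) + exp ((\<theta> - (e/2) *\<^sub>R b) \<bullet> T x))"
    by (intro Bochner_Integration.integrable_sum Bochner_Integration.integrable_add integrable_exp in\<Theta>)
  then have "integrable N (\<lambda>x. exp (\<theta> \<bullet> T x + r * norm (T x)))"
  proof (rule Bochner_Integration.integrable_bound)
    show "AE x in N. norm (exp (\<theta> \<bullet> T x + r * norm (T x)))
        \<le> norm (\<Sum>b\<in>Basis. exp ((\<theta> + (e/2) *\<^sub>R b) \<bullet> T x) + exp ((\<theta> - (e/2) *\<^sub>R b) \<bullet> T x))"
    proof (rule AE_I2)
      fix x
      have "exp (\<theta> \<bullet> T x + r * norm (T x)) = exp (\<theta> \<bullet> T x) * exp (r * norm (T x))" by (simp add: exp_add)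
      also have "\<dots> \<le> exp (\<theta> \<bullet> T x) * (\<Sum>b\<in>Basis. exp ((e/2) * (b \<bullet> T x)) + exp (- ((e/2) * (b \<bullet> T x))))"
        using exp_norm_le_sum_exp_Basis[of r "T x"] r unfolding rD by (intro mult_left_mono) auto
      also have "\<dots> = (\<Sum>b\<in>Basis. exp ((\<theta> + (e/2) *\<^sub>R b) \<bullet> T x) + exp ((\<theta> - (e/2) *\<^sub>R b) \<bullet> T x))"
        by (simp add: sum_distrib_left inner_add_left inner_diff_left distrib_left flip: exp_add)
      finally show "norm (exp (\<theta> \<bullet> T x + r * norm (T x)))
        \<le> norm (\<Sum>b\<in>Basis. exp ((\<theta> + (e/2) *\<^sub>R b) \<bullet> T x) + exp ((\<theta> - (e/2) *\<^sub>R b) \<bullet> T x))"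
        by simp
    qed
  qed simp
  with r that show thesis by blast
qed

lemma integrable_power_norm_exp:
  assumes "\<theta> \<in> \<Theta>"
  obtains r where "r > 0" "\<And>k. integrable N (\<lambda>x. norm (T x) ^ k * exp (\<theta> \<bullet> T x + r * norm (T x)))"
proof -
  obtain R where R: "R > 0" "integrable N (\<lambda>x. exp (\<theta> \<bullet> T x + R * norm (T x)))"
    using integrable_exp_norm[OF assms] by blast
  \<comment> \<open>Half of the exponential margin is given up to absorb the power of the norm; the
    other half is kept for the remainder estimate of the derivative.\<close>
  define r where "r = R / 2"
  have "integrable N (\<lambda>x. norm (T x) ^ k * exp (\<theta> \<bullet> T x + r * norm (T x)))" for k
  proof (rule Bochner_Integration.integrable_bound)
    show "integrable N (\<lambda>x. (fact k / r ^ k) * exp (\<theta> \<bullet> T x + R * norm (T x)))"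
      using R by simp
    show "AE x in N. norm (norm (T x) ^ k * exp (\<theta> \<bullet> T x + r * norm (T x)))
      \<le> norm ((fact k / r ^ k) * exp (\<theta> \<bullet> T x + R * norm (T x)))"
    proof (rule AE_I2)
      fix x
      have "(r * norm (T x)) ^ k \<le> fact k * exp (r * norm (T x))"
        using R by (intro power_le_fact_exp) (simp add: r_def)
      then have "norm (T x) ^ k \<le> fact k / r ^ k * exp (r * norm (T x))"
        using R by (simp add: r_def power_mult_distrib field_simps)
      then have "norm (T x) ^ k * exp (\<theta> \<bullet> T x + r * norm (T x))
        \<le> fact k / r ^ k * exp (r * norm (T x)) * exp (\<theta> \<bullet> T x + r * norm (T x))"
        by (intro mult_right_mono) auto
      also have "\<dots> = fact k / r ^ k * exp (\<theta> \<bullet> T x + R * norm (T x))"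
        by (simp add: r_def flip: exp_add)
      finally show "norm (norm (T x) ^ k * exp (\<theta> \<bullet> T x + r * norm (T x)))
      \<le> norm ((fact k / r ^ k) * exp (\<theta> \<bullet> T x + R * norm (T x)))"
        using R by (simp add: r_def)
    qed
  qed simp
  moreover have "r > 0" using R by (simp add: r_def)
  ultimately show thesis using that by blast
qed

lemma integrable_poly_exp:
  assumes "\<theta> \<in> \<Theta>" and [measurable]: "f \<in> borel_measurable N" and "\<And>x. \<bar>f x\<bar> \<le> c * norm (T x) ^ k"
  shows "integrable N (\<lambda>x. f x * exp (\<theta> \<bullet> T x))"
proof -
  obtain r where r: "r > 0" "\<And>k. integrable N (\<lambda>x. norm (T x) ^ k * exp (\<theta> \<bullet> T x + r * norm (T x)))"
    using integrable_power_norm_exp[OF assms(1)] by blast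
  show ?thesis
  proof (rule Bochner_Integration.integrable_bound)
    show "integrable N (\<lambda>x. c * (norm (T x) ^ k * exp (\<theta> \<bullet> T x + r * norm (T x))))"
      using r by simp
    show "AE x in N. norm (f x * exp (\<theta> \<bullet> T x))
      \<le> norm (c * (norm (T x) ^ k * exp (\<theta> \<bullet> T x + r * norm (T x))))"
    proof (rule AE_I2)
      fix x
      have "\<bar>f x\<bar> * exp (\<theta> \<bullet> T x) \<le> (c * norm (T x) ^ k) * exp (\<theta> \<bullet> T x + r * norm (T x))"
        using assms(3)[of x] r by (intro mult_mono) (auto intro: order_trans[OF abs_ge_zero])
      then show "norm (f x * exp (\<theta> \<bullet> T x))
      \<le> norm (c * (norm (T x) ^ k * exp (\<theta> \<bullet> T x + r * norm (T x))))"
        unfolding real_norm_def abs_mult[of "f x"]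
        by (intro order_trans[OF _ abs_ge_self]) (simp add: mult.assoc)
    qed
  qed simp
qed

text \<open>The weight \<open>f\<close> is a parameter because differentiating in direction
  \<open>d\<close> multiplies it by \<open>d \<bullet> T x\<close>. The family is closed under
  differentiation, so one derivative lemma serves for every order.\<close>

definition laplace :: "('x \<Rightarrow> real) \<Rightarrow> 'a \<Rightarrow> real" where
  "laplace f \<theta> = (\<integral>x. f x * exp (\<theta> \<bullet> T x) \<partial>N)"

lemma abs_mult_inner_le:
  assumes "\<bar>y\<bar> \<le> c * norm (v::'a) ^ k"
  shows "\<bar>y * (d \<bullet> v)\<bar> \<le> (c * norm d) * norm v ^ Suc k"
proof -
  have "\<bar>y * (d \<bullet> v)\<bar> \<le> (c * norm v ^ k) * (norm d * norm v)"
    unfolding abs_mult using assms Cauchy_Schwarz_ineq2[of d v]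
    by (intro mult_mono) (auto intro: order_trans[OF abs_ge_zero])
  then show ?thesis by (simp add: algebra_simps)
qed

text \<open>Differentiation under the integral with an explicit remainder: with
  \<open>z = d \<bullet> T x\<close> and \<open>norm d < r\<close>, the factor
  \<open>exp \<bar>z\<bar>\<close> stays within the margin \<open>exp (r * norm (T x))\<close>, and
  \<open>z\<^sup>2\<close> supplies the quadratic factor in \<open>d\<close>.\<close>

lemma has_derivative_laplace:
  assumes \<theta>: "\<theta> \<in> \<Theta>" and f [measurable]: "f \<in> borel_measurable N" and bd: "\<And>x. \<bar>f x\<bar> \<le> c * norm (T x) ^ k"
  shows "(laplace f has_derivative (\<lambda>d. laplace (\<lambda>x. f x * (d \<bullet> T x)) \<theta>)) (at \<theta>)"
proof -
  obtain r where r: "r > 0" "\<And>k. integrable N (\<lambda>x. norm (T x) ^ k * exp (\<theta> \<bullet> T x + r * norm (T x)))"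
    using integrable_power_norm_exp[OF \<theta>] by blast
  obtain e0 where e0: "e0 > 0" "ball \<theta> e0 \<subseteq> \<Theta>" using open_Theta \<theta> by (meson openE)
  have int1: "integrable N (\<lambda>x. f x * (d \<bullet> T x) * exp (\<theta> \<bullet> T x))" for d
    by (rule integrable_poly_exp[OF \<theta> _ abs_mult_inner_le[OF bd]]) measurable
  have int0: "integrable N (\<lambda>x. f x * exp (t \<bullet> T x))" if "t \<in> \<Theta>" for t
    by (rule integrable_poly_exp[OF that f bd])
  have lin: "bounded_linear (\<lambda>d. laplace (\<lambda>x. f x * (d \<bullet> T x)) \<theta>)"
    unfolding linear_conv_bounded_linear[symmetric]
  proof (rule linearI)
    fix a b and s :: real
    show "laplace (\<lambda>x. f x * ((a + b) \<bullet> T x)) \<theta> = laplace (\<lambda>x. f x * (a \<bullet> T x)) \<theta> + laplace (\<lambda>x. f x * (b \<bullet> T x)) \<theta>"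
      unfolding laplace_def using int1[of a] int1[of b]
      by (subst Bochner_Integration.integral_add[symmetric]) (auto simp: algebra_simps inner_add_left)
    have "laplace (\<lambda>x. f x * ((s *\<^sub>R a) \<bullet> T x)) \<theta> = (\<integral>x. s * (f x * (a \<bullet> T x) * exp (\<theta> \<bullet> T x)) \<partial>N)"
      unfolding laplace_def by (intro Bochner_Integration.integral_cong) auto
    then show "laplace (\<lambda>x. f x * ((s *\<^sub>R a) \<bullet> T x)) \<theta> = s *\<^sub>R laplace (\<lambda>x. f x * (a \<bullet> T x)) \<theta>"
      by (simp add: laplace_def)
  qed
  \<comment> \<open>The exponent \<open>k + 2\<close> counts the growth of \<open>f\<close> and the
    two powers of \<open>norm (T x)\<close> contributed by \<open>z\<^sup>2\<close>.\<close>
  define K where "K = (\<integral>x. c * (norm (T x) ^ (k + 2) * exp (\<theta> \<bullet> T x + r * norm (T x))) \<partial>N)"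
  have bound: "\<bar>laplace f (\<theta> + d) - laplace f \<theta> - laplace (\<lambda>x. f x * (d \<bullet> T x)) \<theta>\<bar> \<le> (norm d)\<^sup>2 * K"
    if d: "norm d < min e0 r" for d
  proof -
    have t: "\<theta> + d \<in> \<Theta>" using d e0 by (auto intro!: subsetD[OF e0(2)] simp: dist_norm)
    have "laplace f (\<theta> + d) - laplace f \<theta> - laplace (\<lambda>x. f x * (d \<bullet> T x)) \<theta>
      = (\<integral>x. f x * exp ((\<theta> + d) \<bullet> T x) - f x * exp (\<theta> \<bullet> T x) - f x * (d \<bullet> T x) * exp (\<theta> \<bullet> T x) \<partial>N)"
      unfolding laplace_def using int0[OF t] int0[OF \<theta>] int1[of d] by simp
    also have "\<bar>\<dots>\<bar> \<le> (\<integral>x. (norm d)\<^sup>2 * (c * (norm (T x) ^ (k + 2) * exp (\<theta> \<bullet> T x + r * norm (T x)))) \<partial>N)"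
      unfolding real_norm_def[symmetric]
    proof (rule order_trans[OF integral_norm_bound integral_mono])
      show "integrable N (\<lambda>x. norm (f x * exp ((\<theta> + d) \<bullet> T x) - f x * exp (\<theta> \<bullet> T x) - f x * (d \<bullet> T x) * exp (\<theta> \<bullet> T x)))"
        using int0[OF t] int0[OF \<theta>] int1[of d] by auto
      show "integrable N (\<lambda>x. (norm d)\<^sup>2 * (c * (norm (T x) ^ (k + 2) * exp (\<theta> \<bullet> T x + r * norm (T x)))))"
        by (intro integrable_mult_right r)
      fix x
      let ?z = "d \<bullet> T x"
      have z: "\<bar>?z\<bar> \<le> norm d * norm (T x)" by (rule Cauchy_Schwarz_ineq2)
      have z2: "\<bar>?z\<bar> \<le> r * norm (T x)" using d by (intro order_trans[OF z] mult_right_mono) auto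
      have zz: "?z\<^sup>2 \<le> (norm d)\<^sup>2 * (norm (T x))\<^sup>2"
        using power_mono[OF z, of 2] by (simp add: power_mult_distrib)
      have "norm (f x * exp ((\<theta> + d) \<bullet> T x) - f x * exp (\<theta> \<bullet> T x) - f x * ?z * exp (\<theta> \<bullet> T x))
        = norm (f x * exp (\<theta> \<bullet> T x) * (exp ?z - 1 - ?z))"
        by (simp add: inner_add_left exp_add algebra_simps)
      also have "\<dots> = \<bar>f x\<bar> * exp (\<theta> \<bullet> T x) * \<bar>exp ?z - 1 - ?z\<bar>" by (simp add: abs_mult)
      also have "\<dots> \<le> \<bar>f x\<bar> * exp (\<theta> \<bullet> T x) * (?z\<^sup>2 * exp \<bar>?z\<bar>)"
        by (intro mult_left_mono abs_exp_minus_one_minus_le) auto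
      also have "\<dots> \<le> (c * norm (T x) ^ k) * exp (\<theta> \<bullet> T x) * (((norm d)\<^sup>2 * (norm (T x))\<^sup>2) * exp (r * norm (T x)))"
        using z2 zz bd[of x] by (intro mult_mono) (auto intro: order_trans[OF abs_ge_zero])
      also have "\<dots> = (norm d)\<^sup>2 * (c * (norm (T x) ^ (k + 2) * exp (\<theta> \<bullet> T x + r * norm (T x))))"
        by (simp only: exp_add power_add ac_simps)
      finally show "norm (f x * exp ((\<theta> + d) \<bullet> T x) - f x * exp (\<theta> \<bullet> T x) - f x * ?z * exp (\<theta> \<bullet> T x))
        \<le> (norm d)\<^sup>2 * (c * (norm (T x) ^ (k + 2) * exp (\<theta> \<bullet> T x + r * norm (T x))))" .
    qed
    also have "\<dots> = (norm d)\<^sup>2 * K" unfolding K_def by simp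
    finally show ?thesis .
  qed
  show ?thesis
    unfolding has_derivative_at_alt
  proof (intro conjI allI impI lin)
    fix e :: real assume e: "e > 0"
    \<comment> \<open>Within the last bound the remainder \<open>(norm d)\<^sup>2 * K\<close> is at
      most \<open>e * norm d\<close>; the summand 1 avoids a division by zero.\<close>
    define d0 where "d0 = min (min e0 r) (e / (\<bar>K\<bar> + 1))"
    have "d0 > 0" using e0 r e by (simp add: d0_def)
    moreover have "norm (laplace f y - laplace f \<theta> - laplace (\<lambda>x. f x * ((y - \<theta>) \<bullet> T x)) \<theta>) \<le> e * norm (y - \<theta>)"
      if "norm (y - \<theta>) < d0" for y
    proof -
      have "norm (laplace f y - laplace f \<theta> - laplace (\<lambda>x. f x * ((y - \<theta>) \<bullet> T x)) \<theta>) \<le> (norm (y - \<theta>))\<^sup>2 * K"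
        using bound[of "y - \<theta>"] that by (simp add: d0_def)
      also have "\<dots> \<le> norm (y - \<theta>) * (norm (y - \<theta>) * (\<bar>K\<bar> + 1))"
        unfolding power2_eq_square mult.assoc by (intro mult_left_mono) auto
      also have "\<dots> \<le> norm (y - \<theta>) * e"
        using that by (intro mult_left_mono) (auto simp: d0_def field_simps)
      finally show ?thesis by (simp add: mult.commute)
    qed
    ultimately show "\<exists>d>0. \<forall>y. norm (y - \<theta>) < d \<longrightarrow>
       norm (laplace f y - laplace f \<theta> - laplace (\<lambda>x. f x * ((y - \<theta>) \<bullet> T x)) \<theta>) \<le> e * norm (y - \<theta>)"
      by blast
  qed
qed

section \<open>Mean and covariance as derivatives of the log-partition function\<close>

definition mean_param :: "'a \<Rightarrow> 'a" where
  "mean_param \<theta> = (\<Sum>b\<in>Basis. (laplace (\<lambda>x. b \<bullet> T x) \<theta> / exp (\<psi> \<theta>)) *\<^sub>R b)"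

text \<open>The covariance of \<open>d \<bullet> T\<close> and \<open>e \<bullet> T\<close> at
  parameter \<open>\<theta>\<close>, in the form "second moment minus product of means" in which the
  Hessian of \<open>\<psi>\<close> comes out of the quotient rule.\<close>

definition cov_form :: "'a \<Rightarrow> 'a \<Rightarrow> 'a \<Rightarrow> real" where
  "cov_form \<theta> d e = laplace (\<lambda>x. (d \<bullet> T x) * (e \<bullet> T x)) \<theta> / exp (\<psi> \<theta>)
     - (laplace (\<lambda>x. d \<bullet> T x) \<theta> / exp (\<psi> \<theta>)) * (laplace (\<lambda>x. e \<bullet> T x) \<theta> / exp (\<psi> \<theta>))"

lemma laplace_1: "\<theta> \<in> \<Theta> \<Longrightarrow> laplace (\<lambda>_. 1) \<theta> = exp (\<psi> \<theta>)"
  by (simp add: laplace_def integral_exp)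

lemma abs_inner_le_power: "\<bar>d \<bullet> T x\<bar> \<le> norm d * norm (T x) ^ 1"
  using Cauchy_Schwarz_ineq2[of d "T x"] by simp

lemma abs_inner_mult_le_power: "\<bar>(d \<bullet> T x) * (e \<bullet> T x)\<bar> \<le> (norm d * norm e) * norm (T x) ^ 2"
  using abs_mult_inner_le[OF abs_inner_le_power, of d x e] by (simp add: power2_eq_square)

lemma integrable_inner_exp: "\<theta> \<in> \<Theta> \<Longrightarrow> integrable N (\<lambda>x. (d \<bullet> T x) * exp (\<theta> \<bullet> T x))"
  by (rule integrable_poly_exp[OF _ _ abs_inner_le_power]) auto

lemma integrable_inner_mult_exp:
  "\<theta> \<in> \<Theta> \<Longrightarrow> integrable N (\<lambda>x. ((d \<bullet> T x) * (e \<bullet> T x)) * exp (\<theta> \<bullet> T x))"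
  by (rule integrable_poly_exp[OF _ _ abs_inner_mult_le_power]) auto

lemma laplace_inner:
  assumes "\<theta> \<in> \<Theta>"
  shows "laplace (\<lambda>x. d \<bullet> T x) \<theta> = (\<Sum>b\<in>Basis. (d \<bullet> b) * laplace (\<lambda>x. b \<bullet> T x) \<theta>)"
proof -
  have "laplace (\<lambda>x. d \<bullet> T x) \<theta> = (\<integral>x. (\<Sum>b\<in>Basis. (d \<bullet> b) * ((b \<bullet> T x) * exp (\<theta> \<bullet> T x))) \<partial>N)"
  proof -
    have "d \<bullet> T x = (\<Sum>b\<in>Basis. (d \<bullet> b) * (b \<bullet> T x))" for x
      using euclidean_inner[of d "T x"] by (simp add: inner_commute)
    then show ?thesis unfolding laplace_def by (simp add: sum_distrib_right mult.assoc)
  qed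
  then show ?thesis
    using integrable_inner_exp[OF assms] by (simp add: laplace_def)
qed

lemma laplace_inner_mult:
  assumes "\<theta> \<in> \<Theta>"
  shows "laplace (\<lambda>x. (d \<bullet> T x) * (e \<bullet> T x)) \<theta>
    = (\<Sum>b\<in>Basis. \<Sum>c\<in>Basis. (d \<bullet> b) * (e \<bullet> c) * laplace (\<lambda>x. (b \<bullet> T x) * (c \<bullet> T x)) \<theta>)"
proof -
  have "(d \<bullet> T x) * (e \<bullet> T x) = (\<Sum>b\<in>Basis. \<Sum>c\<in>Basis. (d \<bullet> b) * (e \<bullet> c) * ((b \<bullet> T x) * (c \<bullet> T x)))" for x
  proof -
    have "(d \<bullet> T x) * (e \<bullet> T x) = (\<Sum>b\<in>Basis. (d \<bullet> b) * (b \<bullet> T x)) * (\<Sum>c\<in>Basis. (e \<bullet> c) * (c \<bullet> T x))"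
      using euclidean_inner[of d "T x"] euclidean_inner[of e "T x"] by (simp add: inner_commute)
    then show ?thesis unfolding sum_product by (simp add: mult_ac)
  qed
  then have "laplace (\<lambda>x. (d \<bullet> T x) * (e \<bullet> T x)) \<theta>
    = (\<integral>x. (\<Sum>b\<in>Basis. \<Sum>c\<in>Basis. (d \<bullet> b) * (e \<bullet> c) * (((b \<bullet> T x) * (c \<bullet> T x)) * exp (\<theta> \<bullet> T x))) \<partial>N)"
    unfolding laplace_def by (simp add: sum_distrib_right mult.assoc)
  then show ?thesis
    using integrable_inner_mult_exp[OF assms] by (simp add: laplace_def)
qed

lemma inner_mean_param:
  "\<theta> \<in> \<Theta> \<Longrightarrow> d \<bullet> mean_param \<theta> = laplace (\<lambda>x. d \<bullet> T x) \<theta> / exp (\<psi> \<theta>)"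
  by (subst laplace_inner) (simp_all add: mean_param_def inner_sum_right sum_divide_distrib mult.commute)

lemma cov_form_Basis:
  assumes "\<theta> \<in> \<Theta>"
  shows "cov_form \<theta> d e = (\<Sum>b\<in>Basis. \<Sum>c\<in>Basis. (d \<bullet> b) * (e \<bullet> c) * cov_form \<theta> b c)"
  unfolding cov_form_def laplace_inner_mult[OF assms, of d e] laplace_inner[OF assms, of d] laplace_inner[OF assms, of e]
  by (simp add: sum_divide_distrib sum_product right_diff_distrib sum_subtractf mult_ac)

lemma has_derivative_laplace_1:
  assumes "\<theta> \<in> \<Theta>"
  shows "(laplace (\<lambda>_. 1) has_derivative (\<lambda>d. laplace (\<lambda>x. d \<bullet> T x) \<theta>)) (at \<theta>)"
  using has_derivative_laplace[OF assms, of "\<lambda>_. 1" 1 0] by simp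

lemma GDERIV_log_partition:
  assumes \<theta>: "\<theta> \<in> \<Theta>"
  shows "GDERIV \<psi> \<theta> :> mean_param \<theta>"
proof -
  have "((\<lambda>t. ln (laplace (\<lambda>_. 1) t)) has_derivative (\<lambda>d. laplace (\<lambda>x. d \<bullet> T x) \<theta> * (1 / laplace (\<lambda>_. 1) \<theta>))) (at \<theta>)"
    by (rule has_derivative_eq_rhs, rule has_derivative_ln[OF _ has_derivative_laplace_1[OF \<theta>]])
      (auto simp: laplace_1[OF \<theta>] divide_inverse)
  then have "((\<lambda>t. ln (laplace (\<lambda>_. 1) t)) has_derivative (\<lambda>d. d \<bullet> mean_param \<theta>)) (at \<theta>)"
    by (simp add: inner_mean_param[OF \<theta>] laplace_1[OF \<theta>])
  then show ?thesis
    unfolding gderiv_def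
    by (rule has_derivative_transform_within_open[OF _ open_Theta \<theta>]) (simp add: laplace_1)
qed

text \<open>Jensen's inequality by hand: \<open>1 + x \<le> exp x\<close> at
  \<open>x = (b - a) \<bullet> T - m\<close>, integrated against the law at \<open>a\<close>, for
  which this \<open>x\<close> has mean zero. The segment from \<open>a\<close> to \<open>b\<close>
  never occurs, so it may leave \<open>\<Theta>\<close>.\<close>

lemma log_partition_convex:
  assumes a: "a \<in> \<Theta>" and b: "b \<in> \<Theta>"
  shows "\<psi> a + (b - a) \<bullet> mean_param a \<le> \<psi> b"
proof -
  define m where "m = (b - a) \<bullet> mean_param a"
  have "exp (m + \<psi> a) = exp m * (exp (\<psi> a) + laplace (\<lambda>x. (b - a) \<bullet> T x) a - m * exp (\<psi> a))"
    by (simp add: m_def inner_mean_param[OF a] exp_add)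
  also have "\<dots> = (\<integral>x. exp m * (exp (a \<bullet> T x) + ((b - a) \<bullet> T x) * exp (a \<bullet> T x) - m * exp (a \<bullet> T x)) \<partial>N)"
    unfolding laplace_def
    using integrable_exp[OF a] integrable_inner_exp[OF a, of "b - a"] by (simp add: integral_exp[OF a])
  also have "\<dots> \<le> (\<integral>x. exp (b \<bullet> T x) \<partial>N)"
  proof (rule integral_mono)
    show "integrable N (\<lambda>x. exp m * (exp (a \<bullet> T x) + ((b - a) \<bullet> T x) * exp (a \<bullet> T x) - m * exp (a \<bullet> T x)))"
      using integrable_exp[OF a] integrable_inner_exp[OF a, of "b - a"] by simp
    show "integrable N (\<lambda>x. exp (b \<bullet> T x))" by (rule integrable_exp[OF b])
    fix x
    let ?z = "(b - a) \<bullet> T x"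
    have "exp m * (exp (a \<bullet> T x) + ?z * exp (a \<bullet> T x) - m * exp (a \<bullet> T x))
      = (exp m * exp (a \<bullet> T x)) * (1 + (?z - m))" by (simp add: algebra_simps)
    also have "\<dots> \<le> (exp m * exp (a \<bullet> T x)) * exp (?z - m)"
      by (intro mult_left_mono exp_ge_add_one_self) auto
    also have "\<dots> = exp (b \<bullet> T x)" by (simp add: inner_diff_left flip: exp_add)
    finally show "exp m * (exp (a \<bullet> T x) + ?z * exp (a \<bullet> T x) - m * exp (a \<bullet> T x)) \<le> exp (b \<bullet> T x)" .
  qed
  also have "\<dots> = exp (\<psi> b)" by (rule integral_exp[OF b])
  finally show ?thesis by (simp add: m_def)
qed

lemma DERIV_laplace_line:
  assumes "a + s *\<^sub>R d \<in> \<Theta>" "f \<in> borel_measurable N" "\<And>x. \<bar>f x\<bar> \<le> c * norm (T x) ^ k"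
  shows "((\<lambda>s. laplace f (a + s *\<^sub>R d)) has_real_derivative laplace (\<lambda>x. f x * (d \<bullet> T x)) (a + s *\<^sub>R d)) (at s)"
proof -
  have 1: "((\<lambda>s. a + s *\<^sub>R d) has_derivative (\<lambda>h. h *\<^sub>R d)) (at s)"
    by (auto intro!: derivative_eq_intros)
  have "((\<lambda>s. laplace f (a + s *\<^sub>R d)) has_derivative
      (\<lambda>h. laplace (\<lambda>x. f x * ((h *\<^sub>R d) \<bullet> T x)) (a + s *\<^sub>R d))) (at s)"
    using has_derivative_compose[OF 1 has_derivative_laplace[OF assms]] by simp
  moreover have "laplace (\<lambda>x. f x * ((h *\<^sub>R d) \<bullet> T x)) t = h * laplace (\<lambda>x. f x * (d \<bullet> T x)) t" for h t
  proof -
    have "laplace (\<lambda>x. f x * ((h *\<^sub>R d) \<bullet> T x)) t = (\<integral>x. h * (f x * (d \<bullet> T x) * exp (t \<bullet> T x)) \<partial>N)"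
      unfolding laplace_def by (intro Bochner_Integration.integral_cong) auto
    then show ?thesis by (simp add: laplace_def)
  qed
  ultimately show ?thesis
    by (simp add: has_field_derivative_def mult_commute_abs)
qed

lemma log_partition_Taylor:
  assumes seg: "\<And>s. 0 \<le> s \<Longrightarrow> s \<le> 1 \<Longrightarrow> a + s *\<^sub>R d \<in> \<Theta>"
  obtains s where "0 < s" "s < 1"
    "\<psi> (a + d) = \<psi> a + d \<bullet> mean_param a + cov_form (a + s *\<^sub>R d) d d / 2"
proof -
  define M where "M s = laplace (\<lambda>_. 1) (a + s *\<^sub>R d)" for s
  define M1 where "M1 s = laplace (\<lambda>x. d \<bullet> T x) (a + s *\<^sub>R d)" for s
  define M2 where "M2 s = laplace (\<lambda>x. (d \<bullet> T x) * (d \<bullet> T x)) (a + s *\<^sub>R d)" for s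
  \<comment> \<open>The function \<open>ln (M s)\<close> and its first two derivatives; the second
    one is the variance of \<open>d \<bullet> T\<close> at the parameter
    \<open>a + s *\<^sub>R d\<close>.\<close>
  define df where "df k s = (if k = 0 then ln (M s) else if k = Suc 0 then M1 s / M s
     else (M2 s / M s - (M1 s / M s) * (M1 s / M s)))" for k :: nat and s
  have Mexp: "M s = exp (\<psi> (a + s *\<^sub>R d))" if "0 \<le> s" "s \<le> 1" for s
    unfolding M_def by (rule laplace_1[OF seg[OF that]])
  have D0: "(M has_real_derivative M1 s) (at s)" if "0 \<le> s" "s \<le> 1" for s
    using DERIV_laplace_line[OF seg[OF that], of "\<lambda>_. 1" 1 0] by (simp add: M_def[abs_def] M1_def)
  have D1: "(M1 has_real_derivative M2 s) (at s)" if "0 \<le> s" "s \<le> 1" for s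
    using DERIV_laplace_line[OF seg[OF that] _ abs_inner_le_power, of d] by (simp add: M2_def M1_def[abs_def])
  have "\<exists>t>0. t < 1 \<and> df 0 1 = (\<Sum>m<2. df m 0 / fact m * 1 ^ m) + df 2 t / fact 2 * 1 ^ 2"
  proof (rule Maclaurin)
    show "\<forall>m t. m < 2 \<and> 0 \<le> t \<and> t \<le> 1 \<longrightarrow> (df m has_real_derivative df (Suc m) t) (at t)"
    proof (intro allI impI)
      fix m :: nat and t :: real assume m: "m < 2 \<and> 0 \<le> t \<and> t \<le> 1"
      have pos: "M t > 0" using m by (simp add: Mexp)
      consider "m = 0" | "m = 1" using m by linarith
      then show "(df m has_real_derivative df (Suc m) t) (at t)"
      proof cases
        case 1
        then show ?thesis unfolding df_def using pos D0[of t] m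
          by (auto intro!: derivative_eq_intros)
      next
        case 2
        have "((\<lambda>s. M1 s / M s) has_real_derivative (M2 t * M t - M1 t * M1 t) / (M t * M t)) (at t)"
          using pos D0[of t] D1[of t] m by (intro DERIV_divide) auto
        moreover have "(M2 t * M t - M1 t * M1 t) / (M t * M t) = M2 t / M t - (M1 t / M t) * (M1 t / M t)"
          using pos by (simp add: field_simps)
        ultimately show ?thesis unfolding df_def using 2 by simp
      qed
    qed
  qed auto
  then obtain s where s: "0 < s" "s < 1" "df 0 1 = df 0 0 + df 1 0 + df 2 s / 2"
    by (auto simp: numeral_2_eq_2)
  have "df 0 1 = \<psi> (a + d)" "df 0 0 = \<psi> a" "df 1 0 = d \<bullet> mean_param a"
    using seg[of 0] by (auto simp: df_def Mexp M1_def inner_mean_param)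
  moreover have "df 2 s = cov_form (a + s *\<^sub>R d) d d"
    using s by (simp add: df_def Mexp M1_def M2_def cov_form_def)
  ultimately show thesis using s that by metis
qed

lemma isCont_log_partition: "\<theta> \<in> \<Theta> \<Longrightarrow> isCont \<psi> \<theta>"
  using GDERIV_log_partition unfolding gderiv_def by (rule has_derivative_continuous)

lemma isCont_laplace:
  assumes "\<theta> \<in> \<Theta>" "f \<in> borel_measurable N" "\<And>x. \<bar>f x\<bar> \<le> c * norm (T x) ^ k"
  shows "isCont (laplace f) \<theta>"
  using has_derivative_laplace[OF assms] by (rule has_derivative_continuous)

lemma isCont_cov_form:
  assumes "\<theta> \<in> \<Theta>"
  shows "isCont (\<lambda>t. cov_form t d e) \<theta>"
  unfolding cov_form_def
  using isCont_laplace[OF assms _ abs_inner_le_power] isCont_laplace[OF assms _ abs_inner_mult_le_power]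
    isCont_log_partition[OF assms]
  by (intro continuous_intros) auto

text \<open>Taylor's formula together with continuity of the covariance at \<open>\<theta>\<close>.
  The base point \<open>a\<close> varies, while the quadratic form stays the one at
  \<open>\<theta>\<close>; this uniformity is needed because the expansion is taken at the moving
  estimator.\<close>

lemma log_partition_quadratic:
  assumes \<theta>: "\<theta> \<in> \<Theta>" and \<eta>: "\<eta> > 0"
  obtains r where "r > 0" "ball \<theta> r \<subseteq> \<Theta>"
    "\<And>a d. a \<in> ball \<theta> r \<Longrightarrow> a + d \<in> ball \<theta> r \<Longrightarrow>
       \<bar>\<psi> (a + d) - \<psi> a - d \<bullet> mean_param a - cov_form \<theta> d d / 2\<bar> \<le> \<eta> * (norm d)\<^sup>2"
proof -
  \<comment> \<open>Entrywise distance of the two covariance forms; it controls their difference on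
    \<open>d\<close> by \<open>(norm d)\<^sup>2 * S t\<close> for every direction at once.\<close>
  define S where "S t = (\<Sum>b\<in>Basis. \<Sum>c\<in>Basis. \<bar>cov_form t b c - cov_form \<theta> b c\<bar>)" for t
  obtain e where e: "e > 0" "ball \<theta> e \<subseteq> \<Theta>" using open_Theta \<theta> by (meson openE)
  have "isCont S \<theta>" unfolding S_def using isCont_cov_form[OF \<theta>] by (intro continuous_intros) auto
  then have "(S \<longlongrightarrow> 0) (at \<theta>)" by (simp add: isCont_def S_def)
  then have "eventually (\<lambda>t. S t < \<eta>) (at \<theta>)" using \<eta> by (rule order_tendstoD)
  then obtain r0 where r0: "r0 > 0" "\<And>t. t \<noteq> \<theta> \<Longrightarrow> dist t \<theta> < r0 \<Longrightarrow> S t < \<eta>"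
    unfolding eventually_at by blast
  have S: "S t < \<eta>" if "dist t \<theta> < r0" for t
    using r0(2)[OF _ that] \<eta> by (cases "t = \<theta>") (auto simp: S_def)
  define r where "r = min e r0"
  have "\<bar>\<psi> (a + d) - \<psi> a - d \<bullet> mean_param a - cov_form \<theta> d d / 2\<bar> \<le> \<eta> * (norm d)\<^sup>2"
    if a: "a \<in> ball \<theta> r" and ad: "a + d \<in> ball \<theta> r" for a d
  proof -
    have seg: "a + s *\<^sub>R d \<in> ball \<theta> r" if "0 \<le> s" "s \<le> 1" for s
    proof -
      have "(1 - s) *\<^sub>R a + s *\<^sub>R (a + d) \<in> ball \<theta> r"
        using convex_ball[of \<theta> r] a ad that by (auto simp: convex_def)
      then show ?thesis by (simp add: algebra_simps)
    qed
    have seg\<Theta>: "a + s *\<^sub>R d \<in> \<Theta>" if "0 \<le> s" "s \<le> 1" for s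
      using seg[OF that] e by (auto simp: r_def)
    obtain s where s: "0 < s" "s < 1"
      "\<psi> (a + d) = \<psi> a + d \<bullet> mean_param a + cov_form (a + s *\<^sub>R d) d d / 2"
      using log_partition_Taylor[OF seg\<Theta>] by blast
    define t where "t = a + s *\<^sub>R d"
    have t: "t \<in> \<Theta>" "S t < \<eta>"
      using seg\<Theta>[of s] seg[of s] s S[of t] by (auto simp: t_def r_def dist_commute)
    have "\<bar>cov_form t d d - cov_form \<theta> d d\<bar>
      = \<bar>\<Sum>b\<in>Basis. \<Sum>c\<in>Basis. (d \<bullet> b) * (d \<bullet> c) * (cov_form t b c - cov_form \<theta> b c)\<bar>"
      unfolding cov_form_Basis[OF t(1), of d d] cov_form_Basis[OF \<theta>, of d d]
      by (simp add: right_diff_distrib sum_subtractf)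
    also have "\<dots> \<le> (\<Sum>b\<in>Basis. \<Sum>c\<in>Basis. (norm d)\<^sup>2 * \<bar>cov_form t b c - cov_form \<theta> b c\<bar>)"
    proof (intro order_trans[OF sum_abs] sum_mono)
      fix b c :: 'a assume bc: "b \<in> Basis" "c \<in> Basis"
      have "\<bar>d \<bullet> b\<bar> * \<bar>d \<bullet> c\<bar> \<le> norm d * norm d"
        using bc by (intro mult_mono) (auto simp: Basis_le_norm)
      then show "\<bar>(d \<bullet> b) * (d \<bullet> c) * (cov_form t b c - cov_form \<theta> b c)\<bar>
        \<le> (norm d)\<^sup>2 * \<bar>cov_form t b c - cov_form \<theta> b c\<bar>"
        unfolding abs_mult power2_eq_square by (intro mult_right_mono) auto
    qed
    also have "\<dots> = (norm d)\<^sup>2 * S t" by (simp add: S_def sum_distrib_left)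
    also have "\<dots> \<le> (norm d)\<^sup>2 * \<eta>" using t by (intro mult_left_mono) auto
    finally have *: "\<bar>cov_form t d d - cov_form \<theta> d d\<bar> \<le> \<eta> * (norm d)\<^sup>2" by (simp add: mult.commute)
    have "\<bar>\<psi> (a + d) - \<psi> a - d \<bullet> mean_param a - cov_form \<theta> d d / 2\<bar> = \<bar>cov_form t d d - cov_form \<theta> d d\<bar> / 2"
      using s(3) by (simp add: t_def flip: diff_divide_distrib)
    also have "\<dots> \<le> \<bar>cov_form t d d - cov_form \<theta> d d\<bar>" by simp
    finally show ?thesis using * by linarith
  qed
  moreover have "r > 0" "ball \<theta> r \<subseteq> \<Theta>" using e r0 by (auto simp: r_def)
  ultimately show thesis using that by blast
qed

end

section \<open>Gaussian integrals\<close>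

text \<open>Fubini with coordinate \<open>m\<close> innermost: since \<open>n\<close> differs from
  \<open>m\<close>, the shift \<open>c * (x \<bullet> n)\<close> is constant for the inner integral,
  which is invariant under translation.\<close>

lemma nn_integral_lborel_shear:
  fixes f :: "'a::euclidean_space \<Rightarrow> ennreal" and m n :: 'a
  assumes f [measurable]: "f \<in> borel_measurable borel" and mn: "m \<in> Basis" "n \<in> Basis" "m \<noteq> n"
  shows "(\<integral>\<^sup>+x. f (x + (c * (x \<bullet> n)) *\<^sub>R m) \<partial>lborel) = (\<integral>\<^sup>+x. f x \<partial>lborel)"
proof -
  interpret product_sigma_finite "\<lambda>_::'a. lborel :: real measure" by standard
  define J where "J = Basis - {m}"
  have J: "finite J" "m \<notin> J" "insert m J = Basis" "n \<in> J" using mn by (auto simp: J_def)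
  have coords: "(\<integral>\<^sup>+x. g x \<partial>lborel) =
      (\<integral>\<^sup>+y. (\<integral>\<^sup>+t. g ((\<Sum>b\<in>J. y b *\<^sub>R b) + t *\<^sub>R m) \<partial>lborel) \<partial>Pi\<^sub>M J (\<lambda>_. lborel))"
    if [measurable]: "g \<in> borel_measurable borel" for g :: "'a \<Rightarrow> ennreal"
  proof -
    have "(\<integral>\<^sup>+x. g x \<partial>lborel) = (\<integral>\<^sup>+y. g (\<Sum>b\<in>Basis. y b *\<^sub>R b) \<partial>Pi\<^sub>M Basis (\<lambda>_. lborel))"
      by (subst lborel_eq, subst nn_integral_distr) simp_all
    also have "\<dots> = (\<integral>\<^sup>+y. g (\<Sum>b\<in>insert m J. y b *\<^sub>R b) \<partial>Pi\<^sub>M (insert m J) (\<lambda>_. lborel))"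
      using J by simp
    also have "\<dots> = (\<integral>\<^sup>+y. (\<integral>\<^sup>+t. g (\<Sum>b\<in>insert m J. (y(m := t)) b *\<^sub>R b) \<partial>lborel) \<partial>Pi\<^sub>M J (\<lambda>_. lborel))"
      by (rule product_nn_integral_insert[OF J(1,2)]) measurable
    also have "\<dots> = (\<integral>\<^sup>+y. (\<integral>\<^sup>+t. g ((\<Sum>b\<in>J. y b *\<^sub>R b) + t *\<^sub>R m) \<partial>lborel) \<partial>Pi\<^sub>M J (\<lambda>_. lborel))"
    proof (intro nn_integral_cong)
      fix y :: "'a \<Rightarrow> real" and t :: real
      have "(\<Sum>b\<in>insert m J. (y(m := t)) b *\<^sub>R b) = t *\<^sub>R m + (\<Sum>b\<in>J. (y(m := t)) b *\<^sub>R b)"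
        unfolding sum.insert[OF J(1,2)] by simp
      also have "(\<Sum>b\<in>J. (y(m := t)) b *\<^sub>R b) = (\<Sum>b\<in>J. y b *\<^sub>R b)"
        using J by (intro sum.cong) auto
      finally show "g (\<Sum>b\<in>insert m J. (y(m := t)) b *\<^sub>R b) = g ((\<Sum>b\<in>J. y b *\<^sub>R b) + t *\<^sub>R m)"
        by (simp add: add.commute)
    qed
    finally show ?thesis .
  qed
  have "(\<integral>\<^sup>+x. f (x + (c * (x \<bullet> n)) *\<^sub>R m) \<partial>lborel)
     = (\<integral>\<^sup>+y. (\<integral>\<^sup>+t. f ((\<Sum>b\<in>J. y b *\<^sub>R b) + t *\<^sub>R m + (c * (((\<Sum>b\<in>J. y b *\<^sub>R b) + t *\<^sub>R m) \<bullet> n)) *\<^sub>R m) \<partial>lborel) \<partial>Pi\<^sub>M J (\<lambda>_. lborel))"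
    by (rule coords) measurable
  also have "\<dots> = (\<integral>\<^sup>+y. (\<integral>\<^sup>+t. f ((\<Sum>b\<in>J. y b *\<^sub>R b) + (c * y n + t) *\<^sub>R m) \<partial>lborel) \<partial>Pi\<^sub>M J (\<lambda>_. lborel))"
  proof -
    have "((\<Sum>b\<in>J. y b *\<^sub>R b) + t *\<^sub>R m) \<bullet> n = y n" for y t
    proof -
      have "((\<Sum>b\<in>J. y b *\<^sub>R b) + t *\<^sub>R m) \<bullet> n = (\<Sum>b\<in>J. y b * (b \<bullet> n))"
        using mn by (simp add: inner_add_left inner_sum_left inner_not_same_Basis)
      also have "\<dots> = (\<Sum>b\<in>J. if b = n then y b else 0)"
        using J mn by (intro sum.cong refl) (auto simp: inner_Basis J_def)
      also have "\<dots> = y n" using J by simp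
      finally show ?thesis .
    qed
    then show ?thesis by (simp add: algebra_simps)
  qed
  also have "\<dots> = (\<integral>\<^sup>+y. (\<integral>\<^sup>+t. f ((\<Sum>b\<in>J. y b *\<^sub>R b) + t *\<^sub>R m) \<partial>lborel) \<partial>Pi\<^sub>M J (\<lambda>_. lborel))"
  proof (rule nn_integral_cong)
    fix y :: "'a \<Rightarrow> real"
    show "(\<integral>\<^sup>+t. f ((\<Sum>b\<in>J. y b *\<^sub>R b) + (c * y n + t) *\<^sub>R m) \<partial>lborel)
      = (\<integral>\<^sup>+t. f ((\<Sum>b\<in>J. y b *\<^sub>R b) + t *\<^sub>R m) \<partial>lborel)"
      using nn_integral_real_affine[of "\<lambda>t. f ((\<Sum>b\<in>J. y b *\<^sub>R b) + t *\<^sub>R m)" 1 "c * y n"] by simp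
  qed
  also have "\<dots> = (\<integral>\<^sup>+x. f x \<partial>lborel)" by (subst coords[OF f]) simp
  finally show ?thesis .
qed

lemma borel_measurable_matrix_vector_mult [measurable]:
  fixes A :: "real^'n::finite^'n"
  shows "(\<lambda>x. A *v x) \<in> borel \<rightarrow>\<^sub>M borel"
  by (intro borel_measurable_continuous_onI linear_continuous_on matrix_vector_mul_bounded_linear)

text \<open>Lebesgue measure is characterized by its values on boxes, and a transposition of
  coordinates maps boxes to boxes with the same side lengths in another order.\<close>

lemma nn_integral_lborel_permute_coordinates:
  fixes f :: "real^'n::finite \<Rightarrow> ennreal"
  assumes f [measurable]: "f \<in> borel_measurable borel"
  shows "(\<integral>\<^sup>+x. f (\<chi> i. x $ Transposition.transpose m n i) \<partial>lborel) = (\<integral>\<^sup>+x. f x \<partial>lborel)"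
proof -
  define \<tau> where "\<tau> = Transposition.transpose m n"
  have \<tau>\<tau>: "\<tau> (\<tau> i) = i" for i by (simp add: \<tau>_def)
  have bij: "bij \<tau>" unfolding \<tau>_def by simp
  have [measurable]: "(\<lambda>x. (\<chi> i. x $ \<tau> i) :: real^'n) \<in> borel \<rightarrow>\<^sub>M borel"
    by (intro borel_measurable_continuous_onI continuous_intros)
  have "lborel = distr lborel borel (\<lambda>x. (\<chi> i. x $ \<tau> i) :: real^'n)"
  proof (rule lborel_eqI)
    fix l u :: "real^'n" assume le: "\<And>b. b \<in> Basis \<Longrightarrow> l \<bullet> b \<le> u \<bullet> b"
    have le': "l $ i \<le> u $ i" for i using le[of "axis i 1"] by (simp add: inner_axis)
    have pre: "(\<lambda>x. (\<chi> i. x $ \<tau> i) :: real^'n) -` box l u = box (\<chi> i. l $ \<tau> i) (\<chi> i. u $ \<tau> i)"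
      by (auto simp: mem_box_cart) (metis \<tau>\<tau>)+
    have P: "(\<Prod>b\<in>Basis. (u' - l') \<bullet> b) = (\<Prod>i\<in>UNIV. u' $ i - l' $ i)" for u' l' :: "real^'n"
    proof -
      have inj: "inj (\<lambda>i. axis i (1::real) :: real^'n)" by (auto simp: inj_on_def axis_eq_axis)
      have B: "Basis = range (\<lambda>i. axis i (1::real) :: real^'n)" by (auto simp: Basis_vec_def)
      show ?thesis unfolding B by (subst prod.reindex[OF inj]) (simp add: inner_axis)
    qed
    have "emeasure (distr lborel borel (\<lambda>x. (\<chi> i. x $ \<tau> i) :: real^'n)) (box l u)
      = emeasure lborel (box (\<chi> i. l $ \<tau> i) (\<chi> i. u $ \<tau> i) :: (real^'n) set)"
      by (subst emeasure_distr) (simp_all add: pre)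
    also have "\<dots> = (\<Prod>b\<in>Basis. ((\<chi> i. u $ \<tau> i) - (\<chi> i. l $ \<tau> i)) \<bullet> b)"
      using le' by (intro emeasure_lborel_box) (auto simp: Basis_vec_def inner_axis)
    also have "\<dots> = (\<Prod>i\<in>UNIV. u $ \<tau> i - l $ \<tau> i)" unfolding P by simp
    also have "\<dots> = (\<Prod>i\<in>UNIV. u $ i - l $ i)"
      using prod.reindex_bij_betw[OF bij, of "\<lambda>i. u $ i - l $ i"] by simp
    finally show "emeasure (distr lborel borel (\<lambda>x. (\<chi> i. x $ \<tau> i) :: real^'n)) (box l u)
      = (\<Prod>b\<in>Basis. (u - l) \<bullet> b)" by (simp add: P)
  qed simp
  then have "(\<integral>\<^sup>+x. f x \<partial>lborel) = (\<integral>\<^sup>+x. f x \<partial>distr lborel borel (\<lambda>x. (\<chi> i. x $ \<tau> i) :: real^'n))" by simp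
  also have "\<dots> = (\<integral>\<^sup>+x. f (\<chi> i. x $ \<tau> i) \<partial>lborel)" by (rule nn_integral_distr) simp_all
  finally show ?thesis by (simp add: \<tau>_def)
qed

text \<open>The linear change of variables in \<open>HOL-Analysis\<close> requires a well-ordered index type; this one does not.\<close>

lemma nn_integral_lborel_matrix:
  fixes A :: "real^'n::finite^'n"
  assumes "det A \<noteq> 0" "f \<in> borel_measurable borel"
  shows "(\<integral>\<^sup>+x. f x \<partial>lborel) = ennreal \<bar>det A\<bar> * (\<integral>\<^sup>+x. f (A *v x) \<partial>lborel)"
proof -
  define P where "P A \<longleftrightarrow> (det A \<noteq> 0 \<longrightarrow> (\<forall>f\<in>borel_measurable borel.
    (\<integral>\<^sup>+x. f x \<partial>lborel) = ennreal \<bar>det A\<bar> * (\<integral>\<^sup>+x. f (A *v x) \<partial>lborel)))" for A :: "real^'n^'n"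
  have "P A"
  \<comment> \<open>The formula is multiplicative in the matrix, so it is enough to treat products,
    a zero row, diagonal matrices, column transpositions and shears.\<close>
  proof (rule induct_matrix_elementary)
    fix A B :: "real^'n^'n" assume P: "P A" "P B"
    show "P (A ** B)" unfolding P_def
    proof (intro impI ballI)
      fix f :: "real^'n \<Rightarrow> ennreal" assume [measurable]: "f \<in> borel_measurable borel" and d: "det (A ** B) \<noteq> 0"
      have dd: "det A \<noteq> 0" "det B \<noteq> 0" using d by (auto simp: det_mul)
      have "(\<integral>\<^sup>+x. f x \<partial>lborel) = ennreal \<bar>det A\<bar> * (\<integral>\<^sup>+x. f (A *v x) \<partial>lborel)"
        by (rule P(1)[unfolded P_def, rule_format, OF dd(1)]) measurable
      also have "(\<integral>\<^sup>+x. f (A *v x) \<partial>lborel) = ennreal \<bar>det B\<bar> * (\<integral>\<^sup>+x. f (A *v (B *v x)) \<partial>lborel)"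
        by (rule P(2)[unfolded P_def, rule_format, OF dd(2)]) measurable
      finally show "(\<integral>\<^sup>+x. f x \<partial>lborel) = ennreal \<bar>det (A ** B)\<bar> * (\<integral>\<^sup>+x. f (A ** B *v x) \<partial>lborel)"
        by (simp add: det_mul abs_mult ennreal_mult mult.assoc matrix_vector_mul_assoc)
    qed
  next
    fix A :: "real^'n^'n" and i assume "row i A = 0"
    then show "P A" by (simp add: P_def det_zero_row)
  next
    fix A :: "real^'n^'n" assume diag: "\<And>i j. i \<noteq> j \<Longrightarrow> A $ i $ j = 0"
    have detA: "det A = (\<Prod>i\<in>UNIV. A $ i $ i)" by (rule det_diagonal[OF diag])
    show "P A" unfolding P_def
    proof (intro impI ballI)
      fix f :: "real^'n \<Rightarrow> ennreal" assume [measurable]: "f \<in> borel_measurable borel" and d: "det A \<noteq> 0"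
      define c where "c b = b \<bullet> (A *v b)" for b :: "real^'n"
      have inj: "inj (\<lambda>i. axis i (1::real) :: real^'n)" by (auto simp: inj_on_def axis_eq_axis)
      have B: "Basis = range (\<lambda>i. axis i (1::real) :: real^'n)" by (auto simp: Basis_vec_def)
      have c: "c (axis i 1) = A $ i $ i" for i
        by (simp add: c_def inner_axis' matrix_vector_mul_component inner_axis)
      have T: "(\<Sum>j\<in>Basis. (c j * (x \<bullet> j)) *\<^sub>R j) = A *v x" for x
      proof -
        have "(\<Sum>j\<in>Basis. (c j * (x \<bullet> j)) *\<^sub>R j) = (\<Sum>i\<in>UNIV. (A $ i $ i * x $ i) *\<^sub>R axis i 1)"
          unfolding B by (subst sum.reindex[OF inj]) (simp add: c inner_axis)
        moreover have "(A *v x) $ k = A $ k $ k * x $ k" for k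
        proof -
          have "(A *v x) $ k = (\<Sum>j\<in>UNIV. A $ k $ j * x $ j)" by (simp add: matrix_vector_mult_def)
          also have "\<dots> = (\<Sum>j\<in>UNIV. if j = k then A $ k $ k * x $ k else 0)"
            by (intro sum.cong refl) (auto simp: diag)
          finally show ?thesis by simp
        qed
        ultimately show ?thesis
          by (simp add: vec_eq_iff axis_def if_distrib sum.delta cong: if_cong)
      qed
      have c0: "c j \<noteq> 0" if "j \<in> Basis" for j using that d by (auto simp: B c detA)
      have pc: "(\<Prod>j\<in>Basis. \<bar>c j\<bar>) = \<bar>det A\<bar>"
        unfolding B by (subst prod.reindex[OF inj]) (simp add: c detA abs_prod)
      have "(\<integral>\<^sup>+x. f x \<partial>lborel) = (\<integral>\<^sup>+x. f x \<partial>density (distr lborel borel (\<lambda>x. A *v x)) (\<lambda>_. \<bar>det A\<bar>))"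
        by (subst lborel_affine_euclidean[of c 0]) (simp_all add: c0 T pc)
      also have "\<dots> = ennreal \<bar>det A\<bar> * (\<integral>\<^sup>+x. f (A *v x) \<partial>lborel)"
        by (simp add: nn_integral_density nn_integral_distr nn_integral_cmult)
      finally show "(\<integral>\<^sup>+x. f x \<partial>lborel) = ennreal \<bar>det A\<bar> * (\<integral>\<^sup>+x. f (A *v x) \<partial>lborel)" .
    qed
  next
    fix m n :: 'n assume mn: "m \<noteq> n"
    let ?A = "(\<chi> i j. mat 1 $ i $ Transposition.transpose m n j) :: real^'n^'n"
    have "det ?A = of_int (sign (Transposition.transpose m n)) * det (mat 1 :: real^'n^'n)"
      by (rule det_permute_columns) (simp add: permutes_swap_id)
    then have d: "\<bar>det ?A\<bar> = 1" by (simp add: sign_def)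
    have v: "?A *v x = (\<chi> i. x $ Transposition.transpose m n i)" for x
    proof -
      have "(?A *v x) $ i = x $ Transposition.transpose m n i" for i
      proof -
        have "(?A *v x) $ i = (\<Sum>j\<in>UNIV. (if i = Transposition.transpose m n j then 1 else 0) * x $ j)"
          by (simp add: matrix_vector_mult_def mat_def)
        also have "\<dots> = (\<Sum>j\<in>UNIV. if j = Transposition.transpose m n i then x $ j else 0)"
          by (intro sum.cong refl) auto
        finally show ?thesis by simp
      qed
      then show ?thesis by (simp add: vec_eq_iff)
    qed
    show "P ?A" unfolding P_def v d by (simp add: nn_integral_lborel_permute_coordinates)
  next
    fix m n :: 'n and c :: real assume mn: "m \<noteq> n"
    let ?A = "(\<chi> i j. if i = m \<and> j = n then c else of_bool (i = j)) :: real^'n^'n"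
    have "?A = (\<chi> k. if k = m then row m (mat 1) + c *s row n (mat 1) else row k (mat 1))"
      using mn by (auto simp: vec_eq_iff row_def mat_def)
    then have d: "det ?A = 1" using det_row_operation[OF mn, where c=c and A="mat 1 :: real^'n^'n"] by simp
    have v: "?A *v x = x + (c * (x \<bullet> axis n 1)) *\<^sub>R axis m 1" for x
    proof -
      have "(?A *v x) $ i = x $ i + (if i = m then c * x $ n else 0)" for i
      proof -
        have "(?A *v x) $ i = (\<Sum>j\<in>UNIV. (if j = i then x $ j else 0) + (if j = n then (if i = m then c * x $ n else 0) else 0))"
          unfolding matrix_vector_mult_def using mn by (auto intro!: sum.cong)
        then show ?thesis by (simp add: sum.distrib)
      qed
      then show ?thesis unfolding inner_axis by (simp add: vec_eq_iff axis_def)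
    qed
    show "P ?A" unfolding P_def v d
    proof (intro impI ballI)
      fix f :: "real^'n \<Rightarrow> ennreal" assume "f \<in> borel_measurable borel"
      then have "(\<integral>\<^sup>+x. f (x + (c * (x \<bullet> axis n 1)) *\<^sub>R axis m 1) \<partial>lborel) = (\<integral>\<^sup>+x. f x \<partial>lborel)"
        using mn by (intro nn_integral_lborel_shear) (auto simp: axis_eq_axis)
      then show "(\<integral>\<^sup>+x. f x \<partial>lborel) = ennreal \<bar>1\<bar> * (\<integral>\<^sup>+x. f (x + (c * (x \<bullet> axis n 1)) *\<^sub>R axis m 1) \<partial>lborel)"
        by (simp only: abs_one ennreal_1 mult_1)
    qed
  qed
  with assms show ?thesis unfolding P_def by blast
qed

text \<open>Gram-Schmidt for the inner product \<open>B\<close> given by \<open>V\<close>: the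
  columns of \<open>S\<close> are a \<open>B\<close>-orthonormal basis.\<close>

lemma congruent_to_identity:
  fixes V :: "real^'n::finite^'n"
  assumes sym: "transpose V = V" and pd: "\<And>x. x \<noteq> 0 \<Longrightarrow> 0 < x \<bullet> (V *v x)"
  obtains S :: "real^'n^'n" where "transpose S ** V ** S = mat 1"
proof -
  define B where "B x y = x \<bullet> (V *v y)" for x y
  have Bsym: "B x y = B y x" for x y
    unfolding B_def using dot_lmul_matrix[of x V y] sym
    by (metis inner_commute transpose_matrix_vector)
  have Badd: "B x (y + z) = B x y + B x z" "B x (y - z) = B x y - B x z" "B x (c *\<^sub>R y) = c * B x y" for x y z c
    by (simp_all add: B_def matrix_vector_right_distrib matrix_vector_mult_diff_distrib
          matrix_vector_mult_scaleR inner_add_right inner_diff_right)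
  have Bsum: "B x (\<Sum>a\<in>F. g a) = (\<Sum>a\<in>F. B x (g a))" for x F and g :: "real^'n \<Rightarrow> real^'n"
    by (simp add: B_def linear_sum[OF matrix_vector_mul_linear] inner_sum_right)
  define Q where "Q F \<longleftrightarrow> finite F \<and> (\<forall>a\<in>F. \<forall>b\<in>F. B a b = of_bool (a = b))" for F
  have expand: "B a (\<Sum>b\<in>F. c b *\<^sub>R b) = c a" if F: "Q F" "a \<in> F" for F a c
  proof -
    have "B a (\<Sum>b\<in>F. c b *\<^sub>R b) = (\<Sum>b\<in>F. if b = a then c b else 0)"
      unfolding Bsum Badd using F by (intro sum.cong) (auto simp: Q_def)
    then show ?thesis using F by (simp add: Q_def)
  qed
  have indep: "independent F" if F: "Q F" for F
    unfolding dependent_finite[OF conjunct1[OF F[unfolded Q_def]]]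
  proof (rule notI, elim exE conjE bexE)
    fix c v assume v: "v \<in> F" "c v \<noteq> 0" and "(\<Sum>v\<in>F. c v *\<^sub>R v) = 0"
    then show False using expand[OF F v(1), of c] by (simp add: B_def)
  qed
  have card_le: "card F \<le> CARD('n)" if "Q F" for F
    using independent_bound[OF indep[OF that]] by simp
  have "Q {}" by (simp add: Q_def)
  \<comment> \<open>Orthonormal sets are independent, which bounds their size, so one of largest
    size exists; it remains to see that it spans.\<close>
  then obtain F where F: "Q F" and max: "\<And>G. Q G \<Longrightarrow> card G \<le> card F"
    using ex_has_greatest_nat[of Q "{}" card "Suc CARD('n)"] card_le le_imp_less_Suc by metis
  have "card F = CARD('n)"
  proof (rule ccontr)
    assume "card F \<noteq> CARD('n)"
    then have "dim F < CARD('n)" using card_le[OF F] dim_eq_card_independent[OF indep[OF F]] by simp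
    then have "span F \<noteq> UNIV" by (metis dim_UNIV dim_span less_irrefl DIM_cart DIM_real mult.right_neutral)
    then obtain w where w: "w \<notin> span F" by blast
    \<comment> \<open>The Gram-Schmidt residual: orthogonal to \<open>F\<close> and nonzero, because
      \<open>w\<close> lies outside the span. Normalized, it would enlarge \<open>F\<close>.\<close>
    define w' where "w' = w - (\<Sum>a\<in>F. B a w *\<^sub>R a)"
    have w': "w' \<notin> span F"
    proof
      have "(\<Sum>a\<in>F. B a w *\<^sub>R a) \<in> span F" by (intro span_sum span_scale span_base)
      moreover assume "w' \<in> span F"
      ultimately have "w' + (\<Sum>a\<in>F. B a w *\<^sub>R a) \<in> span F" by (intro span_add)
      then show False using w by (simp add: w'_def)
    qed
    then have "w' \<noteq> 0" using span_zero by metis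
    then have pos: "B w' w' > 0" using pd by (simp add: B_def)
    define v where "v = (1 / sqrt (B w' w')) *\<^sub>R w'"
    have Bv: "B v v = 1"
      using pos unfolding v_def Badd(3) by (subst Bsym) (simp add: Badd(3) real_sqrt_mult_self field_simps flip: power2_eq_square)
    have Ba: "B a v = 0" if "a \<in> F" for a
      unfolding v_def Badd(3) w'_def Badd(2) by (simp add: expand[OF F that])
    have vF: "v \<notin> F" using Ba[of v] Bv by auto
    have "Q (insert v F)"
      using F vF Bv Ba Bsym by (auto simp: Q_def)
    from max[OF this] show False using vF F by (simp add: Q_def)
  qed
  then obtain \<sigma> where \<sigma>: "bij_betw \<sigma> (UNIV :: 'n set) F"
    using finite_same_card_bij[of "UNIV :: 'n set" F] F by (auto simp: Q_def)
  define S where "S = (\<chi> i j. \<sigma> j $ i)"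
  have "(transpose S ** V ** S) $ i $ j = B (\<sigma> i) (\<sigma> j)" for i j
  proof -
    have "(transpose S ** (V ** S)) $ i $ j = (\<Sum>k\<in>UNIV. \<sigma> i $ k * (\<Sum>l\<in>UNIV. V $ k $ l * \<sigma> j $ l))"
      by (simp add: S_def matrix_matrix_mult_def transpose_def)
    then show ?thesis by (simp add: B_def inner_vec_def matrix_vector_mult_def matrix_mul_assoc)
  qed
  moreover have "B (\<sigma> i) (\<sigma> j) = of_bool (i = j)" for i j
  proof -
    have "\<sigma> i \<in> F" "\<sigma> j \<in> F" "\<sigma> i = \<sigma> j \<longleftrightarrow> i = j"
      using \<sigma> by (auto simp: bij_betw_def inj_on_eq_iff)
    then show ?thesis using F by (auto simp: Q_def)
  qed
  ultimately have "transpose S ** V ** S = mat 1" by (auto simp: vec_eq_iff mat_def)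
  then show thesis by (rule that)
qed

section \<open>The Gaussian integral and the normal density\<close>

lemma nn_integral_exp_neg_norm_square:
  "(\<integral>\<^sup>+x. ennreal (exp (- (x \<bullet> x) / 2)) \<partial>(lborel :: 'a::euclidean_space measure)) = ennreal (sqrt ((2 * pi) ^ DIM('a)))"
proof -
  interpret product_sigma_finite "\<lambda>_::'a. lborel :: real measure" by standard
  have one: "(\<integral>\<^sup>+t. ennreal (exp (- (t\<^sup>2 / 2))) \<partial>lborel) = ennreal (sqrt (2 * pi))"
  proof -
    have "(\<integral>\<^sup>+t. ennreal (exp (- (t\<^sup>2 / 2))) \<partial>lborel) = (\<integral>\<^sup>+t. ennreal (sqrt (2 * pi)) * ennreal (std_normal_density t) \<partial>lborel)"
      by (intro nn_integral_cong) (simp add: std_normal_density_def flip: ennreal_mult)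
    also have "\<dots> = ennreal (sqrt (2 * pi)) * (\<integral>\<^sup>+t. ennreal (std_normal_density t) \<partial>lborel)"
      by (rule nn_integral_cmult) simp
    also have "(\<integral>\<^sup>+t. ennreal (std_normal_density t) \<partial>lborel) = 1"
      by (subst nn_integral_eq_integral) auto
    finally show ?thesis by simp
  qed
  have "(\<integral>\<^sup>+x. ennreal (exp (- (x \<bullet> x) / 2)) \<partial>(lborel :: 'a measure))
    = (\<integral>\<^sup>+y. ennreal (exp (- ((\<Sum>b\<in>Basis. y b *\<^sub>R b) \<bullet> (\<Sum>b\<in>Basis. y b *\<^sub>R b)) / 2)) \<partial>Pi\<^sub>M (Basis::'a set) (\<lambda>_. lborel))"
    by (subst lborel_eq, subst nn_integral_distr) simp_all
  also have "\<dots> = (\<integral>\<^sup>+y. (\<Prod>b\<in>Basis. ennreal (exp (- ((y b)\<^sup>2 / 2)))) \<partial>Pi\<^sub>M (Basis::'a set) (\<lambda>_. lborel))"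
  proof (intro nn_integral_cong)
    fix y :: "'a \<Rightarrow> real"
    have "(\<Sum>b\<in>Basis. y b *\<^sub>R b) \<bullet> (\<Sum>b\<in>Basis. y b *\<^sub>R b) = (\<Sum>b\<in>Basis. (y b)\<^sup>2)"
      by (subst euclidean_inner) (simp add: power2_eq_square)
    then have "exp (- ((\<Sum>b\<in>Basis. y b *\<^sub>R b) \<bullet> (\<Sum>b\<in>Basis. y b *\<^sub>R b)) / 2) = (\<Prod>b\<in>Basis. exp (- ((y b)\<^sup>2 / 2)))"
      by (simp add: exp_sum[symmetric] sum_negf sum_divide_distrib)
    then show "ennreal (exp (- ((\<Sum>b\<in>Basis. y b *\<^sub>R b) \<bullet> (\<Sum>b\<in>Basis. y b *\<^sub>R b)) / 2)) = (\<Prod>b\<in>Basis. ennreal (exp (- ((y b)\<^sup>2 / 2))))"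
      by (simp add: prod_ennreal)
  qed
  also have "\<dots> = (\<Prod>b\<in>(Basis::'a set). ennreal (sqrt (2 * pi)))"
    by (subst product_nn_integral_prod) (simp_all add: one)
  also have "\<dots> = ennreal (sqrt ((2 * pi) ^ DIM('a)))"
    unfolding prod_constant real_sqrt_power by (rule ennreal_power) simp
  finally show ?thesis .
qed

text \<open>Substituting \<open>S *v x\<close>, where the columns of \<open>S\<close> are
  orthonormal for \<open>V\<close>, turns the form into \<open>x \<bullet> x\<close>. The Jacobian
  follows from \<open>(det S)\<^sup>2 * det V = 1\<close>, which also gives the sign of
  \<open>det V\<close>.\<close>

lemma
  fixes V :: "real^'n::finite^'n"
  assumes sym: "transpose V = V" and pd: "\<And>x. x \<noteq> 0 \<Longrightarrow> 0 < x \<bullet> (V *v x)"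
  shows det_pos_of_posdef: "0 < det V"
    and nn_integral_exp_neg_quadratic_form:
      "(\<integral>\<^sup>+x. ennreal (exp (- (x \<bullet> (V *v x)) / 2)) \<partial>lborel) = ennreal (sqrt ((2 * pi) ^ CARD('n) / det V))"
proof -
  obtain S :: "real^'n^'n" where S: "transpose S ** V ** S = mat 1" using congruent_to_identity[OF assms] by blast
  have "det (transpose S ** V ** S) = 1" by (simp add: S)
  then have d: "(det S)\<^sup>2 * det V = 1" by (simp add: det_mul power2_eq_square mult_ac)
  then have S0: "det S \<noteq> 0" by auto
  show pos: "0 < det V" using d by (metis zero_less_mult_pos zero_less_one zero_less_power2 S0)
  have absS: "\<bar>det S\<bar> = sqrt (1 / det V)"
    using d pos by (metis nonzero_eq_divide_eq less_irrefl real_sqrt_abs)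
  have quad: "(S *v x) \<bullet> (V *v (S *v x)) = x \<bullet> x" for x
  proof -
    have "(S *v x) \<bullet> (V *v (S *v x)) = x \<bullet> (transpose S *v (V *v (S *v x)))"
      by (metis dot_lmul_matrix inner_commute transpose_matrix_vector transpose_transpose)
    also have "\<dots> = x \<bullet> ((transpose S ** V ** S) *v x)" by (simp add: matrix_vector_mul_assoc matrix_mul_assoc)
    finally show ?thesis by (simp add: S)
  qed
  have "(\<integral>\<^sup>+x. ennreal (exp (- (x \<bullet> (V *v x)) / 2)) \<partial>lborel)
    = ennreal \<bar>det S\<bar> * (\<integral>\<^sup>+x. ennreal (exp (- ((S *v x) \<bullet> (V *v (S *v x))) / 2)) \<partial>lborel)"
    by (rule nn_integral_lborel_matrix[OF S0]) measurable
  also have "\<dots> = ennreal \<bar>det S\<bar> * ennreal (sqrt ((2 * pi) ^ CARD('n)))"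
    unfolding quad by (subst nn_integral_exp_neg_norm_square) simp
  also have "\<dots> = ennreal (sqrt ((2 * pi) ^ CARD('n) / det V))"
    using pos by (simp add: absS real_sqrt_divide flip: ennreal_mult)
  finally show "(\<integral>\<^sup>+x. ennreal (exp (- (x \<bullet> (V *v x)) / 2)) \<partial>lborel) = ennreal (sqrt ((2 * pi) ^ CARD('n) / det V))" .
qed

lemma matrix_inv_unique:
  fixes A B :: "real^'n::finite^'n"
  assumes "A ** B = mat 1"
  shows "matrix_inv A = B"
proof -
  have BA: "B ** A = mat 1" using assms by (simp add: matrix_left_right_inverse)
  have "A ** matrix_inv A = mat 1 \<and> matrix_inv A ** A = mat 1"
    unfolding matrix_inv_def by (rule someI[of _ B]) (simp add: assms BA)
  then show ?thesis by (metis BA matrix_mul_assoc matrix_mul_lid matrix_mul_rid)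
qed

text \<open>Puts the normal density into the shape "weight divided by its integral", the shape in
  which the limit of the posterior densities arises.\<close>

lemma mvnormal_density_precision:
  fixes V :: "real^'n::finite^'n"
  assumes sym: "transpose V = V" and pd: "\<And>x. x \<noteq> 0 \<Longrightarrow> 0 < x \<bullet> (V *v x)"
  shows "mvnormal_density 0 (matrix_inv V) x
     = exp (- (x \<bullet> (V *v x)) / 2) / (\<integral>y. exp (- (y \<bullet> (V *v y)) / 2) \<partial>lborel)"
proof -
  have pos: "0 < det V" by (rule det_pos_of_posdef[OF assms])
  obtain W where W: "V ** W = mat 1" using pos by (metis invertible_def invertible_det_nz less_irrefl)
  then have "W ** V = mat 1" by (simp add: matrix_left_right_inverse)
  then have inv: "matrix_inv V = W" "matrix_inv W = V" using W by (auto intro: matrix_inv_unique)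
  have "det V * det W = 1" using W by (metis det_I det_mul)
  then have dW: "det W = 1 / det V" using pos by (simp add: field_simps)
  have "(\<integral>y. exp (- (y \<bullet> (V *v y)) / 2) \<partial>lborel) = sqrt ((2 * pi) ^ CARD('n) / det V)"
    using nn_integral_exp_neg_quadratic_form[OF assms] pos
    by (subst integral_eq_nn_integral) auto
  then show ?thesis by (simp add: mvnormal_density_def inv dW)
qed

lemma nn_integral_lborel_affine:
  fixes f :: "'a::euclidean_space \<Rightarrow> ennreal"
  assumes [measurable]: "f \<in> borel_measurable borel" and c: "c \<noteq> 0"
  shows "(\<integral>\<^sup>+x. f x \<partial>lborel) = ennreal (\<bar>c\<bar> ^ DIM('a)) * (\<integral>\<^sup>+x. f (a + c *\<^sub>R x) \<partial>lborel)"
proof -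
  have "(\<integral>\<^sup>+x. f x \<partial>lborel) = (\<integral>\<^sup>+x. f x \<partial>density (distr lborel borel (\<lambda>x. a + c *\<^sub>R x)) (\<lambda>_. ennreal (\<bar>c\<bar> ^ DIM('a))))"
    by (subst lborel_affine[OF c, of a]) (simp add: ennreal_power)
  then show ?thesis by (simp add: nn_integral_density nn_integral_distr nn_integral_cmult)
qed

lemma dist_add_le: "dist x (a + d) \<le> dist x a + norm d" for a d :: "'a::real_normed_vector"
  using dist_triangle[of x "a + d" a] by (simp add: dist_norm)

lemma integrable_exp_neg_norm_square:
  assumes c: "c > 0"
  shows "integrable lborel (\<lambda>y::'a::euclidean_space. exp (- c * (norm y)\<^sup>2))"
proof (rule integrableI_nonneg)
  define s where "s = sqrt (2 * c)"
  have s: "s > 0" "s\<^sup>2 = 2 * c" using c by (auto simp: s_def)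
  have "(\<integral>\<^sup>+x. ennreal (exp (- (x \<bullet> x) / 2)) \<partial>(lborel :: 'a measure))
     = ennreal (\<bar>s\<bar> ^ DIM('a)) * (\<integral>\<^sup>+x. ennreal (exp (- ((0 + s *\<^sub>R x) \<bullet> (0 + s *\<^sub>R x)) / 2)) \<partial>(lborel :: 'a measure))"
    by (rule nn_integral_lborel_affine) (use s in auto)
  also have "(\<lambda>x::'a. ennreal (exp (- ((0 + s *\<^sub>R x) \<bullet> (0 + s *\<^sub>R x)) / 2))) = (\<lambda>x. ennreal (exp (- c * (norm x)\<^sup>2)))"
  proof
    fix x :: 'a
    have "(0 + s *\<^sub>R x) \<bullet> (0 + s *\<^sub>R x) = s\<^sup>2 * (norm x)\<^sup>2"
      by (simp add: dot_square_norm power2_eq_square)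
    then show "ennreal (exp (- ((0 + s *\<^sub>R x) \<bullet> (0 + s *\<^sub>R x)) / 2)) = ennreal (exp (- c * (norm x)\<^sup>2))"
      by (simp only: s(2)) simp
  qed
  finally have E: "(\<integral>\<^sup>+x. ennreal (exp (- (x \<bullet> x) / 2)) \<partial>(lborel :: 'a measure))
    = ennreal (\<bar>s\<bar> ^ DIM('a)) * (\<integral>\<^sup>+x. ennreal (exp (- c * (norm x)\<^sup>2)) \<partial>(lborel :: 'a measure))" .
  have "ennreal (\<bar>s\<bar> ^ DIM('a)) * (\<integral>\<^sup>+x. ennreal (exp (- c * (norm x)\<^sup>2)) \<partial>(lborel :: 'a measure)) < \<infinity>"
    unfolding E[symmetric] nn_integral_exp_neg_norm_square by simp
  then show "(\<integral>\<^sup>+x. ennreal (exp (- c * (norm x)\<^sup>2)) \<partial>(lborel :: 'a measure)) < \<infinity>"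
    using s by (auto simp: ennreal_mult_less_top)
qed auto

text \<open>Split \<open>f / a - g / b\<close> into \<open>(f - g) / b\<close> and
  \<open>(1 / a - 1 / b) * f\<close>, where \<open>a\<close> and \<open>b\<close> are the two
  integrals. Each part costs one L1 distance over \<open>b\<close>, so unnormalized weights can be
  compared.\<close>

lemma L1_normalize_le:
  fixes f g :: "'x \<Rightarrow> real"
  assumes f: "integrable M f" "\<And>x. 0 \<le> f x" and g: "integrable M g" and pos: "0 < (\<integral>x. g x \<partial>M)"
  shows "(\<integral>x. \<bar>f x / (\<integral>x. f x \<partial>M) - g x / (\<integral>x. g x \<partial>M)\<bar> \<partial>M) \<le> 2 * (\<integral>x. \<bar>f x - g x\<bar> \<partial>M) / (\<integral>x. g x \<partial>M)"
proof -
  define a b where "a = (\<integral>x. f x \<partial>M)" and "b = (\<integral>x. g x \<partial>M)"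
  have a: "a \<ge> 0" using f by (simp add: a_def)
  have b: "b > 0" using pos by (simp add: b_def)
  have "(\<integral>x. \<bar>f x / a - g x / b\<bar> \<partial>M) \<le> (\<integral>x. \<bar>f x - g x\<bar> / b + \<bar>1 / a - 1 / b\<bar> * f x \<partial>M)"
  proof (rule integral_mono)
    show "integrable M (\<lambda>x. \<bar>f x / a - g x / b\<bar>)" "integrable M (\<lambda>x. \<bar>f x - g x\<bar> / b + \<bar>1 / a - 1 / b\<bar> * f x)"
      using f g by auto
    fix x
    have "f x / a - g x / b = (f x - g x) / b + (1 / a - 1 / b) * f x"
      by (simp add: algebra_simps diff_divide_distrib)
    also have "\<bar>\<dots>\<bar> \<le> \<bar>(f x - g x) / b\<bar> + \<bar>(1 / a - 1 / b) * f x\<bar>" by (rule abs_triangle_ineq)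
    also have "\<dots> = \<bar>f x - g x\<bar> / b + \<bar>1 / a - 1 / b\<bar> * f x"
      using b f(2)[of x] by (simp add: abs_mult)
    finally show "\<bar>f x / a - g x / b\<bar> \<le> \<bar>f x - g x\<bar> / b + \<bar>1 / a - 1 / b\<bar> * f x" .
  qed
  also have "\<dots> = (\<integral>x. \<bar>f x - g x\<bar> \<partial>M) / b + \<bar>1 / a - 1 / b\<bar> * a"
    using f g by (simp add: a_def)
  also have "\<bar>1 / a - 1 / b\<bar> * a \<le> \<bar>a - b\<bar> / b"
  \<comment> \<open>For \<open>a = 0\<close> the factor \<open>a\<close> makes the left side vanish,
    whatever value \<open>1 / a\<close> has by convention.\<close>
  proof (cases "a = 0")
    case False
    then have "\<bar>1 / a - 1 / b\<bar> * a = \<bar>(1 / a - 1 / b) * a\<bar>" using a by (simp add: abs_mult)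
    also have "(1 / a - 1 / b) * a = (b - a) / b" using False b by (simp add: field_simps)
    finally show ?thesis using b by (simp add: abs_minus_commute)
  qed (use b in auto)
  also have "\<bar>a - b\<bar> \<le> (\<integral>x. \<bar>f x - g x\<bar> \<partial>M)"
    using integral_abs_bound[of M "\<lambda>x. f x - g x"] f g by (simp add: a_def b_def)
  finally show ?thesis using b by (simp add: a_def b_def divide_right_mono field_simps)
qed

section \<open>Concentration of the rescaled density\<close>

text \<open>The vector \<open>\<mu> i a\<close> plays the role of the gradient of \<open>\<psi> i\<close> at \<open>a\<close>, and \<open>Q i\<close> that of its
  second derivative at \<open>\<theta>0\<close>.\<close>

locale local_quadratic =
  fixes \<Theta> :: "'a::euclidean_space set" and \<psi> :: "'m::finite \<Rightarrow> 'a \<Rightarrow> real"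
    and \<mu> :: "'m \<Rightarrow> 'a \<Rightarrow> 'a" and Q :: "'m \<Rightarrow> 'a \<Rightarrow> real" and \<theta>0 :: 'a
  assumes Theta: "open \<Theta>" "\<theta>0 \<in> \<Theta>"
    and cont: "\<And>i. continuous_on \<Theta> (\<psi> i)"
    and convex: "\<And>i a b. a \<in> \<Theta> \<Longrightarrow> b \<in> \<Theta> \<Longrightarrow> \<psi> i a + (b - a) \<bullet> \<mu> i a \<le> \<psi> i b"
    and quad: "\<And>i \<eta>. \<eta> > 0 \<Longrightarrow> \<exists>r>0. \<forall>a d. a \<in> ball \<theta>0 r \<longrightarrow> a + d \<in> ball \<theta>0 r \<longrightarrow>
       \<bar>\<psi> i (a + d) - \<psi> i a - d \<bullet> \<mu> i a - Q i d / 2\<bar> \<le> \<eta> * (norm d)\<^sup>2"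
    and Q_measurable [measurable]: "\<And>i. Q i \<in> borel_measurable borel"
    and Q_scale: "\<And>i c d. Q i (c *\<^sub>R d) = c\<^sup>2 * Q i d"
    and Q_pos: "\<exists>l>0. \<forall>d. l * (norm d)\<^sup>2 \<le> (\<Sum>i\<in>UNIV. Q i d) / CARD('m)"
begin

section \<open>Growth of Bregman divergences\<close>

definition bregman :: "'m \<Rightarrow> 'a \<Rightarrow> 'a \<Rightarrow> real" where
  "bregman i a d = \<psi> i (a + d) - \<psi> i a - d \<bullet> \<mu> i a"

lemma bregman_nonneg: "a \<in> \<Theta> \<Longrightarrow> a + d \<in> \<Theta> \<Longrightarrow> 0 \<le> bregman i a d"
  using convex[of a "a + d" i] by (simp add: bregman_def)

text \<open>Convexity along a ray, read off the supporting hyperplane at the intermediate point: the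
  inequalities at the two ends are averaged with weights \<open>1 - s\<close> and \<open>s\<close>,
  and the gradient terms cancel. Only three points have to lie in \<open>\<Theta>\<close>, not the
  segment.\<close>

lemma bregman_scale:
  assumes "a \<in> \<Theta>" "a + d \<in> \<Theta>" "a + s *\<^sub>R d \<in> \<Theta>" "0 \<le> s" "s \<le> 1"
  shows "bregman i a (s *\<^sub>R d) \<le> s * bregman i a d"
proof -
  let ?c = "a + s *\<^sub>R d"
  have 1: "\<psi> i ?c + (a - ?c) \<bullet> \<mu> i ?c \<le> \<psi> i a" using assms by (intro convex)
  have 2: "\<psi> i ?c + (a + d - ?c) \<bullet> \<mu> i ?c \<le> \<psi> i (a + d)" using assms by (intro convex)
  have "(1 - s) * (\<psi> i ?c + (a - ?c) \<bullet> \<mu> i ?c) + s * (\<psi> i ?c + (a + d - ?c) \<bullet> \<mu> i ?c)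
     \<le> (1 - s) * \<psi> i a + s * \<psi> i (a + d)"
    using assms 1 2 by (intro add_mono mult_left_mono) auto
  moreover have "(1 - s) * (\<psi> i ?c + (a - ?c) \<bullet> \<mu> i ?c) + s * (\<psi> i ?c + (a + d - ?c) \<bullet> \<mu> i ?c) = \<psi> i ?c"
    by (simp add: algebra_simps inner_add_left inner_diff_left)
  ultimately show ?thesis by (simp add: bregman_def algebra_simps)
qed

text \<open>The threshold is half of the limiting weight. Weights near the limit satisfy it, and
  since Bregman divergences are nonnegative a lower bound on the weights is what the growth estimate
  calls for.\<close>

definition admissible_weights :: "('m \<Rightarrow> real) \<Rightarrow> bool" where
  "admissible_weights w \<longleftrightarrow> (\<forall>i. 1 / (2 * real CARD('m)) \<le> w i)"

text \<open>Up to distance \<open>r\<close> the quadratic expansion gives growth of order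
  \<open>(norm d)\<^sup>2\<close>. A farther point is pulled back to distance \<open>r\<close>,
  where the quadratic bound holds, and \<open>bregman_scale\<close> makes the growth beyond at least
  linear. The factor \<open>min (norm d) r\<close> covers both regimes.\<close>

lemma bregman_sum_lower_bound:
  "\<exists>r \<kappa>. r > 0 \<and> \<kappa> > 0 \<and> ball \<theta>0 (2 * r) \<subseteq> \<Theta> \<and>
    (\<forall>a d w. a \<in> ball \<theta>0 r \<longrightarrow> a + d \<in> \<Theta> \<longrightarrow> admissible_weights w \<longrightarrow>
        \<kappa> * norm d * min (norm d) r \<le> (\<Sum>i\<in>UNIV. w i * bregman i a d))"
proof -
  define m where "m = real CARD('m)"
  have m: "m > 0" by (simp add: m_def)
  obtain l where l: "l > 0" "\<And>d. l * (norm d)\<^sup>2 \<le> (\<Sum>i\<in>UNIV. Q i d) / m" using Q_pos by (auto simp: m_def)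
  have "\<forall>i. \<exists>r>0. \<forall>a d. a \<in> ball \<theta>0 r \<longrightarrow> a + d \<in> ball \<theta>0 r \<longrightarrow> \<bar>bregman i a d - Q i d / 2\<bar> \<le> (l / 4) * (norm d)\<^sup>2"
    \<comment> \<open>Tolerance \<open>l / 4\<close>: half of the summed form is at least
      \<open>m * (l / 2) * (norm d)\<^sup>2\<close>, so half of this survives the errors of all
      agents.\<close>
    using quad[of "l / 4"] l unfolding bregman_def by simp
  then obtain R where R: "\<And>i. R i > 0"
    "\<And>i a d. a \<in> ball \<theta>0 (R i) \<Longrightarrow> a + d \<in> ball \<theta>0 (R i) \<Longrightarrow> \<bar>bregman i a d - Q i d / 2\<bar> \<le> (l / 4) * (norm d)\<^sup>2"
    by metis
  obtain e where e: "e > 0" "ball \<theta>0 e \<subseteq> \<Theta>" using Theta by (meson openE)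
  \<comment> \<open>Halved so that a base point within \<open>r\<close> and a displacement shorter
    than \<open>r\<close> stay in the ball of radius \<open>2 * r\<close>, where every expansion is
    valid.\<close>
  define r where "r = min e (Min (range R)) / 2"
  have Rmin: "Min (range R) \<le> R i" for i by (intro Min_le) auto
  have r: "r > 0" using e R(1) by (simp add: r_def)
  have sub: "ball \<theta>0 (2 * r) \<subseteq> \<Theta>" using e by (auto simp: r_def)
  have near: "m * (l / 4) * (norm d)\<^sup>2 \<le> (\<Sum>i\<in>UNIV. bregman i a d)"
    if "a \<in> ball \<theta>0 (2 * r)" "a + d \<in> ball \<theta>0 (2 * r)" for a d
  proof -
    have "2 * r \<le> R i" for i using min.coboundedI2[OF Rmin[of i], of e] by (simp add: r_def)
    then have *: "\<bar>bregman i a d - Q i d / 2\<bar> \<le> (l / 4) * (norm d)\<^sup>2" for i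
      using that by (intro R(2)) (auto intro: less_le_trans)
    have *: "Q i d / 2 \<le> bregman i a d + (l / 4) * (norm d)\<^sup>2" for i
      using *[of i] by linarith
    have "m * (l / 2) * (norm d)\<^sup>2 \<le> (\<Sum>i\<in>UNIV. Q i d / 2)"
      using l(2)[of d] m by (simp add: field_simps flip: sum_divide_distrib)
    also have "\<dots> \<le> (\<Sum>i\<in>UNIV. bregman i a d + (l / 4) * (norm d)\<^sup>2)"
      by (intro sum_mono *)
    also have "\<dots> = (\<Sum>i\<in>UNIV. bregman i a d) + m * (l / 4) * (norm d)\<^sup>2" by (simp add: sum.distrib m_def)
    finally show ?thesis by (simp add: algebra_simps)
  qed
  have "(l / 8) * norm d * min (norm d) r \<le> (\<Sum>i\<in>UNIV. w i * bregman i a d)"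
    if a: "a \<in> ball \<theta>0 r" and ad: "a + d \<in> \<Theta>" and w: "admissible_weights w" for a d w
  proof -
    have a\<Theta>: "a \<in> \<Theta>" using a r sub by (auto simp: subset_iff)
    have S: "m * (l / 4) * (norm d * min (norm d) r) \<le> (\<Sum>i\<in>UNIV. bregman i a d)"
    proof (cases "norm d < r")
      case True
      have "dist \<theta>0 (a + d) \<le> dist \<theta>0 a + norm d" by (rule dist_add_le)
      then show ?thesis using near[of a d] a True r by (simp add: power2_eq_square)
    next
      case False
      define s where "s = r / norm d"
      have nd: "norm d > 0" using False r by linarith
      have s: "0 < s" "s \<le> 1" using False r nd by (auto simp: s_def simp del: zero_less_norm_iff)
      have ns: "norm (s *\<^sub>R d) = r" using r nd by (simp add: s_def)
      have "dist \<theta>0 (a + s *\<^sub>R d) \<le> dist \<theta>0 a + norm (s *\<^sub>R d)"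
        by (rule dist_add_le)
      then have in2: "a + s *\<^sub>R d \<in> ball \<theta>0 (2 * r)" using a ns by simp
      have "m * (l / 4) * r\<^sup>2 \<le> (\<Sum>i\<in>UNIV. bregman i a (s *\<^sub>R d))"
        using near[OF _ in2] a r ns by simp
      also have "\<dots> \<le> (\<Sum>i\<in>UNIV. s * bregman i a d)"
        using in2 sub s by (intro sum_mono bregman_scale a\<Theta> ad) auto
      also have "\<dots> = (r / norm d) * (\<Sum>i\<in>UNIV. bregman i a d)" by (simp add: sum_distrib_left s_def)
      finally have "(m * (l / 4) * r\<^sup>2) * (norm d / r) \<le> (r / norm d) * (\<Sum>i\<in>UNIV. bregman i a d) * (norm d / r)"
        using nd r by (intro mult_right_mono) auto
      moreover have "min (norm d) r = r" using False by simp
      ultimately show ?thesis using nd r by (simp add: power2_eq_square field_simps)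
    qed
    \<comment> \<open>Admissible weights are at least \<open>1 / (2 * m)\<close>; this factor turns
      \<open>m * (l / 4)\<close> into \<open>l / 8\<close>.\<close>
    have "(l / 8) * norm d * min (norm d) r = 1 / (2 * m) * (m * (l / 4) * (norm d * min (norm d) r))"
      using m by (simp add: field_simps)
    also have "\<dots> \<le> 1 / (2 * m) * (\<Sum>i\<in>UNIV. bregman i a d)"
      using S m by (intro mult_left_mono) auto
    also have "\<dots> \<le> (\<Sum>i\<in>UNIV. w i * bregman i a d)"
      unfolding sum_distrib_left
      using w by (intro sum_mono mult_right_mono bregman_nonneg a\<Theta> ad) (auto simp: admissible_weights_def m_def)
    finally show ?thesis .
  qed
  moreover have "l / 8 > 0" using l by simp
  ultimately show ?thesis using r sub by blast
qed

text \<open>When the gradient equation holds at \<open>a\<close>, this is, up to a factor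
  independent of \<open>y\<close>, the posterior weight at \<open>a + y /\<^sub>R sqrt t\<close>.
  The \<open>w i\<close> are total weights divided by \<open>t\<close>, and the indicator accounts
  for the parameter set.\<close>

definition local_density :: "('a \<Rightarrow> real) \<Rightarrow> real \<Rightarrow> 'a \<Rightarrow> ('m \<Rightarrow> real) \<Rightarrow> 'a \<Rightarrow> real" where
  "local_density \<pi> t a w y = exp (- (\<Sum>i\<in>UNIV. t * (w i * bregman i a (y /\<^sub>R sqrt t))))
     * (indicator \<Theta> (a + y /\<^sub>R sqrt t) * \<pi> (a + y /\<^sub>R sqrt t))"

definition limit_density :: "('a \<Rightarrow> real) \<Rightarrow> 'a \<Rightarrow> real" where
  "limit_density \<pi> y = exp (- ((\<Sum>i\<in>UNIV. Q i y) / CARD('m)) / 2) * \<pi> \<theta>0"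

lemma local_density_measurable [measurable]:
  assumes [measurable]: "(\<lambda>x. indicator \<Theta> x * \<pi> x) \<in> borel_measurable borel"
  shows "local_density \<pi> t a w \<in> borel_measurable borel"
proof -
  have [measurable]: "(\<lambda>x. indicator \<Theta> x *\<^sub>R \<psi> i x) \<in> borel_measurable borel" for i
    using cont Theta by (intro borel_measurable_continuous_on_indicator) auto
  \<comment> \<open>\<open>\<psi> i\<close> is known to be continuous on \<open>\<Theta>\<close>
    only, so it is cut off there; outside, the last factor is zero and the cut-off changes
    nothing.\<close>
  define H where "H x = exp (- (\<Sum>i\<in>UNIV. t * (w i * (indicator \<Theta> x *\<^sub>R \<psi> i x - \<psi> i a - (x - a) \<bullet> \<mu> i a))))
     * (indicator \<Theta> x * \<pi> x)" for x
  have "local_density \<pi> t a w = (\<lambda>y. H (a + y /\<^sub>R sqrt t))"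
    by (auto simp: fun_eq_iff local_density_def H_def bregman_def indicator_def)
  moreover have "H \<in> borel_measurable borel" unfolding H_def by measurable
  ultimately show ?thesis by simp
qed

text \<open>For \<open>d = y /\<^sub>R sqrt t\<close> the factor \<open>t\<close> exactly offsets
  the quadratic scaling: \<open>t * Q i d\<close> is \<open>Q i y\<close> and an error
  \<open>\<eta> * (norm d)\<^sup>2\<close> becomes \<open>\<eta> * (norm y)\<^sup>2\<close>. The
  moving base point is covered by the uniformity in \<open>quad\<close>.\<close>

lemma tendsto_scaled_bregman:
  assumes a: "a \<longlonglongrightarrow> \<theta>0" and t: "filterlim t at_top sequentially" and tpos: "\<And>n. t n > (0::real)"
  shows "(\<lambda>n. t n * bregman i (a n) (y /\<^sub>R sqrt (t n))) \<longlonglongrightarrow> Q i y / 2"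
proof (rule tendstoI)
  fix e :: real assume e: "e > 0"
  define \<eta> where "\<eta> = e / (2 * ((norm y)\<^sup>2 + 1))"
  have \<eta>: "\<eta> > 0" using e by (simp add: \<eta>_def add_nonneg_pos)
  obtain r where r: "r > 0" "\<And>a d. a \<in> ball \<theta>0 r \<Longrightarrow> a + d \<in> ball \<theta>0 r \<Longrightarrow> \<bar>bregman i a d - Q i d / 2\<bar> \<le> \<eta> * (norm d)\<^sup>2"
    using quad[OF \<eta>, of i] unfolding bregman_def by auto
  have "(\<lambda>n. y /\<^sub>R sqrt (t n)) \<longlonglongrightarrow> 0 *\<^sub>R y"
    using t by (intro tendsto_scaleR tendsto_const tendsto_inverse_0_at_top filterlim_compose[OF sqrt_at_top])
  then have 2: "(\<lambda>n. a n + y /\<^sub>R sqrt (t n)) \<longlonglongrightarrow> \<theta>0" using tendsto_add[OF a] by force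
  have "\<forall>\<^sub>F n in sequentially. a n \<in> ball \<theta>0 r" "\<forall>\<^sub>F n in sequentially. a n + y /\<^sub>R sqrt (t n) \<in> ball \<theta>0 r"
    using tendstoD[OF a r(1)] tendstoD[OF 2 r(1)] by (simp_all add: dist_commute)
  then show "\<forall>\<^sub>F n in sequentially. dist (t n * bregman i (a n) (y /\<^sub>R sqrt (t n))) (Q i y / 2) < e"
  proof eventually_elim
    case (elim n)
    let ?d = "y /\<^sub>R sqrt (t n)"
    have sq: "(1 / sqrt (t n))\<^sup>2 = 1 / t n" using tpos[of n] by (simp add: power_divide)
    have Qd: "Q i ?d = Q i y / t n" using Q_scale[of i "1 / sqrt (t n)" y] sq by (simp add: inverse_eq_divide)
    have nd: "(norm ?d)\<^sup>2 = (norm y)\<^sup>2 / t n" using sq tpos[of n] by (simp add: power_divide inverse_eq_divide)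
    have "\<bar>t n * bregman i (a n) ?d - Q i y / 2\<bar> = t n * \<bar>bregman i (a n) ?d - Q i ?d / 2\<bar>"
    proof -
      have "t n * bregman i (a n) ?d - Q i y / 2 = t n * (bregman i (a n) ?d - Q i ?d / 2)"
        unfolding Qd using tpos[of n] by (simp add: field_simps)
      then show ?thesis using tpos[of n] by (simp add: abs_mult)
    qed
    also have "\<dots> \<le> t n * (\<eta> * (norm ?d)\<^sup>2)"
      using elim r(2)[of "a n" ?d] tpos[of n] by (intro mult_left_mono) auto
    also have "\<dots> = \<eta> * (norm y)\<^sup>2" unfolding nd using tpos[of n] by simp
    also have "\<dots> \<le> \<eta> * ((norm y)\<^sup>2 + 1)" using \<eta> by (intro mult_left_mono) auto
    also have "\<dots> = e / 2" by (simp add: \<eta>_def field_simps add_nonneg_eq_0_iff)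
    also have "\<dots> < e" using e by simp
    finally show ?case by (simp add: dist_real_def)
  qed
qed

lemma limit_density_bound:
  assumes "l > 0" "\<And>d. l * (norm d)\<^sup>2 \<le> (\<Sum>i\<in>UNIV. Q i d) / CARD('m)" "0 \<le> \<pi> \<theta>0"
  shows "\<bar>limit_density \<pi> y\<bar> \<le> \<pi> \<theta>0 * exp (- (l / 2) * (norm y)\<^sup>2)"
proof -
  have "exp (- ((\<Sum>i\<in>UNIV. Q i y) / CARD('m)) / 2) \<le> exp (- (l / 2) * (norm y)\<^sup>2)"
    using assms(2)[of y] by simp
  then show ?thesis using assms(3) by (simp add: limit_density_def abs_mult mult.commute mult_left_mono)
qed

lemma integrable_limit_density:
  assumes "0 \<le> \<pi> \<theta>0"
  shows "integrable lborel (limit_density \<pi>)"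
proof -
  obtain l where l: "l > 0" "\<And>d. l * (norm d)\<^sup>2 \<le> (\<Sum>i\<in>UNIV. Q i d) / CARD('m)" using Q_pos by blast
  have "integrable lborel (\<lambda>y::'a. \<pi> \<theta>0 * exp (- (l / 2) * (norm y)\<^sup>2))"
    using l by (intro integrable_mult_right integrable_exp_neg_norm_square) simp
  then show ?thesis
  proof (rule Bochner_Integration.integrable_bound)
    show "AE y in lborel. norm (limit_density \<pi> y) \<le> norm (\<pi> \<theta>0 * exp (- (l / 2) * (norm y)\<^sup>2))"
      using limit_density_bound[of l \<pi>, OF l assms] by (auto intro!: AE_I2 order_trans[OF _ abs_ge_self])
  qed (simp add: limit_density_def[abs_def])
qed

section \<open>L1 convergence of the rescaled densities\<close>

lemma power_exp_neg_tendsto_0: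
  assumes "c > 0"
  shows "((\<lambda>x::real. sqrt x ^ p * exp (- c * x)) \<longlongrightarrow> 0) at_top"
proof (rule tendsto_sandwich[of "\<lambda>_. 0" _ _ "\<lambda>x. (1 / c) ^ p * ((c * x) ^ p / exp (c * x))"])
  have "((\<lambda>x. (1 / c) ^ p * ((c * x) ^ p / exp (c * x))) \<longlongrightarrow> (1 / c) ^ p * 0) at_top"
    using assms by (intro tendsto_mult tendsto_const filterlim_compose[OF tendsto_power_div_exp_0]
        filterlim_tendsto_pos_mult_at_top[OF tendsto_const] filterlim_ident)
  then show "((\<lambda>x. (1 / c) ^ p * ((c * x) ^ p / exp (c * x))) \<longlongrightarrow> 0) at_top" by simp
  show "\<forall>\<^sub>F x in at_top. sqrt x ^ p * exp (- c * x) \<le> (1 / c) ^ p * ((c * x) ^ p / exp (c * x))"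
    using eventually_ge_at_top[of 1]
  proof eventually_elim
    case (elim x)
    have "sqrt x \<le> x" using elim by (intro real_le_lsqrt) (auto simp: power2_eq_square)
    then have "sqrt x ^ p \<le> x ^ p" using elim by (intro power_mono) auto
    then show ?case using assms by (simp add: power_mult_distrib exp_minus field_simps)
  qed
qed (auto intro!: always_eventually eventually_mono[OF eventually_ge_at_top[of 0]])

text \<open>Only the exponential factor is estimated, by \<open>exp (- c * t)\<close>. The prior
  factor is integrated exactly: it has mass one, and the substitution contributes
  \<open>sqrt t ^ DIM('a)\<close>.\<close>

lemma local_density_far_nn_integral:
  assumes [measurable]: "(\<lambda>x. indicator \<Theta> x * \<pi> x) \<in> borel_measurable borel"
    and \<pi>0: "\<And>x. 0 \<le> \<pi> x" and \<pi>1: "(\<integral>\<^sup>+x. ennreal (indicator \<Theta> x * \<pi> x) \<partial>lborel) = 1"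
    and t: "t > 0" and c: "\<And>d. \<rho> < norm d \<Longrightarrow> a + d \<in> \<Theta> \<Longrightarrow> c \<le> (\<Sum>i\<in>UNIV. w i * bregman i a d)"
  shows "(\<integral>\<^sup>+y. ennreal (local_density \<pi> t a w y * indicator {y. \<rho> * sqrt t < norm y} y) \<partial>lborel)
    \<le> ennreal (sqrt t ^ DIM('a) * exp (- c * t))"
proof -
  have "(\<integral>\<^sup>+y. ennreal (local_density \<pi> t a w y * indicator {y. \<rho> * sqrt t < norm y} y) \<partial>lborel)
    \<le> (\<integral>\<^sup>+y. ennreal (exp (- c * t)) * ennreal (indicator \<Theta> (a + y /\<^sub>R sqrt t) * \<pi> (a + y /\<^sub>R sqrt t)) \<partial>lborel)"
  proof (intro nn_integral_mono)
    fix y :: 'a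
    let ?d = "y /\<^sub>R sqrt t"
    show "ennreal (local_density \<pi> t a w y * indicator {y. \<rho> * sqrt t < norm y} y)
      \<le> ennreal (exp (- c * t)) * ennreal (indicator \<Theta> (a + ?d) * \<pi> (a + ?d))"
    proof (cases "a + ?d \<in> \<Theta> \<and> \<rho> * sqrt t < norm y")
      case True
      have "norm ?d > \<rho>" using True t by (simp add: inverse_eq_divide field_simps)
      then have "t * c \<le> t * (\<Sum>i\<in>UNIV. w i * bregman i a ?d)" using True c t by (intro mult_left_mono) auto
      then have "exp (- (\<Sum>i\<in>UNIV. t * (w i * bregman i a ?d))) \<le> exp (- c * t)"
        by (simp add: sum_distrib_left mult_ac)
      then show ?thesis using True \<pi>0
        by (simp add: local_density_def mult_right_mono flip: ennreal_mult)
    next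
      case False
      then show ?thesis by (auto simp: local_density_def)
    qed
  qed
  also have "\<dots> = ennreal (exp (- c * t)) * (\<integral>\<^sup>+y. ennreal (indicator \<Theta> (a + y /\<^sub>R sqrt t) * \<pi> (a + y /\<^sub>R sqrt t)) \<partial>lborel)"
    by (rule nn_integral_cmult) measurable
  also have "(\<integral>\<^sup>+y. ennreal (indicator \<Theta> (a + y /\<^sub>R sqrt t) * \<pi> (a + y /\<^sub>R sqrt t)) \<partial>lborel) = ennreal (sqrt t ^ DIM('a))"
  proof -
    define I where "I = (\<integral>\<^sup>+y. ennreal (indicator \<Theta> (a + y /\<^sub>R sqrt t) * \<pi> (a + y /\<^sub>R sqrt t)) \<partial>lborel)"
    have "1 = ennreal (\<bar>1 / sqrt t\<bar> ^ DIM('a)) * I"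
      unfolding I_def \<pi>1[symmetric] inverse_eq_divide by (rule nn_integral_lborel_affine) (use t in auto)
    then have "ennreal (sqrt t ^ DIM('a)) = ennreal (sqrt t ^ DIM('a)) * (ennreal (\<bar>1 / sqrt t\<bar> ^ DIM('a)) * I)" by simp
    also have "\<dots> = I" using t by (simp add: mult.assoc[symmetric] power_divide flip: ennreal_mult)
    finally show ?thesis by (simp add: I_def)
  qed
  also have "ennreal (exp (- c * t)) * ennreal (sqrt t ^ DIM('a)) = ennreal (sqrt t ^ DIM('a) * exp (- c * t))"
    using t by (simp add: mult.commute flip: ennreal_mult)
  finally show ?thesis .
qed

text \<open>The space is split at \<open>norm y = \<rho> * sqrt t\<close>, a fixed distance
  \<open>\<rho>\<close> in the original parameter. Inside, a Gaussian dominates and dominated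
  convergence applies; outside, the mass tends to zero.\<close>

lemma local_density_L1_sequence:
  assumes meas [measurable]: "(\<lambda>x. indicator \<Theta> x * \<pi> x) \<in> borel_measurable borel"
    and \<pi>0: "\<And>x. 0 \<le> \<pi> x" and \<pi>1: "(\<integral>\<^sup>+x. ennreal (indicator \<Theta> x * \<pi> x) \<partial>lborel) = 1"
    and \<pi>cont: "isCont \<pi> \<theta>0"
    and rk: "r > 0" "\<kappa> > 0" "ball \<theta>0 (2 * r) \<subseteq> \<Theta>"
      "\<And>a d w. a \<in> ball \<theta>0 r \<Longrightarrow> a + d \<in> \<Theta> \<Longrightarrow> admissible_weights w \<Longrightarrow>
        \<kappa> * norm d * min (norm d) r \<le> (\<Sum>i\<in>UNIV. w i * bregman i a d)"
    and K: "\<And>x. x \<in> ball \<theta>0 (2 * r) \<Longrightarrow> \<pi> x \<le> K"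
    and a: "a \<longlonglongrightarrow> \<theta>0" "\<And>n. a n \<in> ball \<theta>0 r"
    and t: "filterlim t at_top sequentially" "\<And>n. t n > (0::real)"
    and w: "\<And>i. (\<lambda>n. w n i) \<longlonglongrightarrow> 1 / CARD('m)" "\<And>n. admissible_weights (w n)"
  shows "(\<lambda>n. \<integral>y. \<bar>local_density \<pi> (t n) (a n) (w n) y - limit_density \<pi> y\<bar> \<partial>lborel) \<longlonglongrightarrow> 0"
    and "\<And>n. integrable lborel (local_density \<pi> (t n) (a n) (w n))"
proof -
  \<comment> \<open>Being below \<open>r\<close>, it makes the minimum in the growth bound equal to
    \<open>norm d\<close> inside, and keeps \<open>a + d\<close> in the ball where the prior is at
    most \<open>K\<close>.\<close>
  define \<rho> where "\<rho> = r / 2"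
  have \<rho>: "\<rho> > 0" "\<rho> < r" using rk by (auto simp: \<rho>_def)
  \<comment> \<open>The value of the growth bound at distance \<open>\<rho>\<close>, hence a lower
    bound for the exponent per unit of \<open>t\<close> everywhere outside.\<close>
  define c where "c = \<kappa> * \<rho> * \<rho>"
  have c0: "c > 0" using rk \<rho> by (simp add: c_def)
  define G where "G n = local_density \<pi> (t n) (a n) (w n)" for n
  define near where "near n y = G n y * indicator {y. norm y \<le> \<rho> * sqrt (t n)} y" for n y
  define far where "far n y = G n y * indicator {y. \<rho> * sqrt (t n) < norm y} y" for n y
  have G0: "0 \<le> G n y" for n y using \<pi>0 by (simp add: G_def local_density_def)
  have [measurable]: "G n \<in> borel_measurable borel" for n unfolding G_def by (rule local_density_measurable[OF meas])
  have [measurable]: "near n \<in> borel_measurable borel" "far n \<in> borel_measurable borel" for n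
    unfolding near_def far_def by measurable
  have split: "G n y = near n y + far n y" for n y
    by (auto simp: near_def far_def indicator_def)
  have K0: "0 \<le> K" using order_trans[OF \<pi>0 K, of \<theta>0] rk by simp
  have near_bound: "\<bar>near n y\<bar> \<le> K * exp (- \<kappa> * (norm y)\<^sup>2)" for n y
  proof (cases "norm y \<le> \<rho> * sqrt (t n) \<and> a n + y /\<^sub>R sqrt (t n) \<in> \<Theta>")
    case True
    let ?d = "y /\<^sub>R sqrt (t n)"
    have nd: "norm ?d = norm y / sqrt (t n)" using t(2)[of n] by (simp add: inverse_eq_divide)
    have d\<rho>: "norm ?d \<le> \<rho>" unfolding nd using True t(2)[of n] by (simp add: field_simps)
    have "dist \<theta>0 (a n + ?d) \<le> dist \<theta>0 (a n) + norm ?d"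
      by (rule dist_add_le)
    then have in2: "a n + ?d \<in> ball \<theta>0 (2 * r)" using a(2)[of n] d\<rho> \<rho> by simp
    have "\<kappa> * norm ?d * norm ?d \<le> (\<Sum>i\<in>UNIV. w n i * bregman i (a n) ?d)"
      using rk(4)[OF a(2)[of n] conjunct2[OF True] w(2)[of n]] d\<rho> \<rho> by (simp add: min_def split: if_splits)
    then have "t n * (\<kappa> * norm ?d * norm ?d) \<le> t n * (\<Sum>i\<in>UNIV. w n i * bregman i (a n) ?d)"
      using t(2)[of n] by (intro mult_left_mono) auto
    moreover have "t n * (\<kappa> * norm ?d * norm ?d) = \<kappa> * (norm y)\<^sup>2"
      unfolding nd using t(2)[of n] by (simp add: power2_eq_square field_simps)
    ultimately have "\<kappa> * (norm y)\<^sup>2 \<le> (\<Sum>i\<in>UNIV. t n * (w n i * bregman i (a n) ?d))"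
      by (simp only: sum_distrib_left)
    then have "exp (- (\<Sum>i\<in>UNIV. t n * (w n i * bregman i (a n) ?d))) \<le> exp (- \<kappa> * (norm y)\<^sup>2)"
      by simp
    then have "exp (- (\<Sum>i\<in>UNIV. t n * (w n i * bregman i (a n) ?d))) * \<pi> (a n + ?d) \<le> exp (- \<kappa> * (norm y)\<^sup>2) * K"
      using K[OF in2] \<pi>0 by (intro mult_mono) auto
    then show ?thesis using True G0[of n y] by (simp add: near_def G_def local_density_def mult.commute)
  next
    case False
    then show ?thesis using K0 by (auto simp: near_def G_def local_density_def)
  qed
  have far_bound: "(\<integral>\<^sup>+y. ennreal (far n y) \<partial>lborel) \<le> ennreal (sqrt (t n) ^ DIM('a) * exp (- c * t n))" for n
    unfolding far_def G_def
  proof (rule local_density_far_nn_integral[OF meas \<pi>0 \<pi>1 t(2)])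
    fix d assume d: "\<rho> < norm d" "a n + d \<in> \<Theta>"
    have "c \<le> \<kappa> * norm d * min (norm d) r"
      unfolding c_def using d \<rho> rk by (intro mult_mono) auto
    also have "\<dots> \<le> (\<Sum>i\<in>UNIV. w n i * bregman i (a n) d)" by (rule rk(4)[OF a(2) d(2) w(2)])
    finally show "c \<le> (\<Sum>i\<in>UNIV. w n i * bregman i (a n) d)" .
  qed
  have far0: "0 \<le> far n y" for n y using G0 by (simp add: far_def)
  have far_int: "integrable lborel (far n)" for n
    using far_bound[of n] far0 by (intro integrableI_nonneg) (auto intro: le_less_trans)
  have far_le: "(\<integral>y. far n y \<partial>lborel) \<le> sqrt (t n) ^ DIM('a) * exp (- c * t n)" for n
    using far_bound[of n] far0 far_int[of n] t(2)[of n]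
    by (subst (asm) nn_integral_eq_integral) auto
  have far_lim: "(\<lambda>n. \<integral>y. far n y \<partial>lborel) \<longlonglongrightarrow> 0"
  proof (rule tendsto_sandwich[of "\<lambda>_. 0" _ _ "\<lambda>n. sqrt (t n) ^ DIM('a) * exp (- c * t n)"])
    show "(\<lambda>n. sqrt (t n) ^ DIM('a) * exp (- c * t n)) \<longlonglongrightarrow> 0"
      by (rule filterlim_compose[OF power_exp_neg_tendsto_0[OF c0] t(1)])
  qed (use far_le far0 in \<open>auto intro!: always_eventually\<close>)
  have dom_int: "integrable lborel (\<lambda>y::'a. K * exp (- \<kappa> * (norm y)\<^sup>2))"
    using rk by (intro integrable_mult_right integrable_exp_neg_norm_square)
  have near_int: "integrable lborel (near n)" for n
    using near_bound by (intro Bochner_Integration.integrable_bound[OF dom_int] AE_I2)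
      (auto intro: order_trans[OF _ abs_ge_self])
  have lim_int: "integrable lborel (limit_density \<pi>)" by (rule integrable_limit_density[OF \<pi>0])
  show G_int: "integrable lborel (local_density \<pi> (t n) (a n) (w n))" for n
    using near_int[of n] far_int[of n] unfolding G_def[symmetric] split[abs_def] by simp
  have pointwise: "(\<lambda>n. near n y) \<longlonglongrightarrow> limit_density \<pi> y" for y
  proof -
    have s: "(\<lambda>n. y /\<^sub>R sqrt (t n)) \<longlonglongrightarrow> 0 *\<^sub>R y"
      using t by (intro tendsto_scaleR tendsto_const tendsto_inverse_0_at_top filterlim_compose[OF sqrt_at_top])
    then have pt: "(\<lambda>n. a n + y /\<^sub>R sqrt (t n)) \<longlonglongrightarrow> \<theta>0" using tendsto_add[OF a(1)] by force
    have "(\<lambda>n. exp (- (\<Sum>i\<in>UNIV. w n i * (t n * bregman i (a n) (y /\<^sub>R sqrt (t n))))) * \<pi> (a n + y /\<^sub>R sqrt (t n)))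
      \<longlonglongrightarrow> exp (- (\<Sum>i\<in>UNIV. 1 / CARD('m) * (Q i y / 2))) * \<pi> \<theta>0"
      using w(1) tendsto_scaled_bregman[OF a(1) t] isCont_tendsto_compose[OF \<pi>cont pt]
      by (intro tendsto_intros)
    also have "exp (- (\<Sum>i\<in>UNIV. 1 / CARD('m) * (Q i y / 2))) * \<pi> \<theta>0 = limit_density \<pi> y"
      by (simp add: limit_density_def flip: sum_divide_distrib)
    finally have L: "(\<lambda>n. exp (- (\<Sum>i\<in>UNIV. w n i * (t n * bregman i (a n) (y /\<^sub>R sqrt (t n))))) * \<pi> (a n + y /\<^sub>R sqrt (t n)))
      \<longlonglongrightarrow> limit_density \<pi> y" .
    have e1: "\<forall>\<^sub>F n in sequentially. a n + y /\<^sub>R sqrt (t n) \<in> \<Theta>"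
      using topological_tendstoD[OF pt] Theta by blast
    have "filterlim (\<lambda>n. \<rho> * sqrt (t n)) at_top sequentially"
      using \<rho> t(1) by (intro filterlim_tendsto_pos_mult_at_top[OF tendsto_const] filterlim_compose[OF sqrt_at_top]) auto
    then have e2: "\<forall>\<^sub>F n in sequentially. norm y \<le> \<rho> * sqrt (t n)" by (simp add: filterlim_at_top)
    \<comment> \<open>For fixed \<open>y\<close> both cut-offs, the one from \<open>\<Theta>\<close>
      and the one from the split, are eventually inactive.\<close>
    have "\<forall>\<^sub>F n in sequentially. exp (- (\<Sum>i\<in>UNIV. w n i * (t n * bregman i (a n) (y /\<^sub>R sqrt (t n))))) * \<pi> (a n + y /\<^sub>R sqrt (t n)) = near n y"
      using e1 e2 by eventually_elim (simp add: near_def G_def local_density_def mult.left_commute)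
    then show ?thesis by (rule Lim_transform_eventually[OF L])
  qed
  have near_lim: "(\<lambda>n. \<integral>y. \<bar>near n y - limit_density \<pi> y\<bar> \<partial>lborel) \<longlonglongrightarrow> integral\<^sup>L lborel (\<lambda>y::'a. 0 :: real)"
  proof (rule integral_dominated_convergence)
    show "integrable lborel (\<lambda>y. K * exp (- \<kappa> * (norm y)\<^sup>2) + \<bar>limit_density \<pi> y\<bar>)"
      using dom_int lim_int by simp
    show "AE y in lborel. (\<lambda>n. \<bar>near n y - limit_density \<pi> y\<bar>) \<longlonglongrightarrow> 0"
      using tendsto_rabs_zero[OF LIM_zero[OF pointwise]] by simp
    show "AE y in lborel. norm \<bar>near n y - limit_density \<pi> y\<bar> \<le> K * exp (- \<kappa> * (norm y)\<^sup>2) + \<bar>limit_density \<pi> y\<bar>" for n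
      using near_bound by (intro AE_I2) (auto intro: order_trans[OF abs_triangle_ineq4] add_mono)
  qed (use lim_int in auto)
  show "(\<lambda>n. \<integral>y. \<bar>local_density \<pi> (t n) (a n) (w n) y - limit_density \<pi> y\<bar> \<partial>lborel) \<longlonglongrightarrow> 0"
    unfolding G_def[symmetric]
  proof (rule tendsto_sandwich[of "\<lambda>_. 0" _ _
      "\<lambda>n. (\<integral>y. \<bar>near n y - limit_density \<pi> y\<bar> \<partial>lborel) + (\<integral>y. far n y \<partial>lborel)"])
    show "(\<lambda>n. (\<integral>y. \<bar>near n y - limit_density \<pi> y\<bar> \<partial>lborel) + (\<integral>y. far n y \<partial>lborel)) \<longlonglongrightarrow> 0"
      using tendsto_add[OF near_lim far_lim] by simp
    have "(\<integral>y. \<bar>G n y - limit_density \<pi> y\<bar> \<partial>lborel)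
        \<le> (\<integral>y. \<bar>near n y - limit_density \<pi> y\<bar> + far n y \<partial>lborel)" for n
    proof (rule integral_mono)
      show "integrable lborel (\<lambda>y. \<bar>G n y - limit_density \<pi> y\<bar>)"
        "integrable lborel (\<lambda>y. \<bar>near n y - limit_density \<pi> y\<bar> + far n y)"
        using near_int[of n] far_int[of n] lim_int by (auto simp: split)
      show "\<bar>G n y - limit_density \<pi> y\<bar> \<le> \<bar>near n y - limit_density \<pi> y\<bar> + far n y" for y
        using split[of n y] far0[of n y] by linarith
    qed
    then show "\<forall>\<^sub>F n in sequentially. (\<integral>y. \<bar>G n y - limit_density \<pi> y\<bar> \<partial>lborel)
        \<le> (\<integral>y. \<bar>near n y - limit_density \<pi> y\<bar> \<partial>lborel) + (\<integral>y. far n y \<partial>lborel)"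
      using near_int far_int lim_int by (intro always_eventually allI) simp
  qed auto
qed

text \<open>A single \<open>\<delta>\<close> for all base points, times and weights at once, so that
  random arguments can be inserted for each outcome separately. If no \<open>\<delta>\<close>
  worked, counterexamples for \<open>\<delta> n\<close> tending to 0 would form a sequence to which
  \<open>local_density_L1_sequence\<close> applies.\<close>

lemma local_density_L1:
  assumes meas: "(\<lambda>x. indicator \<Theta> x * \<pi> x) \<in> borel_measurable borel"
    and \<pi>0: "\<And>x. 0 \<le> \<pi> x" and \<pi>1: "(\<integral>\<^sup>+x. ennreal (indicator \<Theta> x * \<pi> x) \<partial>lborel) = 1"
    and \<pi>cont: "isCont \<pi> \<theta>0" and \<pi>pos: "0 < \<pi> \<theta>0" and \<epsilon>: "\<epsilon> > 0"
  shows "\<exists>\<delta>>0. \<forall>a t w. dist a \<theta>0 < \<delta> \<longrightarrow> t > 1 / \<delta> \<longrightarrow> (\<forall>i. \<bar>w i - 1 / CARD('m)\<bar> < \<delta>) \<longrightarrow>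
      integrable lborel (local_density \<pi> t a w) \<and> 0 < (\<integral>y. local_density \<pi> t a w y \<partial>lborel) \<and>
      (\<integral>y. \<bar>local_density \<pi> t a w y / (\<integral>y. local_density \<pi> t a w y \<partial>lborel)
         - limit_density \<pi> y / (\<integral>y. limit_density \<pi> y \<partial>lborel)\<bar> \<partial>lborel) < \<epsilon>"
proof -
  obtain r0 \<kappa> where rk0: "r0 > 0" "\<kappa> > 0" "ball \<theta>0 (2 * r0) \<subseteq> \<Theta>"
    "\<And>a d w. a \<in> ball \<theta>0 r0 \<Longrightarrow> a + d \<in> \<Theta> \<Longrightarrow> admissible_weights w \<Longrightarrow>
        \<kappa> * norm d * min (norm d) r0 \<le> (\<Sum>i\<in>UNIV. w i * bregman i a d)"
    using bregman_sum_lower_bound by blast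
  obtain s where s: "s > 0" "\<And>x. dist x \<theta>0 < s \<Longrightarrow> dist (\<pi> x) (\<pi> \<theta>0) < 1"
    using \<pi>cont unfolding continuous_at_eps_delta by (metis zero_less_one)
  define r where "r = min r0 (s / 2)"
  have r: "r > 0" "r \<le> r0" using rk0 s by (auto simp: r_def)
  have K: "\<pi> x \<le> \<pi> \<theta>0 + 1" if "x \<in> ball \<theta>0 (2 * r)" for x
  proof -
    have "dist x \<theta>0 < s" using that min.cobounded2[of r0 "s / 2"] by (simp add: r_def dist_commute)
    then show ?thesis using s(2)[of x] by (simp add: dist_real_def)
  qed
  have rk: "r > 0" "\<kappa> > 0" "ball \<theta>0 (2 * r) \<subseteq> \<Theta>"
    "\<And>a d w. a \<in> ball \<theta>0 r \<Longrightarrow> a + d \<in> \<Theta> \<Longrightarrow> admissible_weights w \<Longrightarrow>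
        \<kappa> * norm d * min (norm d) r \<le> (\<Sum>i\<in>UNIV. w i * bregman i a d)"
  proof -
    show "ball \<theta>0 (2 * r) \<subseteq> \<Theta>" using rk0(3) r subset_ball[of "2 * r" "2 * r0" \<theta>0] by auto
    fix a d :: 'a and w assume "a \<in> ball \<theta>0 r" "a + d \<in> \<Theta>" "admissible_weights w"
    then have "\<kappa> * norm d * min (norm d) r0 \<le> (\<Sum>i\<in>UNIV. w i * bregman i a d)"
      using r by (intro rk0(4)) auto
    moreover have "\<kappa> * norm d * min (norm d) r \<le> \<kappa> * norm d * min (norm d) r0"
      using r rk0(2) by (intro mult_left_mono) auto
    ultimately show "\<kappa> * norm d * min (norm d) r \<le> (\<Sum>i\<in>UNIV. w i * bregman i a d)" by linarith
  qed (use r rk0 in auto)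
  have lim_int: "integrable lborel (limit_density \<pi>)" by (rule integrable_limit_density[OF \<pi>0])
  have lim_pos: "0 < (\<integral>y. limit_density \<pi> y \<partial>lborel)"
  proof -
    have pos: "0 < limit_density \<pi> y" for y using \<pi>pos by (simp add: limit_density_def)
    have "(\<integral>y. limit_density \<pi> y \<partial>lborel) \<noteq> 0"
    proof
      assume "(\<integral>y. limit_density \<pi> y \<partial>lborel) = 0"
      then have "AE y in lborel. limit_density \<pi> y = 0"
        using integral_nonneg_eq_0_iff_AE[OF lim_int] pos by (simp add: less_imp_le)
      then have "AE y in (lborel :: 'a measure). False"
        using pos by (auto elim!: eventually_mono simp: less_le)
      then show False by (simp add: eventually_False ae_filter_eq_bot_iff)
    qed
    moreover have "0 \<le> (\<integral>y. limit_density \<pi> y \<partial>lborel)"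
      using pos by (intro integral_nonneg_AE AE_I2) (simp add: less_imp_le)
    ultimately show ?thesis by simp
  qed
  define good where "good a t w \<longleftrightarrow> integrable lborel (local_density \<pi> t a w) \<and> 0 < (\<integral>y. local_density \<pi> t a w y \<partial>lborel) \<and>
      (\<integral>y. \<bar>local_density \<pi> t a w y / (\<integral>y. local_density \<pi> t a w y \<partial>lborel)
         - limit_density \<pi> y / (\<integral>y. limit_density \<pi> y \<partial>lborel)\<bar> \<partial>lborel) < \<epsilon>" for a t w
  \<comment> \<open>Keeps every counterexample within the ball of radius \<open>r\<close>, and its
    weights within half of \<open>1 / CARD('m)\<close> of the limit, hence admissible.\<close>
  define m where "m = min r (1 / (2 * real CARD('m)))"
  have m: "m > 0" using r by (simp add: m_def)
  define \<delta> where "\<delta> n = m / (real n + 1)" for n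
  have \<delta>: "0 < \<delta> n" "\<delta> n \<le> r" "\<delta> n \<le> 1 / (2 * real CARD('m))" for n
  proof -
    show "0 < \<delta> n" using m by (simp add: \<delta>_def add_pos_nonneg)
    have "\<delta> n \<le> m" using m by (simp add: \<delta>_def field_simps)
    then show "\<delta> n \<le> r" "\<delta> n \<le> 1 / (2 * real CARD('m))" by (auto simp: m_def)
  qed
  have \<delta>0: "\<delta> \<longlonglongrightarrow> 0" unfolding \<delta>_def by real_asymp
  have "\<exists>n. \<forall>a t w. dist a \<theta>0 < \<delta> n \<longrightarrow> t > 1 / \<delta> n \<longrightarrow> (\<forall>i. \<bar>w i - 1 / CARD('m)\<bar> < \<delta> n) \<longrightarrow> good a t w"
  proof (rule ccontr)
    assume "\<not> ?thesis"
    \<comment> \<open>Base point, time and weights are packed into one tuple so that a single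
      application of choice yields the three sequences.\<close>
    then have "\<forall>n. \<exists>z. dist (fst z) \<theta>0 < \<delta> n \<and> fst (snd z) > 1 / \<delta> n
        \<and> (\<forall>i. \<bar>snd (snd z) i - 1 / CARD('m)\<bar> < \<delta> n) \<and> \<not> good (fst z) (fst (snd z)) (snd (snd z))"
      by simp
    from choice[OF this] obtain z where z: "\<forall>n. dist (fst (z n)) \<theta>0 < \<delta> n \<and> fst (snd (z n)) > 1 / \<delta> n
        \<and> (\<forall>i. \<bar>snd (snd (z n)) i - 1 / CARD('m)\<bar> < \<delta> n) \<and> \<not> good (fst (z n)) (fst (snd (z n))) (snd (snd (z n)))" ..
    define a t w where "a n = fst (z n)" and "t n = fst (snd (z n))" and "w n = snd (snd (z n))" for n
    have seq: "\<And>n. dist (a n) \<theta>0 < \<delta> n" "\<And>n. t n > 1 / \<delta> n"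
      "\<And>n i. \<bar>w n i - 1 / CARD('m)\<bar> < \<delta> n" "\<And>n. \<not> good (a n) (t n) (w n)"
      using z by (auto simp: a_def t_def w_def)
    have tpos: "t n > 0" for n using seq(2)[of n] \<delta>(1)[of n] by (meson divide_pos_pos less_trans zero_less_one)
    have "filterlim (\<lambda>n. 1 / \<delta> n) at_top sequentially"
    proof -
      have "filterlim (\<lambda>n. (1 / m) * (1 + real n)) at_top sequentially"
        using m by (intro filterlim_tendsto_pos_mult_at_top[OF tendsto_const]
            filterlim_tendsto_add_at_top[OF tendsto_const filterlim_real_sequentially]) auto
      then show ?thesis by (simp add: \<delta>_def add.commute)
    qed
    then have tlim: "filterlim t at_top sequentially"
      by (rule filterlim_at_top_mono) (use seq(2) in \<open>auto intro!: always_eventually less_imp_le\<close>)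
    have alim: "a \<longlonglongrightarrow> \<theta>0"
      by (rule tendsto_dist_iff[THEN iffD2], rule tendsto_sandwich[OF _ _ tendsto_const \<delta>0])
        (use seq(1) in \<open>auto intro!: always_eventually less_imp_le\<close>)
    have ain: "a n \<in> ball \<theta>0 r" for n using seq(1)[of n] \<delta>(2)[of n] by (simp add: dist_commute)
    have wlim: "(\<lambda>n. w n i) \<longlonglongrightarrow> 1 / CARD('m)" for i
      by (rule tendsto_dist_iff[THEN iffD2], rule tendsto_sandwich[OF _ _ tendsto_const \<delta>0])
        (use seq(3) in \<open>auto intro!: always_eventually less_imp_le simp: dist_real_def\<close>)
    have wadm: "admissible_weights (w n)" for n
      unfolding admissible_weights_def
    proof
      fix i
      have "1 / real CARD('m) = 2 * (1 / (2 * real CARD('m)))" by simp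
      then show "1 / (2 * real CARD('m)) \<le> w n i" using seq(3)[of n i] \<delta>(3)[of n] by linarith
    qed
    note L1 = local_density_L1_sequence[OF meas \<pi>0 \<pi>1 \<pi>cont rk K alim ain tlim tpos wlim wadm]
    define e where "e n = (\<integral>y. \<bar>local_density \<pi> (t n) (a n) (w n) y - limit_density \<pi> y\<bar> \<partial>lborel)" for n
    define b where "b = (\<integral>y. limit_density \<pi> y \<partial>lborel)"
    have e0: "e \<longlonglongrightarrow> 0" using L1(1) by (simp add: e_def[abs_def])
    have b: "b > 0" using lim_pos by (simp add: b_def)
    have "(\<lambda>n. 2 * e n / b) \<longlonglongrightarrow> 2 * 0 / b" using b by (intro tendsto_intros e0) auto
    then have "\<forall>\<^sub>F n in sequentially. 2 * e n / b < \<epsilon>" using \<epsilon> by (intro order_tendstoD(2)) auto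
    moreover have "\<forall>\<^sub>F n in sequentially. e n < b" by (rule order_tendstoD(2)[OF e0 b])
    ultimately have "\<forall>\<^sub>F n in sequentially. good (a n) (t n) (w n)"
    proof eventually_elim
      case (elim n)
      let ?f = "local_density \<pi> (t n) (a n) (w n)"
      have f0: "0 \<le> ?f y" for y using \<pi>0 by (simp add: local_density_def)
      have "\<bar>(\<integral>y. ?f y \<partial>lborel) - b\<bar> \<le> e n"
      proof -
        have "(\<integral>y. ?f y \<partial>lborel) - b = (\<integral>y. ?f y - limit_density \<pi> y \<partial>lborel)"
          using L1(2)[of n] lim_int by (simp add: b_def)
        then show ?thesis unfolding e_def by (simp only: integral_abs_bound)
      qed
      then have "0 < (\<integral>y. ?f y \<partial>lborel)" using elim by linarith
      moreover have "(\<integral>y. \<bar>?f y / (\<integral>y. ?f y \<partial>lborel) - limit_density \<pi> y / b\<bar> \<partial>lborel) \<le> 2 * e n / b"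
        unfolding b_def e_def by (rule L1_normalize_le[OF L1(2) f0 lim_int lim_pos])
      ultimately show ?case using elim L1(2)[of n] by (simp add: good_def b_def)
    qed
    then show False using seq(4) by (simp add: eventually_False)
  qed
  then obtain n where "\<forall>a t w. dist a \<theta>0 < \<delta> n \<longrightarrow> t > 1 / \<delta> n \<longrightarrow> (\<forall>i. \<bar>w i - 1 / CARD('m)\<bar> < \<delta> n) \<longrightarrow> good a t w"
    by blast
  then show ?thesis using \<delta>(1)[of n] unfolding good_def by blast
qed

text \<open>Convexity at \<open>a\<close> bounds the divergence from \<open>\<theta>0\<close> to
  \<open>a\<close> by the inner product of \<open>a - \<theta>0\<close> with the difference of
  gradients. Cauchy-Schwarz and division by the distance leave a lower bound on the gradient
  difference: close gradients force close points.\<close>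

lemma critical_point_close:
  assumes rk: "\<And>d w. \<theta>0 + d \<in> \<Theta> \<Longrightarrow> admissible_weights w \<Longrightarrow>
        \<kappa> * norm d * min (norm d) r \<le> (\<Sum>i\<in>UNIV. w i * bregman i \<theta>0 d)"
    and "r > 0" "\<kappa> > 0" "a \<in> \<Theta>" "admissible_weights w"
  shows "\<kappa> * min (dist a \<theta>0) r \<le> norm ((\<Sum>i\<in>UNIV. w i *\<^sub>R \<mu> i a) - (\<Sum>i\<in>UNIV. w i *\<^sub>R \<mu> i \<theta>0))"
proof (cases "a = \<theta>0")
  case False
  define d where "d = a - \<theta>0"
  have ad: "a = \<theta>0 + d" by (simp add: d_def)
  have nd: "norm d > 0" using False by (simp add: d_def)
  let ?g = "(\<Sum>i\<in>UNIV. w i *\<^sub>R \<mu> i a) - (\<Sum>i\<in>UNIV. w i *\<^sub>R \<mu> i \<theta>0)"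
  have w0: "w i \<ge> 0" for i using assms(5) by (auto simp: admissible_weights_def intro: order_trans[rotated])
  have "\<kappa> * norm d * min (norm d) r \<le> (\<Sum>i\<in>UNIV. w i * bregman i \<theta>0 d)"
    using assms(4,5) by (intro rk) (auto simp: ad)
  also have "\<dots> \<le> (\<Sum>i\<in>UNIV. w i * (d \<bullet> \<mu> i a - d \<bullet> \<mu> i \<theta>0))"
  proof (intro sum_mono mult_left_mono w0)
    fix i
    have "\<psi> i a + (\<theta>0 - a) \<bullet> \<mu> i a \<le> \<psi> i \<theta>0" by (rule convex[OF assms(4) Theta(2)])
    then show "bregman i \<theta>0 d \<le> d \<bullet> \<mu> i a - d \<bullet> \<mu> i \<theta>0"
      by (simp add: bregman_def d_def inner_diff_left)
  qed
  also have "\<dots> = d \<bullet> ?g" by (simp add: inner_diff_right inner_sum_right sum_subtractf right_diff_distrib)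
  also have "\<dots> \<le> norm d * norm ?g" by (rule norm_cauchy_schwarz)
  finally have "norm d * (\<kappa> * min (norm d) r) \<le> norm d * norm ?g" by (simp add: mult_ac)
  then show ?thesis using nd by (simp add: dist_norm d_def)
qed (use assms in auto)

end

section \<open>Deviation of weighted sums\<close>

text \<open>The four claims are proved together because the induction step needs integrability and
  mean zero of the partial sum to make the cross term vanish.\<close>

lemma (in prob_space) second_moment_sum_indep_centered:
  fixes Y :: "'i \<Rightarrow> 'a \<Rightarrow> real"
  assumes "finite I" and "indep_vars (\<lambda>_. borel) Y I"
    and "\<And>i. i \<in> I \<Longrightarrow> integrable M (\<lambda>x. (Y i x)\<^sup>2)" and "\<And>i. i \<in> I \<Longrightarrow> integrable M (Y i)"
    and "\<And>i. i \<in> I \<Longrightarrow> expectation (Y i) = 0"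
  shows "integrable M (\<lambda>x. \<Sum>i\<in>I. Y i x) \<and> expectation (\<lambda>x. \<Sum>i\<in>I. Y i x) = 0 \<and>
    integrable M (\<lambda>x. (\<Sum>i\<in>I. Y i x)\<^sup>2) \<and> expectation (\<lambda>x. (\<Sum>i\<in>I. Y i x)\<^sup>2) = (\<Sum>i\<in>I. expectation (\<lambda>x. (Y i x)\<^sup>2))"
  using assms
proof (induction I rule: finite_induct)
  case (insert j I)
  define S where "S x = (\<Sum>i\<in>I. Y i x)" for x
  have IH: "integrable M S" "expectation S = 0" "integrable M (\<lambda>x. (S x)\<^sup>2)"
    "expectation (\<lambda>x. (S x)\<^sup>2) = (\<Sum>i\<in>I. expectation (\<lambda>x. (Y i x)\<^sup>2))"
    using insert.IH[OF indep_vars_subset[OF insert.prems(1)]] insert.prems by (auto simp: S_def[abs_def])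
  have ind: "indep_var borel (Y j) borel S"
    unfolding S_def[abs_def] using indep_vars_sum[OF insert.hyps insert.prems(1)] .
  have Yj: "integrable M (Y j)" "integrable M (\<lambda>x. (Y j x)\<^sup>2)" "expectation (Y j) = 0" using insert.prems by auto
  have prod: "expectation (\<lambda>x. Y j x * S x) = 0" "integrable M (\<lambda>x. Y j x * S x)"
    using indep_var_lebesgue_integral[OF ind Yj(1) IH(1)] indep_var_integrable[OF ind Yj(1) IH(1)] Yj by auto
  have sum: "(\<Sum>i\<in>insert j I. Y i x) = Y j x + S x" for x using insert.hyps by (simp add: S_def)
  have sq: "(Y j x + S x)\<^sup>2 = (Y j x)\<^sup>2 + 2 * (Y j x * S x) + (S x)\<^sup>2" for x
    by (simp add: power2_sum)
  show ?case
    unfolding sum sq using IH Yj prod insert.hyps by auto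
qed auto

lemma (in prob_space) prob_weighted_sum_indep_centered_ge:
  fixes Y :: "'i \<Rightarrow> 'a \<Rightarrow> real"
  assumes I: "finite I" and ind: "indep_vars (\<lambda>_. borel) Y I"
    and sq: "\<And>i. i \<in> I \<Longrightarrow> integrable M (\<lambda>x. (Y i x)\<^sup>2)" and int: "\<And>i. i \<in> I \<Longrightarrow> integrable M (Y i)"
    and mean: "\<And>i. i \<in> I \<Longrightarrow> expectation (Y i) = 0"
    and C: "\<And>i. i \<in> I \<Longrightarrow> expectation (\<lambda>x. (Y i x)\<^sup>2) \<le> C"
    and w: "\<And>i. i \<in> I \<Longrightarrow> \<bar>w i\<bar> \<le> 1" and a: "a > 0"
  shows "prob {x\<in>space M. a \<le> \<bar>\<Sum>i\<in>I. w i * Y i x\<bar>} \<le> C * card I / a\<^sup>2"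
proof -
  define S where "S x = (\<Sum>i\<in>I. w i * Y i x)" for x
  have ind': "indep_vars (\<lambda>_. borel) (\<lambda>i x. w i * Y i x) I"
    by (rule indep_vars_compose2[OF ind]) auto
  have m: "integrable M S" "expectation S = 0" "integrable M (\<lambda>x. (S x)\<^sup>2)"
    "expectation (\<lambda>x. (S x)\<^sup>2) = (\<Sum>i\<in>I. expectation (\<lambda>x. (w i * Y i x)\<^sup>2))"
    using second_moment_sum_indep_centered[OF I ind'] sq int mean
    by (auto simp: S_def[abs_def] power_mult_distrib)
  have "expectation (\<lambda>x. (S x)\<^sup>2) \<le> (\<Sum>i\<in>I. C)"
    unfolding m(4)
  proof (rule sum_mono)
    fix i assume i: "i \<in> I"
    have "(w i)\<^sup>2 \<le> 1" using w[OF i] by (simp add: abs_square_le_1)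
    then have "(w i)\<^sup>2 * expectation (\<lambda>x. (Y i x)\<^sup>2) \<le> 1 * C"
      using C[OF i] by (intro mult_mono) auto
    then show "expectation (\<lambda>x. (w i * Y i x)\<^sup>2) \<le> C" by (simp add: power_mult_distrib)
  qed
  then have var: "expectation (\<lambda>x. (S x)\<^sup>2) \<le> C * card I" by (simp add: mult.commute)
  have "prob {x\<in>space M. a \<le> \<bar>S x - expectation S\<bar>} \<le> variance S / a\<^sup>2"
    using m a by (intro Chebyshev_inequality) auto
  also have "\<dots> \<le> C * card I / a\<^sup>2" using var m(2) by (simp add: divide_right_mono)
  finally show ?thesis using m(2) by (simp add: S_def)
qed

text \<open>Chebyshev's inequality in each coordinate and a union bound. \<open>K\<close> is chosen
  before time, weights and threshold: weights of absolute value at most 1 do not increase the second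
  moments, so the weights at each time may vary with \<open>t\<close>.\<close>

lemma (in prob_space) prob_weighted_sum_deviation_le:
  fixes X :: "nat \<Rightarrow> 'm::finite \<Rightarrow> 'a \<Rightarrow> 'x" and T :: "'m \<Rightarrow> 'x \<Rightarrow> 'b::euclidean_space" and \<mu> :: "'m \<Rightarrow> 'b"
  assumes ind: "indep_vars (\<lambda>_. \<nu>) (\<lambda>(k, j). X k j) ({1..} \<times> UNIV)"
    and law: "\<And>k i. 1 \<le> k \<Longrightarrow> distr M \<nu> (X k i) = N"
    and T [measurable]: "\<And>i. T i \<in> borel_measurable \<nu>"
    and int: "\<And>i b. integrable N (\<lambda>x. b \<bullet> T i x)" "\<And>i b. integrable N (\<lambda>x. (b \<bullet> T i x) * (b \<bullet> T i x))"
    and mean: "\<And>i b. (\<integral>x. b \<bullet> T i x \<partial>N) = b \<bullet> \<mu> i"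
  shows "\<exists>K. \<forall>t w \<eta>. 0 < t \<longrightarrow> (\<forall>k i. \<bar>w k i\<bar> \<le> 1) \<longrightarrow> 0 < \<eta> \<longrightarrow>
    {\<omega> \<in> space M. \<eta> * real t \<le> norm (\<Sum>k=1..t. \<Sum>i\<in>UNIV. w k i *\<^sub>R (T i (X k i \<omega>) - \<mu> i))} \<in> events \<and>
    prob {\<omega> \<in> space M. \<eta> * real t \<le> norm (\<Sum>k=1..t. \<Sum>i\<in>UNIV. w k i *\<^sub>R (T i (X k i \<omega>) - \<mu> i))} \<le> K / (\<eta>\<^sup>2 * real t)"
proof -
  have Xm [measurable]: "X k i \<in> measurable M \<nu>" if "1 \<le> k" for k i
    using ind that unfolding indep_vars_def by (auto simp: Ball_def)
  define c where "c b i = (\<integral>x. (b \<bullet> T i x - b \<bullet> \<mu> i)\<^sup>2 \<partial>N)" for b i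
  define C where "C = (\<Sum>b\<in>Basis. \<Sum>i\<in>UNIV. c b i)"
  define d where "d = real DIM('b)"
  have d: "d > 0" by (simp add: d_def)
  have c0: "0 \<le> c b i" for b i unfolding c_def by (auto intro!: integral_nonneg_AE)
  have cC: "c b i \<le> C" if "b \<in> Basis" for b i
  proof -
    have "c b i \<le> (\<Sum>i\<in>UNIV. c b i)" by (rule member_le_sum) (auto simp: c0)
    also have "\<dots> \<le> C" unfolding C_def using that by (intro member_le_sum[of b]) (auto intro!: sum_nonneg c0)
    finally show ?thesis .
  qed
  have N: "prob_space N"
    using prob_space_distr[OF Xm[of 1 undefined]] law[of 1 undefined] by simp
  have Nsets: "sets N = sets \<nu>" using law[of 1 undefined] by auto
  have intsq: "integrable N (\<lambda>x. (b \<bullet> T i x - b \<bullet> \<mu> i)\<^sup>2)" for b i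
  proof -
    interpret N: prob_space N by (rule N)
    have "integrable N (\<lambda>x. (b \<bullet> T i x) * (b \<bullet> T i x) - 2 * (b \<bullet> \<mu> i) * (b \<bullet> T i x) + (b \<bullet> \<mu> i)\<^sup>2)"
      using int[of b i] by auto
    then show ?thesis by (simp add: power2_diff power2_eq_square algebra_simps)
  qed
  have int1: "integrable N (\<lambda>x. b \<bullet> T i x - b \<bullet> \<mu> i)" for b i
  proof -
    interpret N: prob_space N by (rule N)
    show ?thesis using int(1)[of b i] by auto
  qed
  have mean0: "(\<integral>x. b \<bullet> T i x - b \<bullet> \<mu> i \<partial>N) = 0" for b i
  proof -
    interpret N: prob_space N by (rule N)
    show ?thesis using int(1)[of b i] by (simp add: mean N.prob_space)
  qed
  define Y where "Y b z \<omega> = (case z of (k, i) \<Rightarrow> b \<bullet> T i (X k i \<omega>) - b \<bullet> \<mu> i)" for b z \<omega>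
  have indY: "indep_vars (\<lambda>_. borel) (Y b) ({1..t} \<times> UNIV)" for b t
  proof -
    have "indep_vars (\<lambda>_. borel) (\<lambda>z \<omega>. (\<lambda>(k, i) x. b \<bullet> T i x - b \<bullet> \<mu> i) z ((\<lambda>(k, j). X k j) z \<omega>)) ({1..t} \<times> UNIV)"
      by (rule indep_vars_compose2[OF indep_vars_subset[OF ind]]) auto
    moreover have "(\<lambda>z \<omega>. (\<lambda>(k, i) x. b \<bullet> T i x - b \<bullet> \<mu> i) z ((\<lambda>(k, j). X k j) z \<omega>)) = Y b"
      by (auto simp: fun_eq_iff Y_def)
    ultimately show ?thesis by simp
  qed
  have Yint: "integrable M (Y b (k, i))" "expectation (Y b (k, i)) = 0"
    "integrable M (\<lambda>\<omega>. (Y b (k, i) \<omega>)\<^sup>2)" "expectation (\<lambda>\<omega>. (Y b (k, i) \<omega>)\<^sup>2) = c b i"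
    if k: "1 \<le> k" for b k i
  proof -
    have 1: "integrable M (\<lambda>\<omega>. f (X k i \<omega>))" "expectation (\<lambda>\<omega>. f (X k i \<omega>)) = (\<integral>x. f x \<partial>N)"
      if "f \<in> borel_measurable \<nu>" "integrable N f" for f :: "'x \<Rightarrow> real"
      using that integrable_distr_eq[OF Xm[OF k], of f i] integral_distr[OF Xm[OF k], of f i] law[OF k, of i] by simp_all
    show "integrable M (Y b (k, i))" "expectation (Y b (k, i)) = 0"
      using 1[OF _ int1[of b i]] mean0 by (simp_all add: Y_def[abs_def])
    show "integrable M (\<lambda>\<omega>. (Y b (k, i) \<omega>)\<^sup>2)" "expectation (\<lambda>\<omega>. (Y b (k, i) \<omega>)\<^sup>2) = c b i"
      using 1[OF _ intsq[of b i]] by (simp_all add: Y_def[abs_def] c_def)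
  qed
  \<comment> \<open>One factor \<open>d\<close> from the union over coordinates,
    \<open>d\<^sup>2\<close> from the coordinate threshold \<open>\<eta> * real t / d\<close>, and
    \<open>C * real CARD('m)\<close> bounding the variance added per time step.\<close>
  define K where "K = d * (C * real CARD('m) * d\<^sup>2)"
  show ?thesis
  proof (intro exI[of _ K] allI impI)
    fix t :: nat and w :: "nat \<Rightarrow> 'm \<Rightarrow> real" and \<eta> :: real
    assume t: "0 < t" and w: "\<forall>k i. \<bar>w k i\<bar> \<le> 1" and \<eta>: "0 < \<eta>"
    define I where "I = {1..t} \<times> (UNIV :: 'm set)"
    define S where "S \<omega> = (\<Sum>k=1..t. \<Sum>i\<in>UNIV. w k i *\<^sub>R (T i (X k i \<omega>) - \<mu> i))" for \<omega>
    \<comment> \<open>If all \<open>d\<close> coordinates were below this, the l1 norm, and with it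
      the norm, would be below \<open>\<eta> * real t\<close>.\<close>
    define a where "a = \<eta> * real t / d"
    have a: "a > 0" using t \<eta> d by (simp add: a_def)
    have [measurable]: "S \<in> borel_measurable M"
      unfolding S_def[abs_def] by (intro borel_measurable_sum borel_measurable_scaleR borel_measurable_diff
          borel_measurable_const measurable_compose[OF Xm T]) auto
    have Sb: "b \<bullet> S \<omega> = (\<Sum>z\<in>I. (case z of (k, i) \<Rightarrow> w k i) * Y b z \<omega>)" for b \<omega>
      unfolding S_def I_def inner_sum_right sum.cartesian_product
      by (intro sum.cong refl) (auto simp: Y_def inner_diff_right)
    define D where "D b = {\<omega> \<in> space M. a \<le> \<bar>b \<bullet> S \<omega>\<bar>}" for b
    have D [measurable]: "D b \<in> events" for b unfolding D_def by measurable
    have PD: "prob (D b) \<le> C * card I / a\<^sup>2" if b: "b \<in> Basis" for b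
      unfolding D_def Sb
    proof (rule prob_weighted_sum_indep_centered_ge)
      show "indep_vars (\<lambda>_. borel) (Y b) I" unfolding I_def by (rule indY)
      fix z assume "z \<in> I"
      then obtain k i where z: "z = (k, i)" "1 \<le> k" by (auto simp: I_def)
      show "integrable M (\<lambda>x. (Y b z x)\<^sup>2)" "integrable M (Y b z)" "expectation (Y b z) = 0"
        "expectation (\<lambda>x. (Y b z x)\<^sup>2) \<le> C"
        using Yint[OF z(2), of b i] cC[OF b, of i] by (simp_all add: z)
      show "\<bar>case z of (k, i) \<Rightarrow> w k i\<bar> \<le> 1" using w by (simp add: z)
    qed (auto simp: I_def a)
    have sub: "{\<omega> \<in> space M. \<eta> * real t \<le> norm (S \<omega>)} \<subseteq> (\<Union>b\<in>Basis. D b)"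
    proof
      fix \<omega> assume \<omega>: "\<omega> \<in> {\<omega> \<in> space M. \<eta> * real t \<le> norm (S \<omega>)}"
      show "\<omega> \<in> (\<Union>b\<in>Basis. D b)"
      proof (rule ccontr)
        assume "\<omega> \<notin> (\<Union>b\<in>Basis. D b)"
        then have *: "\<bar>b \<bullet> S \<omega>\<bar> < a" if "b \<in> Basis" for b using \<omega> that by (auto simp: D_def)
        have "norm (S \<omega>) \<le> (\<Sum>b\<in>Basis. \<bar>S \<omega> \<bullet> b\<bar>)" by (rule norm_le_l1)
        also have "\<dots> < (\<Sum>b\<in>(Basis::'b set). a)"
          using * by (intro sum_strict_mono) (auto simp: inner_commute)
        also have "\<dots> = \<eta> * real t" using d by (simp add: a_def d_def)
        finally show False using \<omega> by simp
      qed
    qed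
    have "prob {\<omega> \<in> space M. \<eta> * real t \<le> norm (S \<omega>)} \<le> prob (\<Union>b\<in>Basis. D b)"
      by (rule finite_measure_mono[OF sub]) (auto intro!: sets.finite_UN)
    also have "\<dots> \<le> (\<Sum>b\<in>Basis. prob (D b))"
      by (rule finite_measure_subadditive_finite) auto
    also have "\<dots> \<le> (\<Sum>b\<in>(Basis::'b set). C * card I / a\<^sup>2)" by (intro sum_mono PD)
    also have "\<dots> = K / (\<eta>\<^sup>2 * real t)"
      using t \<eta> d by (simp add: K_def a_def I_def d_def power2_eq_square card_cartesian_product field_simps)
    finally have P: "prob {\<omega> \<in> space M. \<eta> * real t \<le> norm (S \<omega>)} \<le> K / (\<eta>\<^sup>2 * real t)" .
    have "{\<omega> \<in> space M. \<eta> * real t \<le> norm (S \<omega>)} \<in> events" by measurable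
    with P show "{\<omega> \<in> space M. \<eta> * real t \<le> norm (\<Sum>k=1..t. \<Sum>i\<in>UNIV. w k i *\<^sub>R (T i (X k i \<omega>) - \<mu> i))} \<in> events \<and>
      prob {\<omega> \<in> space M. \<eta> * real t \<le> norm (\<Sum>k=1..t. \<Sum>i\<in>UNIV. w k i *\<^sub>R (T i (X k i \<omega>) - \<mu> i))} \<le> K / (\<eta>\<^sup>2 * real t)"
      unfolding S_def by blast
  qed
qed

section \<open>The posterior of an exponential family\<close>

locale expfam_model =
  fixes \<nu> :: "'x measure" and h :: "'x \<Rightarrow> real" and T :: "'x \<Rightarrow> real^'p::finite" and \<Theta> :: "(real^'p) set"
    and \<psi> :: "real^'p \<Rightarrow> real"
  assumes open_parameters: "open \<Theta>"
    and h_measurable [measurable]: "h \<in> borel_measurable \<nu>" and h_nonneg: "\<And>x. x \<in> space \<nu> \<Longrightarrow> 0 \<le> h x"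
    and statistic_measurable [measurable]: "T \<in> borel_measurable \<nu>"
    and prob: "\<And>\<theta>. \<theta> \<in> \<Theta> \<Longrightarrow> prob_space (density \<nu> (\<lambda>x. ennreal (expfam_density h T \<psi> \<theta> x)))"
begin

abbreviation base_measure :: "'x measure" where
  "base_measure \<equiv> density \<nu> (\<lambda>x. ennreal (h x))"

abbreviation model :: "real^'p \<Rightarrow> 'x measure" where
  "model \<theta> \<equiv> density \<nu> (\<lambda>x. ennreal (expfam_density h T \<psi> \<theta> x))"

lemma model_eq: "model \<theta> = density base_measure (\<lambda>x. ennreal (exp (\<theta> \<bullet> T x - \<psi> \<theta>)))"
  by (subst density_density_eq)
    (auto simp: expfam_density_def ennreal_mult' h_nonneg intro!: density_cong AE_I2)

lemma nn_integral_exp: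
  assumes "\<theta> \<in> \<Theta>"
  shows "(\<integral>\<^sup>+x. ennreal (exp (\<theta> \<bullet> T x)) \<partial>base_measure) = ennreal (exp (\<psi> \<theta>))"
proof -
  have "(\<integral>\<^sup>+x. ennreal (exp (\<theta> \<bullet> T x - \<psi> \<theta>)) \<partial>base_measure) = 1"
  proof -
    have "(\<integral>\<^sup>+x. ennreal (exp (\<theta> \<bullet> T x - \<psi> \<theta>)) \<partial>base_measure)
      = (\<integral>\<^sup>+x. ennreal (exp (\<theta> \<bullet> T x - \<psi> \<theta>)) * indicator (space base_measure) x \<partial>base_measure)"
      by (intro nn_integral_cong) (auto simp: indicator_def)
    also have "\<dots> = emeasure (density base_measure (\<lambda>x. ennreal (exp (\<theta> \<bullet> T x - \<psi> \<theta>)))) (space base_measure)"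
      by (rule emeasure_density[symmetric]) auto
    also have "\<dots> = 1"
      using prob_space.emeasure_space_1[OF prob[OF assms]] unfolding model_eq by simp
    finally show ?thesis .
  qed
  then have "ennreal (exp (\<psi> \<theta>)) = ennreal (exp (\<psi> \<theta>)) * (\<integral>\<^sup>+x. ennreal (exp (\<theta> \<bullet> T x - \<psi> \<theta>)) \<partial>base_measure)"
    by simp
  also have "\<dots> = (\<integral>\<^sup>+x. ennreal (exp (\<psi> \<theta>)) * ennreal (exp (\<theta> \<bullet> T x - \<psi> \<theta>)) \<partial>base_measure)"
    by (rule nn_integral_cmult[symmetric]) measurable
  also have "\<dots> = (\<integral>\<^sup>+x. ennreal (exp (\<theta> \<bullet> T x)) \<partial>base_measure)"
    by (simp flip: ennreal_mult exp_add)
  finally show ?thesis by simp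
qed

text \<open>That the model has total mass one says precisely that
  \<open>exp (\<psi> \<theta>)\<close> is the Laplace transform of the base measure.\<close>

sublocale exponential_family base_measure T \<Theta> \<psi>
proof
  fix \<theta> assume \<theta>: "\<theta> \<in> \<Theta>"
  show int: "integrable base_measure (\<lambda>x. exp (\<theta> \<bullet> T x))"
    using nn_integral_exp[OF \<theta>] by (intro integrableI_nonneg) (auto simp del: nn_integral_density)
  show "(\<integral>x. exp (\<theta> \<bullet> T x) \<partial>base_measure) = exp (\<psi> \<theta>)"
    using nn_integral_exp[OF \<theta>] int by (subst (asm) nn_integral_eq_integral) auto
qed (auto simp: open_parameters)

lemma integral_model:
  fixes f :: "'x \<Rightarrow> real"
  assumes [measurable]: "f \<in> borel_measurable \<nu>"
  shows "(\<integral>x. f x \<partial>model \<theta>) = laplace f \<theta> / exp (\<psi> \<theta>)"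
  unfolding model_eq laplace_def
  by (subst integral_real_density) (auto simp: exp_diff mult_ac simp flip: Bochner_Integration.integral_divide_zero)

lemma integrable_model:
  fixes f :: "'x \<Rightarrow> real"
  assumes "\<theta> \<in> \<Theta>" and [measurable]: "f \<in> borel_measurable \<nu>" and "\<And>x. \<bar>f x\<bar> \<le> c * norm (T x) ^ k"
  shows "integrable (model \<theta>) f"
proof -
  have "integrable base_measure (\<lambda>x. (1 / exp (\<psi> \<theta>)) * (f x * exp (\<theta> \<bullet> T x)))"
    by (intro integrable_mult_right integrable_poly_exp[OF assms(1) _ assms(3)]) simp
  then show ?thesis
    unfolding model_eq by (subst integrable_real_density) (auto simp: exp_diff mult_ac)
qed

lemma integrable_model_inner: "\<theta> \<in> \<Theta> \<Longrightarrow> integrable (model \<theta>) (\<lambda>x. d \<bullet> T x)"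
  by (rule integrable_model[OF _ _ abs_inner_le_power]) auto

lemma integrable_model_inner_mult: "\<theta> \<in> \<Theta> \<Longrightarrow> integrable (model \<theta>) (\<lambda>x. (d \<bullet> T x) * (e \<bullet> T x))"
  by (rule integrable_model[OF _ _ abs_inner_mult_le_power]) auto

lemma mean_model: "\<theta> \<in> \<Theta> \<Longrightarrow> (\<integral>x. d \<bullet> T x \<partial>model \<theta>) = d \<bullet> mean_param \<theta>"
  by (simp add: integral_model inner_mean_param)

lemma model_total: "\<theta> \<in> \<Theta> \<Longrightarrow> measure (model \<theta>) (space \<nu>) = 1"
  using prob_space.prob_space[OF prob] by simp

lemma covariance_model:
  assumes \<theta>: "\<theta> \<in> \<Theta>"
  shows "(\<integral>x. (d \<bullet> T x - d \<bullet> mean_param \<theta>) * (e \<bullet> T x - e \<bullet> mean_param \<theta>) \<partial>model \<theta>) = cov_form \<theta> d e"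
proof -
  interpret P: prob_space "model \<theta>" by (rule prob[OF \<theta>])
  have "(\<integral>x. (d \<bullet> T x - d \<bullet> mean_param \<theta>) * (e \<bullet> T x - e \<bullet> mean_param \<theta>) \<partial>model \<theta>)
    = (\<integral>x. (d \<bullet> T x) * (e \<bullet> T x) - (e \<bullet> mean_param \<theta>) * (d \<bullet> T x) - (d \<bullet> mean_param \<theta>) * (e \<bullet> T x)
        + (d \<bullet> mean_param \<theta>) * (e \<bullet> mean_param \<theta>) \<partial>model \<theta>)"
    by (intro Bochner_Integration.integral_cong) (auto simp: algebra_simps)
  also have "\<dots> = (\<integral>x. (d \<bullet> T x) * (e \<bullet> T x) \<partial>model \<theta>) - (d \<bullet> mean_param \<theta>) * (e \<bullet> mean_param \<theta>)"
    using integrable_model_inner[OF \<theta>] integrable_model_inner_mult[OF \<theta>]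
    by (simp add: mean_model[OF \<theta>] model_total[OF \<theta>])
  also have "\<dots> = cov_form \<theta> d e"
    by (simp add: cov_form_def integral_model inner_mean_param[OF \<theta>])
  finally show ?thesis .
qed

lemma cov_matrix_nth:
  assumes "\<theta> \<in> \<Theta>"
  shows "cov_matrix (model \<theta>) T $ a $ b = cov_form \<theta> (axis a 1) (axis b 1)"
  using covariance_model[OF assms, of "axis a 1" "axis b 1"] mean_model[OF assms, of "axis a 1"] mean_model[OF assms, of "axis b 1"]
  by (simp add: cov_matrix_def inner_axis')

lemma cov_matrix_symmetric: "transpose (cov_matrix N T) = cov_matrix N T"
  by (simp add: transpose_def cov_matrix_def vec_eq_iff mult.commute)

lemma cov_matrix_quadratic_form:
  assumes "\<theta> \<in> \<Theta>"
  shows "x \<bullet> (cov_matrix (model \<theta>) T *v x) = cov_form \<theta> x x"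
proof -
  have inj: "inj (\<lambda>i. axis i (1::real) :: real^'p)" by (auto simp: inj_on_def axis_eq_axis)
  have B: "Basis = range (\<lambda>i. axis i (1::real) :: real^'p)" by (auto simp: Basis_vec_def)
  have "x \<bullet> (cov_matrix (model \<theta>) T *v x) = (\<Sum>a\<in>UNIV. \<Sum>b\<in>UNIV. x $ a * x $ b * cov_form \<theta> (axis a 1) (axis b 1))"
    by (simp add: inner_vec_def matrix_vector_mult_def cov_matrix_nth[OF assms] sum_distrib_left mult_ac)
  also have "\<dots> = cov_form \<theta> x x"
    by (subst cov_form_Basis[OF assms]) (simp add: B sum.reindex[OF inj] inner_axis)
  finally show ?thesis .
qed

lemma cov_form_nonneg: "\<theta> \<in> \<Theta> \<Longrightarrow> 0 \<le> cov_form \<theta> d d"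
  by (subst covariance_model[symmetric]) (auto intro!: integral_nonneg_AE)

text \<open>Zero variance makes \<open>d \<bullet> T\<close> almost everywhere a constant
  \<open>c\<close>. Moving by \<open>s *\<^sub>R d\<close> then multiplies the unnormalized density
  by the constant \<open>exp (s * c)\<close>, which \<open>\<psi>\<close> takes up.\<close>

lemma model_shift_eq_of_cov_form_eq_0:
  assumes \<theta>: "\<theta> \<in> \<Theta>" and z: "cov_form \<theta> d d = 0" and \<theta>': "\<theta> + s *\<^sub>R d \<in> \<Theta>"
  shows "model (\<theta> + s *\<^sub>R d) = model \<theta>"
proof -
  define c where "c = d \<bullet> mean_param \<theta>"
  interpret P: prob_space "model \<theta>" by (rule prob[OF \<theta>])
  have int: "integrable (model \<theta>) (\<lambda>x. (d \<bullet> T x - c) * (d \<bullet> T x - c))"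
  proof -
    have "integrable (model \<theta>) (\<lambda>x. (d \<bullet> T x) * (d \<bullet> T x) - 2 * c * (d \<bullet> T x) + c * c)"
      using integrable_model_inner[OF \<theta>] integrable_model_inner_mult[OF \<theta>] by simp
    then show ?thesis by (simp add: algebra_simps)
  qed
  have "(\<integral>x. (d \<bullet> T x - c) * (d \<bullet> T x - c) \<partial>model \<theta>) = 0"
    using covariance_model[OF \<theta>, of d d] z by (simp add: c_def)
  then have "AE x in model \<theta>. (d \<bullet> T x - c) * (d \<bullet> T x - c) = 0"
    by (subst (asm) integral_nonneg_eq_0_iff_AE[OF int]) auto
  \<comment> \<open>The model has a strictly positive density with respect to the base measure, so
    the two have the same null sets.\<close>
  then have ae: "AE x in base_measure. d \<bullet> T x = c"
    unfolding model_eq by (subst (asm) AE_density) auto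
  have "exp (\<psi> (\<theta> + s *\<^sub>R d)) = (\<integral>x. exp ((\<theta> + s *\<^sub>R d) \<bullet> T x) \<partial>base_measure)"
    by (rule integral_exp[OF \<theta>', symmetric])
  also have "\<dots> = (\<integral>x. exp (s * c) * exp (\<theta> \<bullet> T x) \<partial>base_measure)"
    using ae by (intro integral_cong_AE) (auto simp: inner_add_left exp_add mult.commute)
  also have "\<dots> = exp (s * c + \<psi> \<theta>)" by (simp add: integral_exp[OF \<theta>] exp_add)
  finally have \<psi>': "\<psi> (\<theta> + s *\<^sub>R d) = s * c + \<psi> \<theta>" by simp
  show ?thesis
    unfolding model_eq using ae by (intro density_cong) (auto simp: \<psi>' inner_add_left)
qed

text \<open>Almost surely no observation hits a zero of \<open>h\<close>, so powers of densities may
  be rewritten through logarithms and the convention for \<open>0 powr 0\<close> never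
  enters.\<close>

lemma AE_model_h_pos: "AE x in model \<theta>. 0 < h x"
proof -
  have "AE x in base_measure. 0 < h x" by (subst AE_density) (auto simp: ennreal_less_zero_iff)
  then show ?thesis unfolding model_eq by (subst AE_density) auto
qed

end

text \<open>The form attains a positive minimum on the compact unit sphere, and homogeneity carries
  it to all vectors.\<close>

lemma posdef_lower_bound:
  fixes V :: "real^'p::finite^'p"
  assumes pd: "\<And>x. x \<noteq> 0 \<Longrightarrow> 0 < x \<bullet> (V *v x)"
  shows "\<exists>l>0. \<forall>x. l * (norm x)\<^sup>2 \<le> x \<bullet> (V *v x)"
proof -
  have ne: "sphere (0 :: real^'p) 1 \<noteq> {}" by simp
  have "continuous_on (sphere (0 :: real^'p) 1) (\<lambda>x. x \<bullet> (V *v x))" by (intro continuous_intros)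
  then obtain u where u: "u \<in> sphere 0 1" "\<And>x. x \<in> sphere 0 1 \<Longrightarrow> u \<bullet> (V *v u) \<le> x \<bullet> (V *v x)"
    using continuous_attains_inf[OF compact_sphere ne, of "\<lambda>x. x \<bullet> (V *v x)"] by blast
  have "u \<bullet> (V *v u) * (norm x)\<^sup>2 \<le> x \<bullet> (V *v x)" for x
  proof (cases "x = 0")
    case False
    have "u \<bullet> (V *v u) \<le> (x /\<^sub>R norm x) \<bullet> (V *v (x /\<^sub>R norm x))" using False by (intro u(2)) simp
    also have "\<dots> = (x \<bullet> (V *v x)) / (norm x)\<^sup>2"
      by (simp add: matrix_vector_mult_scaleR power2_eq_square divide_inverse mult_ac)
    finally show ?thesis using False by (simp add: field_simps)
  qed simp
  moreover have "u \<bullet> (V *v u) > 0" using u(1) by (intro pd) auto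
  ultimately show ?thesis by blast
qed

text \<open>The unknown factor \<open>K\<close> and the Jacobian appear in numerator and normalizer
  and cancel. The equality holds almost everywhere only, because \<open>rescaled_density\<close> is
  a version of a Radon-Nikodym derivative.\<close>

lemma rescaled_density_affine:
  fixes G :: "real^'p::finite \<Rightarrow> real"
  assumes G: "integrable lborel G" "\<And>y. 0 \<le> G y" and I: "0 < (\<integral>y. G y \<partial>lborel)" and K: "K > 0" and t: "t > 0"
    and P: "P = density lborel (\<lambda>\<theta>. ennreal (K * G (sqrt (real t) *\<^sub>R (\<theta> - c)))
        / (\<integral>\<^sup>+\<theta>. ennreal (K * G (sqrt (real t) *\<^sub>R (\<theta> - c))) \<partial>lborel))"
  shows "AE y in lborel. rescaled_density P c t y = G y / (\<integral>y. G y \<partial>lborel)"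
proof -
  define I where "I = (\<integral>y. G y \<partial>lborel)"
  define s where "s = sqrt (real t)"
  have s: "s > 0" using t by (simp add: s_def)
  have I0: "I > 0" using I by (simp add: I_def)
  have [measurable]: "G \<in> borel_measurable borel" using G by (simp add: borel_measurable_integrable)
  have nnG: "(\<integral>\<^sup>+y. ennreal (G y) \<partial>lborel) = ennreal I"
    using G unfolding I_def by (intro nn_integral_eq_integral) auto
  \<comment> \<open>The Jacobian of the substitution
    \<open>\<theta> = c + y /\<^sub>R s\<close>.\<close>
  define r where "r = \<bar>1 / s\<bar> ^ CARD('p)"
  have r: "r > 0" using s by (simp add: r_def)
  define q where "q = ennreal r"
  have aff: "(\<integral>\<^sup>+\<theta>. f (s *\<^sub>R (\<theta> - c)) \<partial>lborel) = q * (\<integral>\<^sup>+y. f y \<partial>lborel)"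
    if [measurable]: "f \<in> borel_measurable borel" for f :: "real^'p \<Rightarrow> ennreal"
  proof -
    have "(\<integral>\<^sup>+\<theta>. f (s *\<^sub>R (\<theta> - c)) \<partial>lborel)
      = ennreal (\<bar>1 / s\<bar> ^ DIM(real^'p)) * (\<integral>\<^sup>+y. f (s *\<^sub>R ((c + (1 / s) *\<^sub>R y) - c)) \<partial>lborel)"
      by (rule nn_integral_lborel_affine) (use s in auto)
    then show ?thesis using s by (simp add: q_def r_def)
  qed
  define nrm where "nrm = (\<integral>\<^sup>+\<theta>. ennreal (K * G (s *\<^sub>R (\<theta> - c))) \<partial>lborel)"
  have nrm: "nrm = q * ennreal (K * I)"
  proof -
    have "nrm = q * (\<integral>\<^sup>+y. ennreal (K * G y) \<partial>lborel)" unfolding nrm_def by (rule aff) measurable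
    also have "(\<integral>\<^sup>+y. ennreal (K * G y) \<partial>lborel) = ennreal K * (\<integral>\<^sup>+y. ennreal (G y) \<partial>lborel)"
      using K by (simp add: ennreal_mult' nn_integral_cmult)
    finally show ?thesis using K by (simp add: nnG ennreal_mult')
  qed
  have Peq: "P = density lborel (\<lambda>\<theta>. ennreal (K * G (s *\<^sub>R (\<theta> - c))) / nrm)"
    unfolding P nrm_def s_def ..
  have "distr P lborel (\<lambda>\<theta>. s *\<^sub>R (\<theta> - c)) = density lborel (\<lambda>y. ennreal (G y / I))"
  proof (rule measure_eqI)
    fix A assume "A \<in> sets (distr P lborel (\<lambda>\<theta>. s *\<^sub>R (\<theta> - c)))"
    then have [measurable]: "A \<in> sets borel" by simp
    have mp: "(\<lambda>\<theta>. s *\<^sub>R (\<theta> - c)) \<in> measurable P lborel" by (simp add: Peq)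
    have "emeasure (distr P lborel (\<lambda>\<theta>. s *\<^sub>R (\<theta> - c))) A = (\<integral>\<^sup>+y. indicator A y \<partial>distr P lborel (\<lambda>\<theta>. s *\<^sub>R (\<theta> - c)))"
      by simp
    also have "\<dots> = (\<integral>\<^sup>+\<theta>. indicator A (s *\<^sub>R (\<theta> - c)) \<partial>P)"
      by (rule nn_integral_distr[OF mp]) simp
    also have "\<dots> = (\<integral>\<^sup>+\<theta>. (ennreal (K * G (s *\<^sub>R (\<theta> - c))) / nrm) * indicator A (s *\<^sub>R (\<theta> - c)) \<partial>lborel)"
      unfolding Peq by (rule nn_integral_density) measurable
    also have "\<dots> = q * (\<integral>\<^sup>+y. (ennreal (K * G y) / nrm) * indicator A y \<partial>lborel)"
      by (rule aff) measurable
    also have "\<dots> = (\<integral>\<^sup>+y. q * ((ennreal (K * G y) / nrm) * indicator A y) \<partial>lborel)"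
      by (rule nn_integral_cmult[symmetric]) measurable
    also have "\<dots> = (\<integral>\<^sup>+y. ennreal (G y / I) * indicator A y \<partial>lborel)"
    proof (intro nn_integral_cong)
      fix y
      have "q * (ennreal (K * G y) / nrm) = ennreal (G y / I)"
      proof -
        have "ennreal (K * G y) / nrm = ennreal (K * G y / (r * (K * I)))"
          unfolding nrm q_def using K I0 r G(2)[of y] by (simp add: divide_ennreal flip: ennreal_mult)
        then have "q * (ennreal (K * G y) / nrm) = ennreal (r * (K * G y / (r * (K * I))))"
          using r by (simp only: q_def ennreal_mult' less_imp_le)
        also have "r * (K * G y / (r * (K * I))) = G y / I" using K I0 r by simp
        finally show ?thesis .
      qed
      then show "q * ((ennreal (K * G y) / nrm) * indicator A y) = ennreal (G y / I) * indicator A y"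
        by (simp add: mult.assoc[symmetric])
    qed
    also have "\<dots> = emeasure (density lborel (\<lambda>y. ennreal (G y / I))) A"
      by (rule emeasure_density[symmetric]) measurable
    finally show "emeasure (distr P lborel (\<lambda>\<theta>. s *\<^sub>R (\<theta> - c))) A = emeasure (density lborel (\<lambda>y. ennreal (G y / I))) A" .
  qed simp
  then have "AE y in lborel. ennreal (G y / I) = RN_deriv lborel (distr P lborel (\<lambda>\<theta>. s *\<^sub>R (\<theta> - c))) y"
    by (intro sigma_finite_measure.RN_deriv_unique[OF sigma_finite_lborel]) auto
  then show ?thesis
  proof (rule AE_mp, intro AE_I2 impI)
    fix y assume "ennreal (G y / I) = RN_deriv lborel (distr P lborel (\<lambda>\<theta>. s *\<^sub>R (\<theta> - c))) y"
    then have "rescaled_density P c t y = enn2real (ennreal (G y / I))" by (simp add: rescaled_density_def s_def)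
    then show "rescaled_density P c t y = G y / (\<integral>y. G y \<partial>lborel)" using G(2)[of y] I0 by (simp add: I_def[symmetric])
  qed
qed

section \<open>From the posterior to local densities\<close>

definition cumulative_weight :: "real^'m::finite^'m \<Rightarrow> nat \<Rightarrow> 'm \<Rightarrow> 'm \<Rightarrow> real" where
  "cumulative_weight A t j i = (\<Sum>k=1..t. matrix_power A (t - k) $ j $ i)"

lemma B_fun_eq_cumulative_weight: "B_fun A \<psi> t j \<theta> = (\<Sum>i\<in>UNIV. cumulative_weight A t j i * \<psi> i \<theta>)"
  unfolding B_fun_def cumulative_weight_def sum_distrib_right by (rule sum.swap)

lemma gradient_eqI:
  assumes "GDERIV f x :> D"
  shows "gradient f x = D"
  unfolding gradient_def
proof (rule the_equality[where P = "\<lambda>D. GDERIV f x :> D", OF assms])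
  fix D' assume "GDERIV f x :> D'"
  then have "(\<lambda>h. h \<bullet> D') = (\<lambda>h. h \<bullet> D)"
    using assms unfolding gderiv_def by (rule has_derivative_unique)
  then have "(D' - D) \<bullet> D' = (D' - D) \<bullet> D" by metis
  then have "(D' - D) \<bullet> (D' - D) = 0" by (simp add: inner_diff_right)
  then show "D' = D" by simp
qed

lemma gradient_B_fun:
  assumes "\<And>i. GDERIV (\<psi> i) \<theta> :> \<mu> i \<theta>"
  shows "gradient (B_fun A \<psi> t j) \<theta> = (\<Sum>i\<in>UNIV. cumulative_weight A t j i *\<^sub>R \<mu> i \<theta>)"
proof (rule gradient_eqI)
  have "((\<lambda>\<theta>. \<Sum>i\<in>UNIV. cumulative_weight A t j i * \<psi> i \<theta>) has_derivative
     (\<lambda>d. \<Sum>i\<in>UNIV. cumulative_weight A t j i * (d \<bullet> \<mu> i \<theta>))) (at \<theta>)"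
    using assms unfolding gderiv_def by (intro has_derivative_sum has_derivative_mult_right) auto
  then show "GDERIV (B_fun A \<psi> t j) \<theta> :> (\<Sum>i\<in>UNIV. cumulative_weight A t j i *\<^sub>R \<mu> i \<theta>)"
    by (simp add: gderiv_def B_fun_eq_cumulative_weight[abs_def] inner_sum_right)
qed

text \<open>The logarithm of the weighted likelihood is
  \<open>H + \<theta> \<bullet> stat - B \<theta>\<close>. The equation \<open>grad\<close>
  identifies \<open>stat\<close> with the gradient of \<open>B\<close> at \<open>c\<close>, so what
  remains after subtracting the value at \<open>c\<close> is minus the weighted Bregman sum.\<close>

lemma (in local_quadratic) posterior_weight_eq_local_density:
  fixes \<pi> :: "'a \<Rightarrow> real" and T :: "'m \<Rightarrow> 'x \<Rightarrow> 'a"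
  assumes grad: "(\<Sum>i\<in>UNIV. C i *\<^sub>R \<mu> i c) = (\<Sum>k=1..t. \<Sum>i\<in>UNIV. v k i *\<^sub>R T i (x k i))"
    and C: "\<And>i. C i = (\<Sum>k=1..t. v k i)"
    and hpos: "\<And>k i. 1 \<le> k \<Longrightarrow> 0 < h (x k i)" and t: "0 < t"
  shows "\<exists>K>0. \<forall>\<theta>\<in>\<Theta>.
    (\<Prod>k=1..t. \<Prod>i\<in>UNIV. (h (x k i) * exp (\<theta> \<bullet> T i (x k i) - \<psi> i \<theta>)) powr v k i) * \<pi> \<theta>
      = K * local_density \<pi> (real t) c (\<lambda>i. C i / real t) (sqrt (real t) *\<^sub>R (\<theta> - c))"
proof -
  define stat where "stat = (\<Sum>k=1..t. \<Sum>i\<in>UNIV. v k i *\<^sub>R T i (x k i))"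
  define B where "B \<theta> = (\<Sum>i\<in>UNIV. C i * \<psi> i \<theta>)" for \<theta>
  define H where "H = (\<Sum>k=1..t. \<Sum>i\<in>UNIV. v k i * ln (h (x k i)))"
  have prod: "(\<Prod>k=1..t. \<Prod>i\<in>UNIV. (h (x k i) * exp (\<theta> \<bullet> T i (x k i) - \<psi> i \<theta>)) powr v k i) = exp (H + \<theta> \<bullet> stat - B \<theta>)" for \<theta>
  proof -
    have "(\<Prod>k=1..t. \<Prod>i\<in>UNIV. (h (x k i) * exp (\<theta> \<bullet> T i (x k i) - \<psi> i \<theta>)) powr v k i)
      = (\<Prod>k=1..t. \<Prod>i\<in>UNIV. exp (v k i * ln (h (x k i)) + v k i * (\<theta> \<bullet> T i (x k i)) - v k i * \<psi> i \<theta>))"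
    proof (intro prod.cong refl)
      fix k i assume "k \<in> {1..t}"
      then have "h (x k i) > 0" by (intro hpos) auto
      then show "(h (x k i) * exp (\<theta> \<bullet> T i (x k i) - \<psi> i \<theta>)) powr v k i
        = exp (v k i * ln (h (x k i)) + v k i * (\<theta> \<bullet> T i (x k i)) - v k i * \<psi> i \<theta>)"
        by (simp add: powr_def ln_mult algebra_simps)
    qed
    also have "\<dots> = exp (\<Sum>k=1..t. \<Sum>i\<in>UNIV. v k i * ln (h (x k i)) + v k i * (\<theta> \<bullet> T i (x k i)) - v k i * \<psi> i \<theta>)"
      by (simp add: exp_sum)
    also have "(\<Sum>k=1..t. \<Sum>i\<in>UNIV. v k i * ln (h (x k i)) + v k i * (\<theta> \<bullet> T i (x k i)) - v k i * \<psi> i \<theta>)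
      = H + \<theta> \<bullet> stat - (\<Sum>k=1..t. \<Sum>i\<in>UNIV. v k i * \<psi> i \<theta>)"
      by (simp add: H_def stat_def sum.distrib sum_subtractf inner_sum_right)
    also have "(\<Sum>k=1..t. \<Sum>i\<in>UNIV. v k i * \<psi> i \<theta>) = B \<theta>"
      unfolding B_def C sum_distrib_right by (rule sum.swap)
    finally show ?thesis .
  qed
  have breg: "(\<Sum>i\<in>UNIV. C i * bregman i c (\<theta> - c)) = B \<theta> - B c - (\<theta> - c) \<bullet> stat" for \<theta>
  proof -
    have "(\<theta> - c) \<bullet> stat = (\<Sum>i\<in>UNIV. C i * ((\<theta> - c) \<bullet> \<mu> i c))"
      unfolding stat_def grad[symmetric] by (simp add: inner_sum_right)
    then show ?thesis by (simp add: B_def bregman_def right_diff_distrib sum_subtractf)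
  qed
  show ?thesis
  \<comment> \<open>The constant is the weighted likelihood at \<open>c\<close>.\<close>
  proof (intro exI[of _ "exp (H + c \<bullet> stat - B c)"] conjI ballI)
    show "0 < exp (H + c \<bullet> stat - B c)" by simp
    fix \<theta> assume \<theta>: "\<theta> \<in> \<Theta>"
    have "local_density \<pi> (real t) c (\<lambda>i. C i / real t) (sqrt (real t) *\<^sub>R (\<theta> - c))
       = exp (- (B \<theta> - B c - (\<theta> - c) \<bullet> stat)) * \<pi> \<theta>"
      unfolding breg[symmetric] using t \<theta> by (simp add: local_density_def)
    then show "(\<Prod>k=1..t. \<Prod>i\<in>UNIV. (h (x k i) * exp (\<theta> \<bullet> T i (x k i) - \<psi> i \<theta>)) powr v k i) * \<pi> \<theta>
      = exp (H + c \<bullet> stat - B c) * local_density \<pi> (real t) c (\<lambda>i. C i / real t) (sqrt (real t) *\<^sub>R (\<theta> - c))"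
      unfolding prod by (simp add: inner_diff_left algebra_simps flip: exp_add)
  qed
qed

lemma rescaled_posterior_eq_local_density:
  fixes A :: "real^'m::finite^'m" and \<theta>0 :: "real^'p::finite"
  assumes lq: "local_quadratic \<Theta> \<psi> \<mu> Q \<theta>0"
    and sym: "transpose A = A" and t: "0 < t" and hpos: "\<And>k i. 1 \<le> k \<Longrightarrow> 0 < h (x k i)"
    and grad: "(\<Sum>i\<in>UNIV. cumulative_weight A t j i *\<^sub>R \<mu> i c) = chi_stat A T x t j"
    and \<pi>0: "\<And>\<theta>. 0 \<le> \<pi> \<theta>"
  defines "G \<equiv> local_quadratic.local_density \<Theta> \<psi> \<mu> \<pi> (real t) c (\<lambda>i. cumulative_weight A t j i / real t)"
  assumes G: "integrable lborel G" "0 < (\<integral>y. G y \<partial>lborel)"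
  shows "AE y in lborel. rescaled_density (posterior \<Theta> A (\<lambda>j. expfam_density h (T j) (\<psi> j)) \<pi> x t j) c t y
    = G y / (\<integral>y. G y \<partial>lborel)"
proof -
  interpret local_quadratic \<Theta> \<psi> \<mu> Q \<theta>0 by (rule lq)
  \<comment> \<open>The posterior uses the entries \<open>i, j\<close> of the powers, whereas
    \<open>chi_stat\<close> and \<open>B_fun\<close> use \<open>j, i\<close>; symmetry of
    \<open>A\<close> reconciles them.\<close>
  have symA: "matrix_power A n $ i $ j = matrix_power A n $ j $ i" for n i
  proof -
    have "matrix_power A n $ j $ i = transpose (matrix_power A n) $ i $ j" by (simp add: transpose_def)
    then show ?thesis by (simp add: matrix_power_symmetric[OF sym])
  qed
  obtain K where K: "0 < K" "\<And>\<theta>. \<theta> \<in> \<Theta> \<Longrightarrow>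
    (\<Prod>k=1..t. \<Prod>i\<in>UNIV. (h (x k i) * exp (\<theta> \<bullet> T i (x k i) - \<psi> i \<theta>)) powr (matrix_power A (t - k) $ j $ i)) * \<pi> \<theta>
      = K * G (sqrt (real t) *\<^sub>R (\<theta> - c))"
    using posterior_weight_eq_local_density[where h = h and x = x and \<pi> = \<pi>,
        OF grad[unfolded chi_stat_def] cumulative_weight_def hpos t]
    unfolding G_def by auto
  have eq: "ennreal (posterior_weight A (\<lambda>j. expfam_density h (T j) (\<psi> j)) \<pi> x t j \<theta>) * indicator \<Theta> \<theta>
    = ennreal (K * G (sqrt (real t) *\<^sub>R (\<theta> - c)))" for \<theta>
  proof (cases "\<theta> \<in> \<Theta>")
    case True
    then show ?thesis using K(2)[OF True] by (simp add: posterior_weight_def expfam_density_def symA)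
  next
    case False
    then show ?thesis using t by (simp add: G_def local_density_def)
  qed
  have G0: "0 \<le> G y" for y using \<pi>0 by (simp add: G_def local_density_def)
  show ?thesis
    by (rule rescaled_density_affine[OF G(1) G0 G(2) K(1) t]) (simp add: posterior_def posterior_normalizer_def eq)
qed

section \<open>Convergence in probability of the posterior densities\<close>

theorem proposition24:
  fixes \<nu> P0 :: "'x measure"
    and M :: "'w measure"
    and X :: "nat \<Rightarrow> 'm::finite \<Rightarrow> 'w \<Rightarrow> 'x"
    and \<Theta> :: "(real^'p) set"
    and h :: "'x \<Rightarrow> real"
    and T :: "'m \<Rightarrow> 'x \<Rightarrow> real^'p"
    and \<psi> :: "'m \<Rightarrow> real^'p \<Rightarrow> real"
    and g \<psi>0 :: "real^'p \<Rightarrow> real"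
    and u \<theta>0 :: "real^'p"
    and E :: "('m \<times> 'm) set"
    and A :: "real^'m^'m"
  defines "p \<equiv> \<lambda>j. expfam_density h (T j) (\<psi> j)"
    and "P \<equiv> \<lambda>j \<theta>. density \<nu> (\<lambda>x. ennreal (expfam_density h (T j) (\<psi> j) \<theta> x))"
    and "\<pi> \<equiv> prior_density g \<psi>0 u"
    and "V \<equiv> (1 / real CARD('m)) *\<^sub>R (\<Sum>i\<in>UNIV.
               cov_matrix (density \<nu> (\<lambda>x. ennreal (expfam_density h (T i) (\<psi> i) \<theta>0 x))) (T i))"
  assumes "open \<Theta>"
    and "h \<in> borel_measurable \<nu>" and "\<And>x. x \<in> space \<nu> \<Longrightarrow> 0 \<le> h x"
    and "\<And>j. T j \<in> borel_measurable \<nu>"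
    and "\<And>j \<theta>. \<theta> \<in> \<Theta> \<Longrightarrow> prob_space (P j \<theta>)"
    and "set_borel_measurable lborel \<Theta> \<pi>"
    and "(\<integral>\<^sup>+\<theta>. ennreal (\<pi> \<theta>) * indicator \<Theta> \<theta> \<partial>lborel) = 1"
    and "isCont \<psi>0 \<theta>0"
    and "\<theta>0 \<in> \<Theta>" and "\<And>j. P j \<theta>0 = P0"
    and "\<And>\<theta>. \<theta> \<in> \<Theta> \<Longrightarrow> \<theta> \<noteq> \<theta>0 \<Longrightarrow>
           (\<Sum>j\<in>UNIV. KL_divergence (exp 1) (P j \<theta>0) P0) < (\<Sum>j\<in>UNIV. KL_divergence (exp 1) (P j \<theta>) P0)"
    and "\<And>j \<theta>. \<theta> \<in> \<Theta> \<Longrightarrow> integrable P0 (\<lambda>x. ln (p j \<theta> x))"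
    and "sym E" and "\<And>i j. (i, j) \<in> E\<^sup>*"
    and "weighted_adjacency E A" and "transpose A = A" and "row_stochastic A" and "\<And>i. 0 < A $ i $ i"
    and "prob_space M"
    and "prob_space.indep_vars M (\<lambda>_. \<nu>) (\<lambda>(k, j). X k j) ({1..} \<times> UNIV)"
    and "\<And>k j. 1 \<le> k \<Longrightarrow> distr M \<nu> (X k j) = P0"
    and "\<And>t j. 1 \<le> t \<Longrightarrow>
           AE \<omega> in M. posterior_normalizer \<Theta> A p \<pi> (\<lambda>k i. X k i \<omega>) t j < \<infinity>"
    and "\<And>t j. 1 \<le> t \<Longrightarrow>
           AE \<omega> in M. chi_stat A T (\<lambda>k i. X k i \<omega>) t j \<in> gradient (B_fun A \<psi> t j) ` \<Theta>"
  shows "\<forall>j. tendsto_in_probability M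
           (\<lambda>t \<omega>. \<integral>y. \<bar>rescaled_density (posterior \<Theta> A p \<pi> (\<lambda>k i. X k i \<omega>) t j)
                           (theta_hat \<Theta> A T \<psi> (\<lambda>k i. X k i \<omega>) t j) t y
                         - mvnormal_density 0 (matrix_inv V) y\<bar> \<partial>lborel)
           0"
proof
  fix j :: 'm
  note [measurable] = assms(6)
  have Theta: "open \<Theta>" "\<theta>0 \<in> \<Theta>" by fact+
  have P_P0: "density \<nu> (\<lambda>x. ennreal (expfam_density h (T i) (\<psi> i) \<theta>0 x)) = P0" for i
    using assms(14)[of i] by (simp add: P_def)
  have EF: "expfam_model \<nu> h (T i) \<Theta> (\<psi> i)" for i
  proof -
    have "prob_space (density \<nu> (\<lambda>x. ennreal (expfam_density h (T i) (\<psi> i) \<theta> x)))" if "\<theta> \<in> \<Theta>" for \<theta>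
      using assms(9)[OF that, of i] by (simp add: P_def)
    then show ?thesis unfolding expfam_model_def using assms(5-8) by blast
  qed
  interpret F: expfam_model \<nu> h "T i" \<Theta> "\<psi> i" for i by (rule EF)
  define m where "m = real CARD('m)"
  have m: "m > 0" by (simp add: m_def)
  define Q where "Q i d = d \<bullet> (cov_matrix P0 (T i) *v d)" for i d
  define \<mu> where "\<mu> i = F.mean_param i" for i
  have V: "V = (1 / m) *\<^sub>R (\<Sum>i\<in>UNIV. cov_matrix P0 (T i))" by (simp add: V_def P_P0 m_def)
  have Q_cov: "Q i d = F.cov_form i \<theta>0 d d" for i d
    using F.cov_matrix_quadratic_form[OF Theta(2), of d i] by (simp add: Q_def P_P0)
  have V_quad: "d \<bullet> (V *v d) = (\<Sum>i\<in>UNIV. Q i d) / m" for d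
  proof -
    have "(\<Sum>i\<in>I. cov_matrix P0 (T i)) *v d = (\<Sum>i\<in>I. cov_matrix P0 (T i) *v d)" for I
      by (induction I rule: infinite_finite_induct) (auto simp: matrix_vector_mult_add_rdistrib)
    then show ?thesis
      by (simp add: V Q_def scaleR_matrix_vector_assoc[symmetric] inner_sum_right)
  qed
  have V_sym: "transpose V = V"
    using F.cov_matrix_symmetric[of P0] unfolding V
    by (simp add: vec_eq_iff transpose_def sum_component)
  have V_pos: "0 < d \<bullet> (V *v d)" if d: "d \<noteq> 0" for d
  proof (rule ccontr)
    have Q0: "0 \<le> Q i d" for i unfolding Q_cov by (rule F.cov_form_nonneg[OF Theta(2)])
    assume "\<not> 0 < d \<bullet> (V *v d)"
    then have "(\<Sum>i\<in>UNIV. Q i d) \<le> 0" using m by (simp add: V_quad zero_less_divide_iff not_less)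
    then have "(\<Sum>i\<in>UNIV. Q i d) = 0" using Q0 by (intro antisym sum_nonneg) auto
    then have Qz: "Q i d = 0" for i using Q0 by (subst (asm) sum_nonneg_eq_0_iff) auto
    obtain e where e: "e > 0" "ball \<theta>0 e \<subseteq> \<Theta>" using Theta by (meson openE)
    define s where "s = e / (2 * norm d)"
    have s: "s > 0" using e d by (simp add: s_def)
    have "norm (s *\<^sub>R d) < e" using e d by (simp add: s_def)
    then have in\<Theta>: "\<theta>0 + s *\<^sub>R d \<in> \<Theta>" using e(2) by (auto simp: subset_iff dist_norm)
    have "P i (\<theta>0 + s *\<^sub>R d) = P i \<theta>0" for i
      unfolding P_def using Qz[of i] by (intro F.model_shift_eq_of_cov_form_eq_0 Theta in\<Theta>) (simp add: Q_cov)
    then show False using assms(15)[OF in\<Theta>] s d by simp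
  qed
  have LQ: "local_quadratic \<Theta> \<psi> \<mu> Q \<theta>0"
  proof
    show "continuous_on \<Theta> (\<psi> i)" for i
      using F.isCont_log_partition by (simp add: continuous_at_imp_continuous_on)
    show "\<psi> i a + (b - a) \<bullet> \<mu> i a \<le> \<psi> i b" if "a \<in> \<Theta>" "b \<in> \<Theta>" for i a b
      unfolding \<mu>_def by (rule F.log_partition_convex[OF that])
    show "\<exists>r>0. \<forall>a d. a \<in> ball \<theta>0 r \<longrightarrow> a + d \<in> ball \<theta>0 r \<longrightarrow>
       \<bar>\<psi> i (a + d) - \<psi> i a - d \<bullet> \<mu> i a - Q i d / 2\<bar> \<le> \<eta> * (norm d)\<^sup>2" if "\<eta> > 0" for i \<eta>
      by (rule F.log_partition_quadratic[OF Theta(2) that, of i]) (auto simp: Q_cov \<mu>_def)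
    show "Q i \<in> borel_measurable borel" for i unfolding Q_def[abs_def] by measurable
    show "Q i (c *\<^sub>R d) = c\<^sup>2 * Q i d" for i c d
      by (simp add: Q_def matrix_vector_mult_scaleR power2_eq_square)
    show "\<exists>l>0. \<forall>d. l * (norm d)\<^sup>2 \<le> (\<Sum>i\<in>UNIV. Q i d) / real CARD('m)"
      using posdef_lower_bound[of V, OF V_pos] by (simp add: V_quad m_def)
  qed (fact Theta)+
  interpret LQ: local_quadratic \<Theta> \<psi> \<mu> Q \<theta>0 by (rule LQ)
  \<comment> \<open>\<open>ennreal\<close> sends negative reals to 0, so a nonpositive
    \<open>g u\<close> would give a prior of mass 0 instead of 1.\<close>
  have gpos: "0 < g u"
  proof (rule ccontr)
    assume "\<not> 0 < g u"
    then have "ennreal (\<pi> \<theta>) = 0" for \<theta>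
      by (simp add: \<pi>_def prior_density_def ennreal_neg mult_nonpos_nonneg)
    then show False using assms(11) by simp
  qed
  have \<pi>_pos: "0 < \<pi> \<theta>" for \<theta> using gpos by (simp add: \<pi>_def prior_density_def)
  have \<pi>_nonneg: "0 \<le> \<pi> \<theta>" for \<theta> using \<pi>_pos[of \<theta>] by simp
  have \<pi>_meas: "(\<lambda>x. indicator \<Theta> x * \<pi> x) \<in> borel_measurable borel"
    using assms(10) by (simp add: set_borel_measurable_def)
  have \<pi>_int: "(\<integral>\<^sup>+x. ennreal (indicator \<Theta> x * \<pi> x) \<partial>lborel) = 1"
    unfolding assms(11)[symmetric] by (intro nn_integral_cong) (auto simp: indicator_def)
  have \<pi>_cont: "isCont \<pi> \<theta>0"
    unfolding \<pi>_def prior_density_def using assms(12) by (intro continuous_intros)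
  have normal: "mvnormal_density 0 (matrix_inv V) y
      = LQ.limit_density \<pi> y / (\<integral>y. LQ.limit_density \<pi> y \<partial>lborel)" for y
    using \<pi>_pos[of \<theta>0]
    by (subst mvnormal_density_precision[OF V_sym V_pos])
      (simp_all add: LQ.limit_density_def[abs_def] V_quad m_def)
  obtain r \<kappa> where r: "r > 0" "\<kappa> > 0" and
    close: "\<And>a d w. a \<in> ball \<theta>0 r \<Longrightarrow> a + d \<in> \<Theta> \<Longrightarrow> LQ.admissible_weights w \<Longrightarrow>
        \<kappa> * norm d * min (norm d) r \<le> (\<Sum>i\<in>UNIV. w i * LQ.bregman i a d)"
    using LQ.bregman_sum_lower_bound by blast
  interpret M: prob_space M by fact
  have grad: "gradient (B_fun A \<psi> t j) \<theta> = (\<Sum>i\<in>UNIV. cumulative_weight A t j i *\<^sub>R \<mu> i \<theta>)" if "\<theta> \<in> \<Theta>" for t \<theta>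
    unfolding \<mu>_def by (rule gradient_B_fun) (rule F.GDERIV_log_partition[OF that])
  define w where "w t i = cumulative_weight A t j i / real t" for t i
  have w_lim: "(\<lambda>t. w t i) \<longlonglongrightarrow> 1 / m" for i
    unfolding w_def cumulative_weight_def m_def by (rule matrix_power_Cesaro) fact+
  have A01: "\<bar>matrix_power A n $ j $ i\<bar> \<le> 1" for n i
    using matrix_power_nonneg[of A n j i] matrix_power_le_1[of A n j i] assms by simp
  have "\<exists>K. \<forall>t w \<eta>. 0 < t \<longrightarrow> (\<forall>k i. \<bar>w k i\<bar> \<le> 1) \<longrightarrow> 0 < \<eta> \<longrightarrow>
    {\<omega> \<in> space M. \<eta> * real t \<le> norm (\<Sum>k=1..t. \<Sum>i\<in>UNIV. w k i *\<^sub>R (T i (X k i \<omega>) - \<mu> i \<theta>0))} \<in> M.events \<and>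
    M.prob {\<omega> \<in> space M. \<eta> * real t \<le> norm (\<Sum>k=1..t. \<Sum>i\<in>UNIV. w k i *\<^sub>R (T i (X k i \<omega>) - \<mu> i \<theta>0))} \<le> K / (\<eta>\<^sup>2 * real t)"
  proof (rule M.prob_weighted_sum_deviation_le[of \<nu> X P0 T "\<lambda>i. \<mu> i \<theta>0"])
    show "M.indep_vars (\<lambda>_. \<nu>) (\<lambda>(k, j). X k j) ({1..} \<times> UNIV)" by fact
    show "distr M \<nu> (X k i) = P0" if "1 \<le> k" for k i by (rule assms(25)[OF that])
    show "T i \<in> borel_measurable \<nu>" for i by (rule assms(8))
    show "integrable P0 (\<lambda>x. b \<bullet> T i x)" for i b
      using F.integrable_model_inner[OF Theta(2), where i = i and d = b] by (simp add: P_P0)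
    show "integrable P0 (\<lambda>x. (b \<bullet> T i x) * (b \<bullet> T i x))" for i b
      using F.integrable_model_inner_mult[OF Theta(2), where i = i and d = b and e = b] by (simp add: P_P0)
    show "(\<integral>x. b \<bullet> T i x \<partial>P0) = b \<bullet> \<mu> i \<theta>0" for i b
      using F.mean_model[OF Theta(2), where i = i and d = b] by (simp add: P_P0 \<mu>_def)
  qed
  then obtain K where K: "\<forall>t w \<eta>. 0 < t \<longrightarrow> (\<forall>k i. \<bar>w k i\<bar> \<le> 1) \<longrightarrow> 0 < \<eta> \<longrightarrow>
    {\<omega> \<in> space M. \<eta> * real t \<le> norm (\<Sum>k=1..t. \<Sum>i\<in>UNIV. w k i *\<^sub>R (T i (X k i \<omega>) - \<mu> i \<theta>0))} \<in> M.events \<and>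
    M.prob {\<omega> \<in> space M. \<eta> * real t \<le> norm (\<Sum>k=1..t. \<Sum>i\<in>UNIV. w k i *\<^sub>R (T i (X k i \<omega>) - \<mu> i \<theta>0))} \<le> K / (\<eta>\<^sup>2 * real t)" ..
  have X_meas: "X k i \<in> measurable M \<nu>" if "1 \<le> k" for k i
    using assms(24) that unfolding M.indep_vars_def by (auto simp: Ball_def)
  have hpos: "AE \<omega> in M. \<forall>k i. 1 \<le> k \<longrightarrow> 0 < h (X k i \<omega>)"
  proof -
    have "AE \<omega> in M. 0 < h (X k i \<omega>)" if k: "1 \<le> k" for k i
    proof (rule AE_distrD[OF X_meas[OF k]])
      show "AE x in distr M \<nu> (X k i). 0 < h x"
        unfolding assms(25)[OF k] by (rule F.AE_model_h_pos[of i \<theta>0, unfolded P_P0])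
    qed
    then have "AE \<omega> in M. 1 \<le> k \<longrightarrow> 0 < h (X k i \<omega>)" for k i by (cases "1 \<le> k") auto
    then show ?thesis by (simp add: AE_all_countable)
  qed
  define L1 where "L1 t \<omega> = (\<integral>y. \<bar>rescaled_density (posterior \<Theta> A p \<pi> (\<lambda>k i. X k i \<omega>) t j)
                           (theta_hat \<Theta> A T \<psi> (\<lambda>k i. X k i \<omega>) t j) t y
                         - mvnormal_density 0 (matrix_inv V) y\<bar> \<partial>lborel)" for t \<omega>
  show "tendsto_in_probability M (\<lambda>t \<omega>. \<integral>y. \<bar>rescaled_density (posterior \<Theta> A p \<pi> (\<lambda>k i. X k i \<omega>) t j)
                           (theta_hat \<Theta> A T \<psi> (\<lambda>k i. X k i \<omega>) t j) t y
                         - mvnormal_density 0 (matrix_inv V) y\<bar> \<partial>lborel) 0"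
    unfolding tendsto_in_probability_def L1_def[symmetric]
  proof (intro allI impI)
    fix \<epsilon> :: real assume \<epsilon>: "0 < \<epsilon>"
    obtain \<delta> where \<delta>: "\<delta> > 0" and small: "\<forall>a t w. dist a \<theta>0 < \<delta> \<longrightarrow> t > 1 / \<delta> \<longrightarrow> (\<forall>i. \<bar>w i - 1 / CARD('m)\<bar> < \<delta>) \<longrightarrow>
      integrable lborel (LQ.local_density \<pi> t a w) \<and> 0 < (\<integral>y. LQ.local_density \<pi> t a w y \<partial>lborel) \<and>
      (\<integral>y. \<bar>LQ.local_density \<pi> t a w y / (\<integral>y. LQ.local_density \<pi> t a w y \<partial>lborel)
         - LQ.limit_density \<pi> y / (\<integral>y. LQ.limit_density \<pi> y \<partial>lborel)\<bar> \<partial>lborel) < \<epsilon>"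
      using LQ.local_density_L1[OF \<pi>_meas \<pi>_nonneg \<pi>_int \<pi>_cont \<pi>_pos \<epsilon>] by blast
    \<comment> \<open>Matched to \<open>critical_point_close\<close>: a gradient difference below
      this forces the estimator to within \<open>\<delta>\<close> of
      \<open>\<theta>0\<close>.\<close>
    define \<eta> where "\<eta> = \<kappa> * min \<delta> r"
    have \<eta>: "\<eta> > 0" using r \<delta> by (simp add: \<eta>_def)
    \<comment> \<open>The exceptional event: \<open>chi_stat\<close> deviates from its mean by at
      least \<open>\<eta> * real t\<close>. It does not mention the estimator and is therefore
      measurable.\<close>
    define D where "D t = {\<omega> \<in> space M. \<eta> * real t \<le>
      norm (\<Sum>k=1..t. \<Sum>i\<in>UNIV. (matrix_power A (t - k) $ j $ i) *\<^sub>R (T i (X k i \<omega>) - \<mu> i \<theta>0))}" for t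
    have D: "D t \<in> M.events" "M.prob (D t) \<le> K / (\<eta>\<^sup>2 * real t)" if "0 < t" for t
      using K[rule_format, OF that, of "\<lambda>k i. matrix_power A (t - k) $ j $ i", OF A01 \<eta>] by (auto simp: D_def)
    have bound: "outer_measure_of M {\<omega> \<in> space M. \<epsilon> \<le> \<bar>L1 t \<omega> - 0\<bar>} \<le> ennreal (K / (\<eta>\<^sup>2 * real t))"
      \<comment> \<open>The first bound on the weights is the closeness required for L1 convergence,
        the second makes them admissible.\<close>
      if t: "0 < t" "real t > 1 / \<delta>" and wt: "\<And>i. \<bar>w t i - 1 / m\<bar> < min \<delta> (1 / (2 * m))" for t
    proof -
      have adm: "LQ.admissible_weights (w t)"
        unfolding LQ.admissible_weights_def
      proof
        fix i
        have "1 / m = 2 * (1 / (2 * m))" by simp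
        then show "1 / (2 * real CARD('m)) \<le> w t i" using wt[of i] unfolding m_def by linarith
      qed
      have "AE \<omega> in M. \<omega> \<notin> D t \<longrightarrow> L1 t \<omega> < \<epsilon>"
      proof -
        have "AE \<omega> in M. chi_stat A T (\<lambda>k i. X k i \<omega>) t j \<in> gradient (B_fun A \<psi> t j) ` \<Theta>"
          using assms(27) t by simp
        then show ?thesis using hpos AE_space
        proof eventually_elim
          case (elim \<omega>)
          show ?case
          proof
            assume nD: "\<omega> \<notin> D t"
            define x where "x = (\<lambda>k i. X k i \<omega>)"
            define c where "c = theta_hat \<Theta> A T \<psi> x t j"
            have c: "c \<in> \<Theta>" "gradient (B_fun A \<psi> t j) c = chi_stat A T x t j"
              unfolding c_def theta_hat_def using elim(1)
              by (auto simp: x_def intro: inv_into_into f_inv_into_f)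
            have gc: "(\<Sum>i\<in>UNIV. cumulative_weight A t j i *\<^sub>R \<mu> i c) = chi_stat A T x t j"
              using c grad by simp
            \<comment> \<open>Since \<open>chi_stat\<close> is the gradient of \<open>B_fun\<close>
              at \<open>c\<close>, its deviation from the mean is \<open>real t\<close> times the
              difference of averaged gradients at \<open>c\<close> and
              \<open>\<theta>0\<close>.\<close>
            have dev: "(\<Sum>k=1..t. \<Sum>i\<in>UNIV. (matrix_power A (t - k) $ j $ i) *\<^sub>R (T i (X k i \<omega>) - \<mu> i \<theta>0))
              = real t *\<^sub>R ((\<Sum>i\<in>UNIV. w t i *\<^sub>R \<mu> i c) - (\<Sum>i\<in>UNIV. w t i *\<^sub>R \<mu> i \<theta>0))"
            proof -
              have "(\<Sum>k=1..t. \<Sum>i\<in>UNIV. (matrix_power A (t - k) $ j $ i) *\<^sub>R (T i (X k i \<omega>) - \<mu> i \<theta>0))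
                = chi_stat A T x t j - (\<Sum>k=1..t. \<Sum>i\<in>UNIV. (matrix_power A (t - k) $ j $ i) *\<^sub>R \<mu> i \<theta>0)"
                by (simp add: chi_stat_def x_def scaleR_diff_right sum_subtractf)
              also have "(\<Sum>k=1..t. \<Sum>i\<in>UNIV. (matrix_power A (t - k) $ j $ i) *\<^sub>R \<mu> i \<theta>0)
                = (\<Sum>i\<in>UNIV. cumulative_weight A t j i *\<^sub>R \<mu> i \<theta>0)"
                unfolding cumulative_weight_def scaleR_sum_left by (rule sum.swap)
              also have "chi_stat A T x t j - (\<Sum>i\<in>UNIV. cumulative_weight A t j i *\<^sub>R \<mu> i \<theta>0)
                = real t *\<^sub>R ((\<Sum>i\<in>UNIV. w t i *\<^sub>R \<mu> i c) - (\<Sum>i\<in>UNIV. w t i *\<^sub>R \<mu> i \<theta>0))"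
                unfolding gc[symmetric] w_def using t by (simp add: scaleR_diff_right scaleR_sum_right)
              finally show ?thesis .
            qed
            have "\<omega> \<in> space M" by (rule elim(3))
            then have "real t * norm ((\<Sum>i\<in>UNIV. w t i *\<^sub>R \<mu> i c) - (\<Sum>i\<in>UNIV. w t i *\<^sub>R \<mu> i \<theta>0)) < real t * \<eta>"
              using nD unfolding D_def mem_Collect_eq dev by (simp add: mult.commute)
            then have "norm ((\<Sum>i\<in>UNIV. w t i *\<^sub>R \<mu> i c) - (\<Sum>i\<in>UNIV. w t i *\<^sub>R \<mu> i \<theta>0)) < \<eta>"
              using t by simp
            moreover have "\<kappa> * min (dist c \<theta>0) r \<le> norm ((\<Sum>i\<in>UNIV. w t i *\<^sub>R \<mu> i c) - (\<Sum>i\<in>UNIV. w t i *\<^sub>R \<mu> i \<theta>0))"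
            proof (rule LQ.critical_point_close[OF _ r c(1) adm])
              fix d w assume "\<theta>0 + d \<in> \<Theta>" "LQ.admissible_weights w"
              then show "\<kappa> * norm d * min (norm d) r \<le> (\<Sum>i\<in>UNIV. w i * LQ.bregman i \<theta>0 d)"
                using r(1) by (intro close) simp_all
            qed
            ultimately have "\<kappa> * min (dist c \<theta>0) r < \<kappa> * min \<delta> r" unfolding \<eta>_def by linarith
            \<comment> \<open>A distance of at least \<open>r\<close> would make the left side
              \<open>r\<close>, which is not below \<open>min \<delta> r\<close>; so the minimum is
              the distance itself.\<close>
            then have "min (dist c \<theta>0) r < min \<delta> r" using r(2) by simp
            then have dc: "dist c \<theta>0 < \<delta>" by (auto simp: min_def split: if_splits)
            let ?G = "LQ.local_density \<pi> (real t) c (w t)"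
            have wt': "\<bar>w t i - 1 / real CARD('m)\<bar> < \<delta>" for i using wt[of i] by (simp add: m_def)
            note G = small[rule_format, OF dc t(2) wt']
            have ae: "AE y in lborel. rescaled_density (posterior \<Theta> A p \<pi> x t j) c t y = ?G y / (\<integral>y. ?G y \<partial>lborel)"
              unfolding p_def w_def
            proof (rule rescaled_posterior_eq_local_density[OF LQ])
              show "transpose A = A" by fact
              show "0 < t" by (rule t)
              show "0 < h (x k i)" if "1 \<le> k" for k i using elim(2) that by (simp add: x_def)
              show "(\<Sum>i\<in>UNIV. cumulative_weight A t j i *\<^sub>R \<mu> i c) = chi_stat A T x t j" by (rule gc)
              show "0 \<le> \<pi> \<theta>" for \<theta> by (rule \<pi>_nonneg)
            qed (use G in \<open>auto simp: w_def[abs_def]\<close>)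
            have [measurable]: "?G \<in> borel_measurable borel" by (rule LQ.local_density_measurable[OF \<pi>_meas])
            have [measurable]: "LQ.limit_density \<pi> \<in> borel_measurable borel"
              using LQ.integrable_limit_density[of \<pi>, OF \<pi>_nonneg] by (simp add: borel_measurable_integrable)
            \<comment> \<open>An almost everywhere equality suffices inside the integral. The
              right-hand integrand is integrable, so the bound from \<open>small\<close> is not an
              artefact of the value 0 given to integrals that do not exist.\<close>
            have "L1 t \<omega> = (\<integral>y. \<bar>?G y / (\<integral>y. ?G y \<partial>lborel) - LQ.limit_density \<pi> y / (\<integral>y. LQ.limit_density \<pi> y \<partial>lborel)\<bar> \<partial>lborel)"
              unfolding L1_def normal x_def[symmetric] c_def[symmetric]
            proof (rule integral_cong_AE)
              show "(\<lambda>y. \<bar>rescaled_density (posterior \<Theta> A p \<pi> x t j) c t y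
                - LQ.limit_density \<pi> y / (\<integral>y. LQ.limit_density \<pi> y \<partial>lborel)\<bar>) \<in> borel_measurable lborel"
                unfolding rescaled_density_def by measurable
            qed (use ae in auto)
            then show "L1 t \<omega> < \<epsilon>" using G by simp
          qed
        qed
      qed
      \<comment> \<open>The set in question is covered by a null set and \<open>D t\<close>, both
        measurable, which bounds its outer measure without any measurability of
        \<open>L1 t\<close>.\<close>
      then obtain N where N: "N \<in> null_sets M" "{\<omega> \<in> space M. \<not> (\<omega> \<notin> D t \<longrightarrow> L1 t \<omega> < \<epsilon>)} \<subseteq> N"
        by (auto elim!: AE_E simp: null_sets_def)
      have L1_0: "0 \<le> L1 t \<omega>" for \<omega> unfolding L1_def by (intro integral_nonneg_AE) auto
      have "{\<omega> \<in> space M. \<epsilon> \<le> \<bar>L1 t \<omega> - 0\<bar>} \<subseteq> N \<union> D t"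
        using N(2) L1_0 by (auto simp: not_less)
      then have "outer_measure_of M {\<omega> \<in> space M. \<epsilon> \<le> \<bar>L1 t \<omega> - 0\<bar>} \<le> emeasure M (N \<union> D t)"
        unfolding outer_measure_of_def using N(1) D(1)[OF t(1)] by (intro INF_lower) auto
      also have "\<dots> \<le> emeasure M N + emeasure M (D t)"
        using N(1) D(1)[OF t(1)] by (intro emeasure_subadditive) auto
      also have "\<dots> = ennreal (M.prob (D t))" unfolding null_setsD1[OF N(1)] by (simp add: M.emeasure_eq_measure)
      also have "\<dots> \<le> ennreal (K / (\<eta>\<^sup>2 * real t))" by (intro ennreal_leI D(2) t)
      finally show ?thesis .
    qed
    show "(\<lambda>t. outer_measure_of M {\<omega> \<in> space M. \<epsilon> \<le> \<bar>L1 t \<omega> - 0\<bar>}) \<longlonglongrightarrow> 0"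
    proof (rule tendsto_sandwich[of "\<lambda>_. 0" _ _ "\<lambda>t. ennreal (K / (\<eta>\<^sup>2 * real t))"])
      have "(\<lambda>t. K / \<eta>\<^sup>2 * (1 / real t)) \<longlonglongrightarrow> K / \<eta>\<^sup>2 * 0"
        by (intro tendsto_mult tendsto_const lim_1_over_n)
      then have "(\<lambda>t. K / (\<eta>\<^sup>2 * real t)) \<longlonglongrightarrow> 0" by simp
      then show "(\<lambda>t. ennreal (K / (\<eta>\<^sup>2 * real t))) \<longlonglongrightarrow> 0" using tendsto_ennrealI by fastforce
      have "\<forall>\<^sub>F t in sequentially. \<bar>w t i - 1 / m\<bar> < min \<delta> (1 / (2 * m))" for i
        using tendstoD[OF w_lim[of i], of "min \<delta> (1 / (2 * m))"] \<delta> m by (simp add: dist_real_def)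
      then have "\<forall>\<^sub>F t in sequentially. \<forall>i. \<bar>w t i - 1 / m\<bar> < min \<delta> (1 / (2 * m))"
        by (rule eventually_all_finite)
      moreover have "\<forall>\<^sub>F t in sequentially. 1 / \<delta> < real t"
        using filterlim_real_sequentially by (simp add: filterlim_at_top_dense)
      ultimately show "\<forall>\<^sub>F t in sequentially. outer_measure_of M {\<omega> \<in> space M. \<epsilon> \<le> \<bar>L1 t \<omega> - 0\<bar>}
        \<le> ennreal (K / (\<eta>\<^sup>2 * real t))"
        using eventually_gt_at_top[of "0::nat"] by eventually_elim (rule bound, auto)
    qed auto
  qed
qed

end
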